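(* Let $R$ be a standard graded algebra over a field $k$ with homogeneous maximal ideal $\mathfrak m$, and let $M=\bigoplus_{i\ge 0}M_i$ be a nonzero finitely generated graded $R$-module equipped with an $\mathfrak m$-stable graded filtration $\mathbb M$. If $\operatorname{reg}_R(gr_{\mathbb M}(M))<\infty$, then $\operatorname{reg}_R(M)<\infty$. Furthermore, the converse holds provided $M$ is of homogeneous type with respect to $\mathbb M$: in that case $\operatorname{reg}_R(M)<\infty$ implies $\operatorname{reg}_R(gr_{\mathbb M}(M))<\infty$.
   Context: A standard graded $k$-algebra is $R=\bigoplus_{i\ge0}R_i$ with $R_0=k$, generated as a $k$-algebra by finitely many elements of degree 1. An $\mathfrak m$-stable filtration $\mathbb M=\{\mathfrak F_pM\}_{p\ge0}$ of $M$ is a descending chain of submodules with $\mathfrak F_0M=M$, $\mathfrak m\,\mathfrak F_pM\subseteq\mathfrak F_{p+1}M$ for all $p\ge 0$, with equality for all $p\gg0$. It is a graded filtration if every $\mathfrak F_pM$ is a graded submodule of $M$. The associated graded module is $gr_{\mathbb M}(M)=\bigoplus_{p\ge0}\mathfrak F_pM/\mathfrak F_{p+1}M$; it is a graded module (the degree $p$ part being $\mathfrak F_pM/\mathfrak F_{p+1}M$) over $R^g=\bigoplus_{p\ge0}\mathfrak m^p/\mathfrak m^{p+1}$, which is identified with $R$. For a finitely generated graded $R$-module $N$, $\beta_{ij}^R(N)=\dim_k\operatorname{Tor}_i^R(N,k)_j$, $\beta_i^R(N)=\dim_k\operatorname{Tor}^R_i(N,k)$, and $\operatorname{reg}_R(N)=\sup\{j-i:\beta^R_{ij}(N)\ne0\}$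 (possibly infinite). $M$ is of homogeneous type with respect to $\mathbb M$ if $\beta_i^R(M)=\beta_i^{R^g}(gr_{\mathbb M}(M))$ for every $i\ge0$. *)

theory Defs
  imports
    "HOL-Library.Extended_Real"
    "HOL-Algebra.Generated_Rings"
    "Jordan_Normal_Form.Missing_VectorSpace"
begin

section \<open>Gradings\<close>

definition is_decomposition ::
  "('b, 'm) ring_scheme \<Rightarrow> (nat \<Rightarrow> 'b set) \<Rightarrow> 'b \<Rightarrow> (nat \<Rightarrow> 'b) \<Rightarrow> bool" where
  "is_decomposition M G x c \<longleftrightarrow>
     (\<forall>i. c i \<in> G i) \<and> finite {i. c i \<noteq> \<zero>\<^bsub>M\<^esub>} \<and> finsum M c {i. c i \<noteq> \<zero>\<^bsub>M\<^esub>} = x"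

definition internal_direct_sum :: "('b, 'm) ring_scheme \<Rightarrow> (nat \<Rightarrow> 'b set) \<Rightarrow> bool" where
  "internal_direct_sum M G \<longleftrightarrow>
     (\<forall>i. subgroup (G i) (add_monoid M)) \<and>
     (\<forall>x\<in>carrier M. \<exists>!c. is_decomposition M G x c)"

definition hom_component ::
  "('b, 'm) ring_scheme \<Rightarrow> (nat \<Rightarrow> 'b set) \<Rightarrow> nat \<Rightarrow> 'b \<Rightarrow> 'b" where
  "hom_component M G i x = (THE c. is_decomposition M G x c) i"

text \<open>The ground field is the degree-zero part \<open>A 0\<close> of the algebra.\<close>

locale standard_graded_algebra = cring R
  for R :: "('a, 'r) ring_scheme" (structure) and A :: "nat \<Rightarrow> 'a set" +
  assumes direct_sum: "internal_direct_sum R A"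
    and mult_degree: "\<lbrakk>a \<in> A i; b \<in> A j\<rbrakk> \<Longrightarrow> a \<otimes> b \<in> A (i + j)"
    and ground_field: "subfield (A 0) R"
    and generated_in_degree_1: "\<exists>S. finite S \<and> S \<subseteq> A 1 \<and> generate_ring R (A 0 \<union> S) = carrier R"

definition ground_field_of :: "('a, 'r) ring_scheme \<Rightarrow> (nat \<Rightarrow> 'a set) \<Rightarrow> ('a, 'r) ring_scheme" where
  "ground_field_of R A = R\<lparr>carrier := A 0\<rparr>"

definition irrelevant_ideal :: "('a, 'r) ring_scheme \<Rightarrow> (nat \<Rightarrow> 'a set) \<Rightarrow> 'a set" where
  "irrelevant_ideal R A = {a \<in> carrier R. hom_component R A 0 a = \<zero>\<^bsub>R\<^esub>}"

locale graded_module = standard_graded_algebra R A + module R M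
  for R :: "('a, 'r) ring_scheme" (structure) and A :: "nat \<Rightarrow> 'a set"
    and M :: "('a, 'b, 'm) module_scheme" (structure) and G :: "nat \<Rightarrow> 'b set" +
  assumes module_direct_sum: "internal_direct_sum M G"
    and smult_degree: "\<lbrakk>a \<in> A i; x \<in> G j\<rbrakk> \<Longrightarrow> a \<odot>\<^bsub>M\<^esub> x \<in> G (i + j)"

definition finitely_generated_module ::
  "('a, 'r) ring_scheme \<Rightarrow> ('a, 'b, 'm) module_scheme \<Rightarrow> bool" where
  "finitely_generated_module R M \<longleftrightarrow>
     (\<exists>S. finite S \<and> S \<subseteq> carrier M \<and> module.span R M S = carrier M)"


section \<open>Stable graded filtrations\<close>

definition ideal_times ::
  "('a, 'r) ring_scheme \<Rightarrow> ('a, 'b, 'm) module_scheme \<Rightarrow> 'a set \<Rightarrow> 'b set \<Rightarrow> 'b set" where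
  "ideal_times R M I N = module.span R M {a \<odot>\<^bsub>M\<^esub> x | a x. a \<in> I \<and> x \<in> N}"

text \<open>A submodule is graded iff it contains the homogeneous components of its elements.\<close>

locale stable_graded_filtration = graded_module R A M G
  for R :: "('a, 'r) ring_scheme" (structure) and A :: "nat \<Rightarrow> 'a set"
    and M :: "('a, 'b, 'm) module_scheme" (structure) and G :: "nat \<Rightarrow> 'b set" +
  fixes Fil :: "nat \<Rightarrow> 'b set"
  assumes Fil_0: "Fil 0 = carrier M"
    and Fil_submodule: "Module.submodule (Fil p) R M"
    and Fil_descending: "Fil (Suc p) \<subseteq> Fil p"
    and Fil_mult: "ideal_times R M (irrelevant_ideal R A) (Fil p) \<subseteq> Fil (Suc p)"
    and Fil_stable: "\<exists>p\<^sub>0. \<forall>p\<ge>p\<^sub>0. ideal_times R M (irrelevant_ideal R A) (Fil p) = Fil (Suc p)"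
    and Fil_graded: "x \<in> Fil p \<Longrightarrow> hom_component M G i x \<in> Fil p"


section \<open>Module constructions\<close>

text \<open>
  In all module records below the fields \<open>mult\<close> and \<open>one\<close>, inherited from \<open>ring\<close>, carry no meaning.
\<close>

definition self_module :: "('a, 'r) ring_scheme \<Rightarrow> ('a, 'a) module" where
  "self_module R = \<lparr>carrier = carrier R, mult = mult R, one = one R,
     zero = zero R, add = add R, smult = mult R\<rparr>"

text \<open>The subquotient \<open>Z/B\<close> of \<open>M\<close>, for submodules \<open>B \<subseteq> Z\<close> of \<open>M\<close>, with cosets as elements.\<close>

definition subquotient :: "('a, 'b, 'm) module_scheme \<Rightarrow> 'b set \<Rightarrow> 'b set \<Rightarrow> ('a, 'b set) module" where
  "subquotient M Z B = \<lparr>carrier = {B +>\<^bsub>M\<^esub> z | z. z \<in> Z}, mult = (\<lambda>_ _. undefined), one = undefined,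
     zero = B, add = (\<lambda>X Y. X <+>\<^bsub>M\<^esub> Y), smult = (\<lambda>a X. B <+>\<^bsub>M\<^esub> (\<lambda>x. a \<odot>\<^bsub>M\<^esub> x) ` X)\<rparr>"

definition power_module :: "('a, 'b, 'm) module_scheme \<Rightarrow> nat \<Rightarrow> ('a, nat \<Rightarrow> 'b) module" where
  "power_module M n = \<lparr>carrier = {..<n} \<rightarrow>\<^sub>E carrier M, mult = (\<lambda>_ _. undefined), one = undefined,
     zero = (\<lambda>l\<in>{..<n}. \<zero>\<^bsub>M\<^esub>), add = (\<lambda>x y. \<lambda>l\<in>{..<n}. x l \<oplus>\<^bsub>M\<^esub> y l),
     smult = (\<lambda>a x. \<lambda>l\<in>{..<n}. a \<odot>\<^bsub>M\<^esub> x l)\<rparr>"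

text \<open>The map \<open>M\<^sup>n \<rightarrow> M\<^sup>m\<close> given by an \<open>m \<times> n\<close> matrix over \<open>R\<close>.\<close>

definition matrix_map ::
  "('a, 'b, 'm) module_scheme \<Rightarrow> nat \<Rightarrow> nat \<Rightarrow> (nat \<Rightarrow> nat \<Rightarrow> 'a) \<Rightarrow> (nat \<Rightarrow> 'b) \<Rightarrow> (nat \<Rightarrow> 'b)" where
  "matrix_map M m n \<phi> x = (\<lambda>r\<in>{..<m}. \<Oplus>\<^bsub>M\<^esub>c\<in>{..<n}. \<phi> r c \<odot>\<^bsub>M\<^esub> x c)"

text \<open>The degree-\<open>j\<close> part of the twist \<open>M(-d)\<close>.\<close>

definition twist ::
  "('b, 'm) ring_scheme \<Rightarrow> (nat \<Rightarrow> 'b set) \<Rightarrow> nat \<Rightarrow> nat \<Rightarrow> 'b set" where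
  "twist M G d j = (if d \<le> j then G (j - d) else {\<zero>\<^bsub>M\<^esub>})"


section \<open>Graded free resolutions and Tor\<close>

text \<open>
  A resolution \<open>\<dots> \<rightarrow> F\<^sub>1 \<rightarrow> F\<^sub>0 \<rightarrow> B \<rightarrow> 0\<close> by graded free modules of finite rank: \<open>F\<^sub>i\<close> is the
  direct sum of the \<open>R(-gen_deg F i l)\<close> over \<open>l < rk F i\<close>, the differential \<open>F\<^sub>i\<^sub>+\<^sub>1 \<rightarrow> F\<^sub>i\<close> is the
  matrix \<open>dmat F i\<close>, and \<open>F\<^sub>0 \<rightarrow> B\<close> maps the \<open>l\<close>-th basis vector to \<open>aug F l\<close>.
\<close>

record ('a, 'b) free_res =
  rk :: "nat \<Rightarrow> nat"
  gen_deg :: "nat \<Rightarrow> nat \<Rightarrow> nat"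
  dmat :: "nat \<Rightarrow> nat \<Rightarrow> nat \<Rightarrow> 'a"
  aug :: "nat \<Rightarrow> 'b"

definition res_map ::
  "('a, 'b, 'm) module_scheme \<Rightarrow> ('a, 'c) free_res \<Rightarrow> nat \<Rightarrow> (nat \<Rightarrow> 'b) \<Rightarrow> (nat \<Rightarrow> 'b)" where
  "res_map N F i = matrix_map N (rk F i) (rk F (Suc i)) (dmat F i)"

definition graded_free_resolution ::
  "('a, 'r) ring_scheme \<Rightarrow> (nat \<Rightarrow> 'a set) \<Rightarrow> ('a, 'b, 'm) module_scheme \<Rightarrow> (nat \<Rightarrow> 'b set) \<Rightarrow>
   ('a, 'b) free_res \<Rightarrow> bool" where
  "graded_free_resolution R A B H F \<longleftrightarrow>
     (let F_mod = (\<lambda>i. power_module (self_module R) (rk F i));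
          d = res_map (self_module R) F;
          \<epsilon> = (\<lambda>x. \<Oplus>\<^bsub>B\<^esub>l\<in>{..<rk F 0}. x l \<odot>\<^bsub>B\<^esub> aug F l)
      in (\<forall>l<rk F 0. aug F l \<in> H (gen_deg F 0 l)) \<and>
         (\<forall>i. \<forall>r<rk F i. \<forall>c<rk F (Suc i). dmat F i r c \<in> twist R A (gen_deg F i r) (gen_deg F (Suc i) c)) \<and>
         \<epsilon> ` carrier (F_mod 0) = carrier B \<and>
         d 0 ` carrier (F_mod 1) = {x \<in> carrier (F_mod 0). \<epsilon> x = \<zero>\<^bsub>B\<^esub>} \<and>
         (\<forall>i. d (Suc i) ` carrier (F_mod (Suc (Suc i))) =
               {x \<in> carrier (F_mod (Suc i)). d i x = \<zero>\<^bsub>F_mod i\<^esub>}))"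

text \<open>
  \<open>Tor\<^sub>i(N, B)\<close> is the \<open>i\<close>-th homology of \<open>N \<otimes> F\<close> for a graded free resolution \<open>F\<close> of \<open>B\<close>, i.e. the
  \<open>i\<close>-th left derived functor of \<open>N \<otimes> -\<close> at \<open>B\<close>. Here \<open>N \<otimes> F\<^sub>i\<close> is identified with \<open>N\<^sup>r\<close>, where
  \<open>r = rk F i\<close>, through \<open>x \<otimes> e\<^sub>l \<mapsto>\<close> (\<open>x\<close> in position \<open>l\<close>); this turns \<open>id \<otimes> d\<close> into the map given
  on powers of \<open>N\<close> by the matrix of \<open>d\<close>. As usual \<open>F\<close> is an arbitrary choice; one exists whenever
  \<open>B\<close> is finitely generated, since a standard graded algebra is Noetherian.
\<close>

definition tor_cycles ::
  "('a, 'b, 'm) module_scheme \<Rightarrow> ('a, 'c) free_res \<Rightarrow> nat \<Rightarrow> (nat \<Rightarrow> 'b) set" where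
  "tor_cycles N F i = {x \<in> carrier (power_module N (rk F i)).
     \<forall>n. i = Suc n \<longrightarrow> res_map N F n x = \<zero>\<^bsub>power_module N (rk F n)\<^esub>}"

definition tor_boundaries ::
  "('a, 'b, 'm) module_scheme \<Rightarrow> ('a, 'c) free_res \<Rightarrow> nat \<Rightarrow> (nat \<Rightarrow> 'b) set" where
  "tor_boundaries N F i = res_map N F i ` carrier (power_module N (rk F (Suc i)))"

definition tensor_degree_part ::
  "('a, 'b, 'm) module_scheme \<Rightarrow> (nat \<Rightarrow> 'b set) \<Rightarrow> ('a, 'c) free_res \<Rightarrow> nat \<Rightarrow> nat \<Rightarrow> (nat \<Rightarrow> 'b) set" where
  "tensor_degree_part N G F i j = (\<Pi>\<^sub>E l\<in>{..<rk F i}. twist N G (gen_deg F i l) j)"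

definition tor_res ::
  "('a, 'b, 'm) module_scheme \<Rightarrow> ('a, 'c) free_res \<Rightarrow> nat \<Rightarrow> ('a, (nat \<Rightarrow> 'b) set) module" where
  "tor_res N F i = subquotient (power_module N (rk F i)) (tor_cycles N F i) (tor_boundaries N F i)"

definition tor_res_degree ::
  "('a, 'b, 'm) module_scheme \<Rightarrow> (nat \<Rightarrow> 'b set) \<Rightarrow> ('a, 'c) free_res \<Rightarrow> nat \<Rightarrow> nat \<Rightarrow>
   ('a, (nat \<Rightarrow> 'b) set) module" where
  "tor_res_degree N G F i j = (tor_res N F i)\<lparr>carrier :=
     {tor_boundaries N F i +>\<^bsub>power_module N (rk F i)\<^esub> z | z.
        z \<in> tor_cycles N F i \<inter> tensor_degree_part N G F i j}\<rparr>"

definition chosen_resolution ::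
  "('a, 'r) ring_scheme \<Rightarrow> (nat \<Rightarrow> 'a set) \<Rightarrow> ('a, 'b, 'm) module_scheme \<Rightarrow> (nat \<Rightarrow> 'b set) \<Rightarrow>
   ('a, 'b) free_res" where
  "chosen_resolution R A B H = (SOME F. graded_free_resolution R A B H F)"

definition Tor ::
  "('a, 'r) ring_scheme \<Rightarrow> (nat \<Rightarrow> 'a set) \<Rightarrow> nat \<Rightarrow> ('a, 'b, 'm) module_scheme \<Rightarrow>
   ('a, 'c, 'n) module_scheme \<Rightarrow> (nat \<Rightarrow> 'c set) \<Rightarrow> ('a, (nat \<Rightarrow> 'b) set) module" where
  "Tor R A i N B H = tor_res N (chosen_resolution R A B H) i"

definition Tor_degree ::
  "('a, 'r) ring_scheme \<Rightarrow> (nat \<Rightarrow> 'a set) \<Rightarrow> nat \<Rightarrow> ('a, 'b, 'm) module_scheme \<Rightarrow> (nat \<Rightarrow> 'b set) \<Rightarrow>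
   ('a, 'c, 'n) module_scheme \<Rightarrow> (nat \<Rightarrow> 'c set) \<Rightarrow> nat \<Rightarrow> ('a, (nat \<Rightarrow> 'b) set) module" where
  "Tor_degree R A i N G B H j = tor_res_degree N G (chosen_resolution R A B H) i j"


section \<open>Betti numbers and regularity\<close>

definition residue_module :: "('a, 'r) ring_scheme \<Rightarrow> (nat \<Rightarrow> 'a set) \<Rightarrow> ('a, 'a set) module" where
  "residue_module R A = subquotient (self_module R) (carrier R) (irrelevant_ideal R A)"

definition residue_grading :: "('a, 'r) ring_scheme \<Rightarrow> (nat \<Rightarrow> 'a set) \<Rightarrow> nat \<Rightarrow> 'a set set" where
  "residue_grading R A i =
     (if i = 0 then carrier (residue_module R A) else {\<zero>\<^bsub>residue_module R A\<^esub>})"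

definition vdim :: "('a, 'r) ring_scheme \<Rightarrow> ('a, 'b, 'm) module_scheme \<Rightarrow> enat" where
  "vdim K V = (if vectorspace.fin_dim K V then enat (vectorspace.dim K V) else \<infinity>)"

definition betti ::
  "('a, 'r) ring_scheme \<Rightarrow> (nat \<Rightarrow> 'a set) \<Rightarrow> ('a, 'b, 'm) module_scheme \<Rightarrow> nat \<Rightarrow> enat" where
  "betti R A N i =
     vdim (ground_field_of R A) (Tor R A i N (residue_module R A) (residue_grading R A))"

definition graded_betti ::
  "('a, 'r) ring_scheme \<Rightarrow> (nat \<Rightarrow> 'a set) \<Rightarrow> ('a, 'b, 'm) module_scheme \<Rightarrow> (nat \<Rightarrow> 'b set) \<Rightarrow>
   nat \<Rightarrow> nat \<Rightarrow> enat" where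
  "graded_betti R A N G i j =
     vdim (ground_field_of R A) (Tor_degree R A i N G (residue_module R A) (residue_grading R A) j)"

definition regularity ::
  "('a, 'r) ring_scheme \<Rightarrow> (nat \<Rightarrow> 'a set) \<Rightarrow> ('a, 'b, 'm) module_scheme \<Rightarrow> (nat \<Rightarrow> 'b set) \<Rightarrow> ereal" where
  "regularity R A N G =
     Sup {ereal (real j - real i) | i j. graded_betti R A N G i j \<noteq> 0}"


section \<open>The associated graded module\<close>

definition gr_part :: "('a, 'b, 'm) module_scheme \<Rightarrow> (nat \<Rightarrow> 'b set) \<Rightarrow> nat \<Rightarrow> ('a, 'b set) module" where
  "gr_part M Fil p = subquotient M (Fil p) (Fil (Suc p))"

text \<open>
  The ring \<open>\<Oplus>\<^sub>q m\<^sup>q/m\<^sup>q\<^sup>+\<^sup>1\<close> is identified with \<open>R\<close>: since \<open>R\<close> is standard graded,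
  \<open>A q \<rightarrow> m\<^sup>q/m\<^sup>q\<^sup>+\<^sup>1\<close> is bijective. So \<open>a \<in> A q\<close> sends the class of \<open>x\<close> in
  \<open>Fil p / Fil (p+1)\<close> to the class of \<open>a \<odot> x\<close> in \<open>Fil (p+q) / Fil (p+q+1)\<close>; this is \<open>gr_smult\<close>,
  with \<open>n = p + q\<close> the target degree. Elements of the associated graded module are the finitely
  supported families \<open>f\<close> with \<open>f p \<in> Fil p / Fil (p+1)\<close>.
\<close>

definition gr_smult ::
  "('a, 'b, 'm) module_scheme \<Rightarrow> (nat \<Rightarrow> 'b set) \<Rightarrow> nat \<Rightarrow> 'a \<Rightarrow> 'b set \<Rightarrow> 'b set" where
  "gr_smult M Fil n a X = Fil (Suc n) <+>\<^bsub>M\<^esub> (\<lambda>x. a \<odot>\<^bsub>M\<^esub> x) ` X"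

definition assoc_graded ::
  "('a, 'r) ring_scheme \<Rightarrow> (nat \<Rightarrow> 'a set) \<Rightarrow> ('a, 'b, 'm) module_scheme \<Rightarrow> (nat \<Rightarrow> 'b set) \<Rightarrow>
   ('a, nat \<Rightarrow> 'b set) module" where
  "assoc_graded R A M Fil = \<lparr>
     carrier = {f. (\<forall>p. f p \<in> carrier (gr_part M Fil p)) \<and> finite {p. f p \<noteq> \<zero>\<^bsub>gr_part M Fil p\<^esub>}},
     mult = (\<lambda>_ _. undefined), one = undefined,
     zero = (\<lambda>p. \<zero>\<^bsub>gr_part M Fil p\<^esub>),
     add = (\<lambda>f g p. f p \<oplus>\<^bsub>gr_part M Fil p\<^esub> g p),
     smult = (\<lambda>a f p. \<Oplus>\<^bsub>gr_part M Fil p\<^esub>q\<in>{..p}. gr_smult M Fil p (hom_component R A q a) (f (p - q)))\<rparr>"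

definition assoc_grading ::
  "('a, 'r) ring_scheme \<Rightarrow> (nat \<Rightarrow> 'a set) \<Rightarrow> ('a, 'b, 'm) module_scheme \<Rightarrow> (nat \<Rightarrow> 'b set) \<Rightarrow>
   nat \<Rightarrow> (nat \<Rightarrow> 'b set) set" where
  "assoc_grading R A M Fil p =
     {f \<in> carrier (assoc_graded R A M Fil). \<forall>q. q \<noteq> p \<longrightarrow> f q = \<zero>\<^bsub>gr_part M Fil q\<^esub>}"

definition homogeneous_type ::
  "('a, 'r) ring_scheme \<Rightarrow> (nat \<Rightarrow> 'a set) \<Rightarrow> ('a, 'b, 'm) module_scheme \<Rightarrow> (nat \<Rightarrow> 'b set) \<Rightarrow> bool" where
  "homogeneous_type R A M Fil \<longleftrightarrow>
     (\<forall>i. betti R A M i = betti R A (assoc_graded R A M Fil) i)"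

end

theory Submission
  imports Defs
begin

text \<open>
  A stable graded filtration and the grading of a finitely generated \<open>M\<close> bound each other: for some
  constant \<open>c\<close>, \<open>M\<^sub>j \<subseteq> F\<^sub>j\<^sub>-\<^sub>c\<close>, and \<open>F\<^sub>p\<close> has no elements of degree below \<open>p - c\<close>.
  Tensor \<open>M\<close> with a graded free resolution of the residue field and filter the resulting complex by
  \<open>F\<close>, shifted by the generator degrees; its associated graded complex computes the Tor of \<open>gr(M)\<close>.

  If \<open>Tor\<^sub>i(gr(M))\<close> vanishes in high degrees, a homogeneous cycle of \<open>M\<close> of high degree lies deep in the
  filtration, and boundaries can be subtracted from it until it lies so deep that it is zero.

  Conversely, if \<open>reg M < \<infinity>\<close>, then \<open>Tor\<^sub>i(M)\<close> is finite dimensional and its cycles deep in the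
  filtration are boundaries. Hence \<open>Tor\<^sub>i(M)\<close> is spanned by lifts of linearly independent classes of low
  degree in \<open>Tor\<^sub>i(gr(M))\<close>, and equality of the total dimensions leaves no room for a class of high
  degree.
\<close>

section \<open>Finite generation over sets of operators\<close>

text \<open>Both Tor modules use one chosen resolution of the residue field, so a single family of
  homogeneous matrices acts on powers of \<open>M\<close> and of the associated graded module. The
  choice is meaningful only once such a resolution is known to exist; this is where Hilbert's basis
  theorem and homogeneous generators enter. The two regularities refer to different gradings:
  internal degree for \<open>M\<close>, filtration step for the associated graded module. In the
  complex both are shifted by the same generator degrees, so the constants that compare them on
  \<open>M\<close> serve in every homological degree. This uniformity in \<open>i\<close> turns
  vanishing beyond \<open>i + C\<close> on one side into vanishing beyond \<open>i + C'\<close> on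
  the other. The associated graded module is treated as a vector space over the ground field on
  which homogeneous scalars act linearly. The matrix entries are such scalars, and Betti numbers are
  dimensions over the ground field. Leading classes and corrections by boundaries take the place of
  a spectral sequence.\<close>

inductive_set tspan :: "('a, 'b, 'm) module_scheme \<Rightarrow> 'a set \<Rightarrow> 'b set \<Rightarrow> 'b set"
  for M :: "('a, 'b, 'm) module_scheme" and T :: "'a set" and S :: "'b set" where
  tspan_zero: "\<zero>\<^bsub>M\<^esub> \<in> tspan M T S"
| tspan_base: "x \<in> S \<Longrightarrow> x \<in> tspan M T S"
| tspan_add: "x \<in> tspan M T S \<Longrightarrow> y \<in> tspan M T S \<Longrightarrow> x \<oplus>\<^bsub>M\<^esub> y \<in> tspan M T S"
| tspan_smult: "t \<in> T \<Longrightarrow> x \<in> tspan M T S \<Longrightarrow> t \<odot>\<^bsub>M\<^esub> x \<in> tspan M T S"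

text \<open>The operators \<open>T\<close> need not form a ring, so that the generators of an algebra can be adjoined to
  \<open>T\<close> one at a time.\<close>

definition tclosed :: "('a, 'b, 'm) module_scheme \<Rightarrow> 'a set \<Rightarrow> 'b set \<Rightarrow> bool" where
  "tclosed M T N \<longleftrightarrow> N \<subseteq> carrier M \<and> \<zero>\<^bsub>M\<^esub> \<in> N \<and>
     (\<forall>x\<in>N. \<forall>y\<in>N. x \<oplus>\<^bsub>M\<^esub> y \<in> N) \<and> (\<forall>t\<in>T. \<forall>x\<in>N. t \<odot>\<^bsub>M\<^esub> x \<in> N)"

text \<open>\<open>N\<close> only bounds the closed sets \<open>P\<close>, so the property is
  inherited by every subset of \<open>N\<close>.\<close>

definition tnoetherian :: "('a, 'b, 'm) module_scheme \<Rightarrow> 'a set \<Rightarrow> 'b set \<Rightarrow> bool" where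
  "tnoetherian M T N \<longleftrightarrow>
     (\<forall>P. tclosed M T P \<longrightarrow> P \<subseteq> N \<longrightarrow> (\<exists>S. finite S \<and> S \<subseteq> P \<and> P \<subseteq> tspan M T S))"

lemma tclosedD:
  assumes "tclosed M T N"
  shows "N \<subseteq> carrier M" "\<zero>\<^bsub>M\<^esub> \<in> N"
    "x \<in> N \<Longrightarrow> y \<in> N \<Longrightarrow> x \<oplus>\<^bsub>M\<^esub> y \<in> N" "t \<in> T \<Longrightarrow> x \<in> N \<Longrightarrow> t \<odot>\<^bsub>M\<^esub> x \<in> N"
  using assms by (auto simp: tclosed_def)

lemma tclosedI:
  assumes "N \<subseteq> carrier M" "\<zero>\<^bsub>M\<^esub> \<in> N"
    "\<And>x y. x \<in> N \<Longrightarrow> y \<in> N \<Longrightarrow> x \<oplus>\<^bsub>M\<^esub> y \<in> N" "\<And>t x. t \<in> T \<Longrightarrow> x \<in> N \<Longrightarrow> t \<odot>\<^bsub>M\<^esub> x \<in> N"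
  shows "tclosed M T N"
  using assms by (auto simp: tclosed_def)

lemma tspan_subset: "tclosed M T N \<Longrightarrow> S \<subseteq> N \<Longrightarrow> tspan M T S \<subseteq> N"
proof
  fix x assume N: "tclosed M T N" "S \<subseteq> N" and "x \<in> tspan M T S"
  from this(3) show "x \<in> N" by induct (use N in \<open>auto simp: tclosed_def\<close>)
qed

lemma tspan_trans: "x \<in> tspan M T S \<Longrightarrow> S \<subseteq> tspan M T' S' \<Longrightarrow> T \<subseteq> T' \<Longrightarrow> x \<in> tspan M T' S'"
proof (induct rule: tspan.induct)
  case (tspan_smult t x)
  then show ?case by (intro tspan.tspan_smult) auto
qed (auto intro: tspan.tspan_zero tspan.tspan_add)

lemma tspan_mono: "S \<subseteq> S' \<Longrightarrow> T \<subseteq> T' \<Longrightarrow> tspan M T S \<subseteq> tspan M T' S'"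
  using tspan_trans[of _ M T S T' S'] tspan_base[of _ S' M T'] by blast

lemma tnoetherianD:
  assumes "tnoetherian M T N" "tclosed M T P" "P \<subseteq> N"
  obtains S where "finite S" "S \<subseteq> P" "P \<subseteq> tspan M T S"
  using assms(1)[unfolded tnoetherian_def, rule_format, OF assms(2,3)] that by auto

lemma tnoetherian_mono: "tnoetherian M T N \<Longrightarrow> N' \<subseteq> N \<Longrightarrow> tnoetherian M T N'"
  unfolding tnoetherian_def using subset_trans by metis

context module
begin

lemma tclosed_tspan:
  assumes "T \<subseteq> carrier R" "S \<subseteq> carrier M"
  shows "tclosed M T (tspan M T S)"
proof (rule tclosedI)
  have "tclosed M T (carrier M)" using assms by (auto simp: tclosed_def)
  then show "tspan M T S \<subseteq> carrier M" using assms(2) by (rule tspan_subset)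
qed (auto intro: tspan.intros)

text \<open>\<open>tclosed\<close> does not mention negatives; they arise from acting with
  \<open>\<ominus> \<one>\<close>. This is why the Noetherian arguments carry that scalar in
  \<open>T\<close>.\<close>

lemma tclosed_minus:
  assumes "tclosed M T N" "\<ominus> \<one> \<in> T" "x \<in> N" "y \<in> N"
  shows "x \<ominus>\<^bsub>M\<^esub> y \<in> N"
proof -
  have "y \<in> carrier M" using tclosedD(1)[OF assms(1)] assms(4) by auto
  then have "\<ominus>\<^bsub>M\<^esub> y = (\<ominus> \<one>) \<odot>\<^bsub>M\<^esub> y" by (simp add: smult_l_minus)
  then show ?thesis
    using tclosedD(3,4)[OF assms(1)] assms by (simp add: M.minus_eq)
qed

lemma add_interchange:
  assumes "a \<in> carrier M" "b \<in> carrier M" "x \<in> carrier M" "y \<in> carrier M"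
  shows "(a \<oplus>\<^bsub>M\<^esub> b) \<oplus>\<^bsub>M\<^esub> (x \<oplus>\<^bsub>M\<^esub> y) = (a \<oplus>\<^bsub>M\<^esub> x) \<oplus>\<^bsub>M\<^esub> (b \<oplus>\<^bsub>M\<^esub> y)"
  using assms by (simp add: M.a_ac)

lemma minus_interchange:
  assumes "a \<in> carrier M" "b \<in> carrier M" "x \<in> carrier M" "y \<in> carrier M"
  shows "(a \<oplus>\<^bsub>M\<^esub> b) \<ominus>\<^bsub>M\<^esub> (x \<oplus>\<^bsub>M\<^esub> y) = (a \<ominus>\<^bsub>M\<^esub> x) \<oplus>\<^bsub>M\<^esub> (b \<ominus>\<^bsub>M\<^esub> y)"
  using assms add_interchange[of a b "\<ominus>\<^bsub>M\<^esub> x" "\<ominus>\<^bsub>M\<^esub> y"] by (simp add: M.minus_eq M.minus_add)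

lemma add_minus_cancel_left:
  assumes "a \<in> carrier M" "x \<in> carrier M" "y \<in> carrier M"
  shows "(a \<oplus>\<^bsub>M\<^esub> x) \<ominus>\<^bsub>M\<^esub> (a \<oplus>\<^bsub>M\<^esub> y) = x \<ominus>\<^bsub>M\<^esub> y"
  using assms minus_interchange[of a x a y] by (simp add: M.minus_eq M.r_neg)

lemma add_add_minus_cancel:
  assumes "a \<in> carrier M" "x \<in> carrier M" "y \<in> carrier M"
  shows "(a \<oplus>\<^bsub>M\<^esub> y) \<oplus>\<^bsub>M\<^esub> (x \<ominus>\<^bsub>M\<^esub> y) = a \<oplus>\<^bsub>M\<^esub> x"
proof -
  have "y \<oplus>\<^bsub>M\<^esub> (x \<ominus>\<^bsub>M\<^esub> y) = x" using assms by (simp add: M.minus_eq M.a_lcomm[of y] M.r_neg)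
  then show ?thesis using assms by (simp add: M.a_assoc)
qed

text \<open>The usual argument for extensions, carried out without quotients:
  \<open>P \<inter> N1\<close> plays the part of the kernel, and the set \<open>Q\<close> of second
  summands of elements of \<open>P\<close> that of the image. Generators of the first together with
  lifts of generators of the second generate \<open>P\<close>.\<close>

lemma tnoetherian_sum:
  assumes T: "T \<subseteq> carrier R" "\<ominus> \<one> \<in> T"
    and N1: "tclosed M T N1" "tnoetherian M T N1"
    and N2: "tclosed M T N2" "tnoetherian M T N2"
  shows "tnoetherian M T {a \<oplus>\<^bsub>M\<^esub> b | a b. a \<in> N1 \<and> b \<in> N2}"
  unfolding tnoetherian_def
proof (intro allI impI)
  fix P assume P: "tclosed M T P" "P \<subseteq> {a \<oplus>\<^bsub>M\<^esub> b | a b. a \<in> N1 \<and> b \<in> N2}"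
  note Pc = tclosedD[OF P(1)] and c1 = tclosedD[OF N1(1)] and c2 = tclosedD[OF N2(1)]
  have "tclosed M T (P \<inter> N1)" using P(1) N1(1) by (auto simp: tclosed_def)
  then obtain S1 where S1: "finite S1" "S1 \<subseteq> P \<inter> N1" "P \<inter> N1 \<subseteq> tspan M T S1"
    using tnoetherianD[OF N1(2)] by (metis Int_lower2)
  define Q where "Q = {b \<in> N2. \<exists>a\<in>N1. a \<oplus>\<^bsub>M\<^esub> b \<in> P}"
  have "tclosed M T Q"
  proof (rule tclosedI)
    show "Q \<subseteq> carrier M" using c2 by (auto simp: Q_def)
    show "\<zero>\<^bsub>M\<^esub> \<in> Q" using c1 c2 Pc by (auto simp: Q_def intro!: bexI[of _ "\<zero>\<^bsub>M\<^esub>"])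
    fix x y assume "x \<in> Q" "y \<in> Q"
    then obtain a b where h: "x \<in> N2" "y \<in> N2" "a \<in> N1" "b \<in> N1" "a \<oplus>\<^bsub>M\<^esub> x \<in> P" "b \<oplus>\<^bsub>M\<^esub> y \<in> P"
      by (auto simp: Q_def)
    have "(a \<oplus>\<^bsub>M\<^esub> b) \<oplus>\<^bsub>M\<^esub> (x \<oplus>\<^bsub>M\<^esub> y) = (a \<oplus>\<^bsub>M\<^esub> x) \<oplus>\<^bsub>M\<^esub> (b \<oplus>\<^bsub>M\<^esub> y)"
      using h c1(1) c2(1) by (intro add_interchange) auto
    also have "\<dots> \<in> P" using h Pc(3) by blast
    finally show "x \<oplus>\<^bsub>M\<^esub> y \<in> Q" using h c1(3) c2(3) unfolding Q_def by blast
  next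
    fix t x assume "t \<in> T" "x \<in> Q"
    then obtain a where h: "x \<in> N2" "a \<in> N1" "a \<oplus>\<^bsub>M\<^esub> x \<in> P" by (auto simp: Q_def)
    have "t \<odot>\<^bsub>M\<^esub> (a \<oplus>\<^bsub>M\<^esub> x) = t \<odot>\<^bsub>M\<^esub> a \<oplus>\<^bsub>M\<^esub> t \<odot>\<^bsub>M\<^esub> x"
      using h c1(1) c2(1) \<open>t \<in> T\<close> T by (intro smult_r_distr) auto
    then have "t \<odot>\<^bsub>M\<^esub> a \<oplus>\<^bsub>M\<^esub> t \<odot>\<^bsub>M\<^esub> x \<in> P" using h Pc(4) \<open>t \<in> T\<close> by metis
    then show "t \<odot>\<^bsub>M\<^esub> x \<in> Q" using h c1(4) c2(4) \<open>t \<in> T\<close> unfolding Q_def by blast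
  qed
  then obtain S2 where S2: "finite S2" "S2 \<subseteq> Q" "Q \<subseteq> tspan M T S2"
    using tnoetherianD[OF N2(2), of Q] by (auto simp: Q_def)
  have "\<forall>b\<in>S2. \<exists>a\<in>N1. a \<oplus>\<^bsub>M\<^esub> b \<in> P" using S2 by (auto simp: Q_def)
  then obtain g where g: "\<And>b. b \<in> S2 \<Longrightarrow> g b \<in> N1 \<and> g b \<oplus>\<^bsub>M\<^esub> b \<in> P" by metis
  define S where "S = S1 \<union> (\<lambda>b. g b \<oplus>\<^bsub>M\<^esub> b) ` S2"
  have SP: "S \<subseteq> P" using S1 g by (auto simp: S_def)
  have cS: "tclosed M T (tspan M T S)" by (rule tclosed_tspan) (use T SP Pc in auto)
  have spP: "tspan M T S \<subseteq> P" using tspan_subset[OF P(1) SP] .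
  \<comment> \<open>Every operation used to build \<open>b\<close> from \<open>S2\<close> is
    repeated on the lifts; only the first summand changes, and it stays in
    \<open>N1\<close>.\<close>
  have lift: "\<exists>a\<in>N1. a \<oplus>\<^bsub>M\<^esub> b \<in> tspan M T S \<and> b \<in> N2" if "b \<in> tspan M T S2" for b
    using that
  proof induct
    case tspan_zero
    show ?case using c1(2) c2(2) tspan.tspan_zero[of M T S] by (intro bexI[of _ "\<zero>\<^bsub>M\<^esub>"]) simp_all
  next
    case (tspan_base x)
    then have "g x \<oplus>\<^bsub>M\<^esub> x \<in> tspan M T S" by (intro tspan.tspan_base) (simp add: S_def)
    then show ?case using tspan_base g[of x] S2(2) unfolding Q_def by blast
  next
    case (tspan_add x y)
    then obtain a b where h: "x \<in> N2" "y \<in> N2" "a \<in> N1" "b \<in> N1" "a \<oplus>\<^bsub>M\<^esub> x \<in> tspan M T S" "b \<oplus>\<^bsub>M\<^esub> y \<in> tspan M T S"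
      by auto
    have "(a \<oplus>\<^bsub>M\<^esub> b) \<oplus>\<^bsub>M\<^esub> (x \<oplus>\<^bsub>M\<^esub> y) = (a \<oplus>\<^bsub>M\<^esub> x) \<oplus>\<^bsub>M\<^esub> (b \<oplus>\<^bsub>M\<^esub> y)"
      using h c1(1) c2(1) by (intro add_interchange) auto
    also have "\<dots> \<in> tspan M T S" by (rule tspan.tspan_add) (fact h)+
    finally show ?case using h c1(3) c2(3) by blast
  next
    case (tspan_smult t x)
    then obtain a where h: "x \<in> N2" "a \<in> N1" "a \<oplus>\<^bsub>M\<^esub> x \<in> tspan M T S" by auto
    have "t \<odot>\<^bsub>M\<^esub> (a \<oplus>\<^bsub>M\<^esub> x) = t \<odot>\<^bsub>M\<^esub> a \<oplus>\<^bsub>M\<^esub> t \<odot>\<^bsub>M\<^esub> x"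
      using h c1(1) c2(1) \<open>t \<in> T\<close> T by (intro smult_r_distr) auto
    moreover have "t \<odot>\<^bsub>M\<^esub> (a \<oplus>\<^bsub>M\<^esub> x) \<in> tspan M T S" by (rule tspan.tspan_smult) (fact h \<open>t \<in> T\<close>)+
    ultimately show ?case using h c1(4) c2(4) \<open>t \<in> T\<close> by auto
  qed
  have "P \<subseteq> tspan M T S"
  proof
    fix x assume x: "x \<in> P"
    then obtain a b where ab: "a \<in> N1" "b \<in> N2" "x = a \<oplus>\<^bsub>M\<^esub> b" using P(2) by auto
    then have "b \<in> tspan M T S2" using x S2 by (auto simp: Q_def)
    then obtain a' where a': "a' \<in> N1" "a' \<oplus>\<^bsub>M\<^esub> b \<in> tspan M T S" using lift by blast
    have c: "a \<in> carrier M" "b \<in> carrier M" "a' \<in> carrier M" using ab a' c1 c2 by auto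
    \<comment> \<open>\<open>x\<close> and its substitute have the same second summand
      \<open>b\<close>, so their difference falls into \<open>P \<inter> N1\<close>, where
      \<open>S1\<close> generates.\<close>
    have e: "x \<ominus>\<^bsub>M\<^esub> (a' \<oplus>\<^bsub>M\<^esub> b) = a \<ominus>\<^bsub>M\<^esub> a'"
      using c ab(3) minus_interchange[of a b a' b] by (simp add: M.r_neg M.minus_eq)
    have "a \<ominus>\<^bsub>M\<^esub> a' \<in> P \<inter> N1"
      using e tclosed_minus[OF P(1) T(2) x, of "a' \<oplus>\<^bsub>M\<^esub> b"] spP a'
        tclosed_minus[OF N1(1) T(2) ab(1) a'(1)] by auto
    then have "a \<ominus>\<^bsub>M\<^esub> a' \<in> tspan M T S" using S1(3) tspan_mono[of S1 S T T M] by (auto simp: S_def)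
    moreover have "x = (a \<ominus>\<^bsub>M\<^esub> a') \<oplus>\<^bsub>M\<^esub> (a' \<oplus>\<^bsub>M\<^esub> b)"
      using c ab(3) by (simp add: M.minus_eq M.a_assoc M.r_neg1)
    ultimately show "x \<in> tspan M T S" using tspan.tspan_add[OF _ a'(2)] by simp
  qed
  then show "\<exists>S. finite S \<and> S \<subseteq> P \<and> P \<subseteq> tspan M T S"
    using SP S1(1) S2(1) by (intro exI[of _ S]) (simp add: S_def)
qed

section \<open>Hilbert's basis theorem\<close>

definition hpart :: "nat \<Rightarrow> 'a \<Rightarrow> 'c set \<Rightarrow> 'c set" where
  "hpart d s N = rec_nat {\<zero>\<^bsub>M\<^esub>} (\<lambda>k E. {(s [^] k) \<odot>\<^bsub>M\<^esub> n \<oplus>\<^bsub>M\<^esub> y | n y. n \<in> N \<and> y \<in> E}) d"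

lemma hpart_0: "hpart 0 s N = {\<zero>\<^bsub>M\<^esub>}"
  by (simp add: hpart_def)

lemma hpart_Suc: "hpart (Suc d) s N = {(s [^] d) \<odot>\<^bsub>M\<^esub> n \<oplus>\<^bsub>M\<^esub> y | n y. n \<in> N \<and> y \<in> hpart d s N}"
  by (simp add: hpart_def)

lemma hpart_SucI: "n \<in> N \<Longrightarrow> y \<in> hpart d s N \<Longrightarrow> (s [^] d) \<odot>\<^bsub>M\<^esub> n \<oplus>\<^bsub>M\<^esub> y \<in> hpart (Suc d) s N"
  unfolding hpart_Suc by blast

lemma hpart_SucE:
  assumes "x \<in> hpart (Suc d) s N"
  obtains n y where "n \<in> N" "y \<in> hpart d s N" "x = (s [^] d) \<odot>\<^bsub>M\<^esub> n \<oplus>\<^bsub>M\<^esub> y"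
  using assms unfolding hpart_Suc by blast

lemma tclosed_hpart:
  assumes T: "T \<subseteq> carrier R" and s: "s \<in> carrier R" and N: "tclosed M T N"
  shows "tclosed M T (hpart d s N)"
proof (induct d)
  case 0
  show ?case using T by (auto simp: hpart_0 tclosed_def)
next
  case (Suc d)
  note Nc = tclosedD[OF N] and Ec = tclosedD[OF Suc]
  have cN: "n \<in> N \<Longrightarrow> n \<in> carrier M" for n using Nc by auto
  have cE: "n \<in> hpart d s N \<Longrightarrow> n \<in> carrier M" for n using Ec by auto
  have sd: "s [^] d \<in> carrier R" using s by simp
  show ?case
  proof (rule tclosedI)
    show "hpart (Suc d) s N \<subseteq> carrier M"
      using cN cE sd by (auto simp: hpart_Suc)
    have "\<zero>\<^bsub>M\<^esub> = (s [^] d) \<odot>\<^bsub>M\<^esub> \<zero>\<^bsub>M\<^esub> \<oplus>\<^bsub>M\<^esub> \<zero>\<^bsub>M\<^esub>" using sd by simp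
    then show "\<zero>\<^bsub>M\<^esub> \<in> hpart (Suc d) s N" using hpart_SucI[OF Nc(2) Ec(2)] by simp
  next
    fix x y assume "x \<in> hpart (Suc d) s N" "y \<in> hpart (Suc d) s N"
    then obtain n u m v where h: "n \<in> N" "u \<in> hpart d s N" "x = (s [^] d) \<odot>\<^bsub>M\<^esub> n \<oplus>\<^bsub>M\<^esub> u"
      "m \<in> N" "v \<in> hpart d s N" "y = (s [^] d) \<odot>\<^bsub>M\<^esub> m \<oplus>\<^bsub>M\<^esub> v"
      by (elim hpart_SucE)
    have "x \<oplus>\<^bsub>M\<^esub> y = (s [^] d) \<odot>\<^bsub>M\<^esub> (n \<oplus>\<^bsub>M\<^esub> m) \<oplus>\<^bsub>M\<^esub> (u \<oplus>\<^bsub>M\<^esub> v)"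
      using h cN cE sd by (simp add: smult_r_distr add_interchange)
    then show "x \<oplus>\<^bsub>M\<^esub> y \<in> hpart (Suc d) s N"
      using hpart_SucI[OF Nc(3) Ec(3)] h by simp
  next
    fix t x assume t: "t \<in> T" and "x \<in> hpart (Suc d) s N"
    then obtain n u where h: "n \<in> N" "u \<in> hpart d s N" "x = (s [^] d) \<odot>\<^bsub>M\<^esub> n \<oplus>\<^bsub>M\<^esub> u"
      by (elim hpart_SucE)
    have tR: "t \<in> carrier R" using t T by auto
    have "t \<odot>\<^bsub>M\<^esub> x = (t \<otimes> s [^] d) \<odot>\<^bsub>M\<^esub> n \<oplus>\<^bsub>M\<^esub> t \<odot>\<^bsub>M\<^esub> u"
      using h cN cE sd tR by (simp add: smult_r_distr smult_assoc1)
    also have "\<dots> = (s [^] d) \<odot>\<^bsub>M\<^esub> (t \<odot>\<^bsub>M\<^esub> n) \<oplus>\<^bsub>M\<^esub> t \<odot>\<^bsub>M\<^esub> u"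
      using h cN cE sd tR by (simp add: R.m_comm[of t] smult_assoc1)
    finally show "t \<odot>\<^bsub>M\<^esub> x \<in> hpart (Suc d) s N"
      using hpart_SucI[OF Nc(4)[OF t] Ec(4)[OF t]] h by simp
  qed
qed

lemma hpart_mono:
  assumes "s \<in> carrier R" "tclosed M T N" "T \<subseteq> carrier R" "d \<le> e"
  shows "hpart d s N \<subseteq> hpart e s N"
proof (rule lift_Suc_mono_le[OF _ assms(4)])
  fix n
  show "hpart n s N \<subseteq> hpart (Suc n) s N"
  proof
    fix x assume x: "x \<in> hpart n s N"
    then have "x \<in> carrier M" using tclosedD(1)[OF tclosed_hpart[OF assms(3,1,2), of n]] by auto
    then have "x = (s [^] n) \<odot>\<^bsub>M\<^esub> \<zero>\<^bsub>M\<^esub> \<oplus>\<^bsub>M\<^esub> x" using assms(1) by simp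
    then show "x \<in> hpart (Suc n) s N" using hpart_SucI[OF tclosedD(2)[OF assms(2)] x] by simp
  qed
qed

lemma hpart_smult:
  assumes s: "s \<in> carrier R" and N: "tclosed M T N" and T: "T \<subseteq> carrier R"
  shows "x \<in> hpart d s N \<Longrightarrow> s \<odot>\<^bsub>M\<^esub> x \<in> hpart (Suc d) s N"
proof (induct d arbitrary: x)
  case 0
  then have "s \<odot>\<^bsub>M\<^esub> x = \<zero>\<^bsub>M\<^esub>" using s by (simp add: hpart_0)
  then show ?case using tclosedD(2)[OF tclosed_hpart[OF T s N]] by simp
next
  case (Suc d)
  then obtain n u where h: "n \<in> N" "u \<in> hpart d s N" "x = (s [^] d) \<odot>\<^bsub>M\<^esub> n \<oplus>\<^bsub>M\<^esub> u"
    by (elim hpart_SucE)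
  have c: "n \<in> carrier M" "u \<in> carrier M"
    using h tclosedD(1)[OF N] tclosedD(1)[OF tclosed_hpart[OF T s N]] by auto
  have "s \<odot>\<^bsub>M\<^esub> x = (s [^] Suc d) \<odot>\<^bsub>M\<^esub> n \<oplus>\<^bsub>M\<^esub> s \<odot>\<^bsub>M\<^esub> u"
    using h(3) c s by (simp add: smult_r_distr smult_assoc1[symmetric] R.m_comm)
  then show ?case using hpart_SucI[OF h(1) Suc(1)[OF h(2)]] by simp
qed

lemma hpart_pow_smult:
  assumes s: "s \<in> carrier R" and N: "tclosed M T N" and T: "T \<subseteq> carrier R"
  shows "x \<in> hpart d s N \<Longrightarrow> (s [^] k) \<odot>\<^bsub>M\<^esub> x \<in> hpart (d + k) s N"
proof (induct k)
  case 0
  then have "x \<in> carrier M" using tclosedD(1)[OF tclosed_hpart[OF T s N]] by auto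
  then show ?case using 0 by simp
next
  case (Suc k)
  have "x \<in> carrier M" using Suc tclosedD(1)[OF tclosed_hpart[OF T s N]] by auto
  then have "(s [^] Suc k) \<odot>\<^bsub>M\<^esub> x = s \<odot>\<^bsub>M\<^esub> ((s [^] k) \<odot>\<^bsub>M\<^esub> x)"
    using s by (simp add: smult_assoc1[symmetric] R.m_comm)
  then show ?case using hpart_smult[OF s N T Suc(1)[OF Suc(2)]] by simp
qed

text \<open>Hilbert's basis theorem: the leading coefficients of elements of \<open>P\<close> form an ascending
  chain of closed subsets of \<open>N\<close>. No independence of the powers of \<open>s\<close> is needed, since one
  works with arbitrary representations.\<close>

theorem tnoetherian_adjoin:
  assumes T: "T \<subseteq> carrier R" "\<ominus> \<one> \<in> T" and s: "s \<in> carrier R"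
    and N: "tclosed M T N" "tnoetherian M T N"
  shows "tnoetherian M (insert s T) (tspan M (insert s T) N)"
  unfolding tnoetherian_def
proof (intro allI impI)
  let ?T = "insert s T"
  fix P assume P: "tclosed M ?T P" "P \<subseteq> tspan M ?T N"
  note Pc = tclosedD[OF P(1)]
  have PT: "tclosed M T P" using P(1) by (auto simp: tclosed_def)
  note Ec = tclosedD[OF tclosed_hpart[OF T(1) s N(1)]]
  note mono = subsetD[OF hpart_mono[OF s N(1) T(1)]]
  \<comment> \<open>\<open>E\<close> contains \<open>N\<close> and is closed under \<open>T\<close>
    and \<open>s\<close>, so every element of \<open>P\<close> is a polynomial expression in
    \<open>s\<close>.\<close>
  define E where "E = (\<Union>d. hpart d s N)"
  have "tclosed M ?T E"
  proof (rule tclosedI)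
    show "E \<subseteq> carrier M" "\<zero>\<^bsub>M\<^esub> \<in> E" using Ec by (auto simp: E_def)
    fix x y assume "x \<in> E" "y \<in> E"
    then obtain d e where "x \<in> hpart d s N" "y \<in> hpart e s N" by (auto simp: E_def)
    then have "x \<in> hpart (max d e) s N" "y \<in> hpart (max d e) s N"
      using mono[of d "max d e"] mono[of e "max d e"] by auto
    then show "x \<oplus>\<^bsub>M\<^esub> y \<in> E" using Ec(3) unfolding E_def by blast
  next
    fix t x assume "t \<in> ?T" "x \<in> E"
    then obtain d where "x \<in> hpart d s N" by (auto simp: E_def)
    then show "t \<odot>\<^bsub>M\<^esub> x \<in> E"
      using \<open>t \<in> ?T\<close> hpart_smult[OF s N(1) T(1)] Ec(4) unfolding E_def by blast
  qed
  moreover have "N \<subseteq> E"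
  proof
    fix n assume n: "n \<in> N"
    then have "n \<in> carrier M" using tclosedD(1)[OF N(1)] by auto
    then have "(s [^] (0::nat)) \<odot>\<^bsub>M\<^esub> n \<oplus>\<^bsub>M\<^esub> \<zero>\<^bsub>M\<^esub> = n" by simp
    then have "n \<in> hpart (Suc 0) s N" using hpart_SucI[OF n, of "\<zero>\<^bsub>M\<^esub>" 0 s] by (simp add: hpart_0)
    then show "n \<in> E" unfolding E_def by blast
  qed
  ultimately have PE: "P \<subseteq> E" using P(2) tspan_subset[of M ?T E N] by (meson order_trans)
  \<comment> \<open>The leading coefficients in degree \<open>d\<close>, taken over all
    representations of elements of \<open>P\<close>.\<close>
  define L where "L d = {n \<in> N. \<exists>y\<in>hpart d s N. (s [^] d) \<odot>\<^bsub>M\<^esub> n \<oplus>\<^bsub>M\<^esub> y \<in> P}" for d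
  have cN: "n \<in> N \<Longrightarrow> n \<in> carrier M" for n using tclosedD(1)[OF N(1)] by auto
  have cE: "n \<in> hpart d s N \<Longrightarrow> n \<in> carrier M" for n d using Ec(1) by auto
  have sc: "s [^] d \<in> carrier R" for d :: nat using s by simp
  have Lcl: "tclosed M T (L d)" for d
  proof (rule tclosedI)
    show "L d \<subseteq> carrier M" using cN by (auto simp: L_def)
    have "(s [^] d) \<odot>\<^bsub>M\<^esub> \<zero>\<^bsub>M\<^esub> \<oplus>\<^bsub>M\<^esub> \<zero>\<^bsub>M\<^esub> \<in> P" using sc Pc(2) by simp
    then show "\<zero>\<^bsub>M\<^esub> \<in> L d" using Ec(2) tclosedD(2)[OF N(1)] unfolding L_def by blast
  next
    fix x y assume "x \<in> L d" "y \<in> L d"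
    then obtain u v where h: "x \<in> N" "y \<in> N" "u \<in> hpart d s N" "v \<in> hpart d s N"
      "(s [^] d) \<odot>\<^bsub>M\<^esub> x \<oplus>\<^bsub>M\<^esub> u \<in> P" "(s [^] d) \<odot>\<^bsub>M\<^esub> y \<oplus>\<^bsub>M\<^esub> v \<in> P" unfolding L_def by blast
    have "(s [^] d) \<odot>\<^bsub>M\<^esub> (x \<oplus>\<^bsub>M\<^esub> y) \<oplus>\<^bsub>M\<^esub> (u \<oplus>\<^bsub>M\<^esub> v) = ((s [^] d) \<odot>\<^bsub>M\<^esub> x \<oplus>\<^bsub>M\<^esub> u) \<oplus>\<^bsub>M\<^esub> ((s [^] d) \<odot>\<^bsub>M\<^esub> y \<oplus>\<^bsub>M\<^esub> v)"
      using h(1-4) cN cE sc by (simp add: smult_r_distr add_interchange)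
    also have "\<dots> \<in> P" using h Pc(3) by simp
    finally show "x \<oplus>\<^bsub>M\<^esub> y \<in> L d"
      using Ec(3)[OF h(3,4)] tclosedD(3)[OF N(1) h(1,2)] unfolding L_def by blast
  next
    fix t x assume t: "t \<in> T" and "x \<in> L d"
    then obtain u where h: "x \<in> N" "u \<in> hpart d s N" "(s [^] d) \<odot>\<^bsub>M\<^esub> x \<oplus>\<^bsub>M\<^esub> u \<in> P" unfolding L_def by blast
    have tR: "t \<in> carrier R" using t T by auto
    have "(s [^] d) \<odot>\<^bsub>M\<^esub> (t \<odot>\<^bsub>M\<^esub> x) \<oplus>\<^bsub>M\<^esub> t \<odot>\<^bsub>M\<^esub> u = t \<odot>\<^bsub>M\<^esub> ((s [^] d) \<odot>\<^bsub>M\<^esub> x \<oplus>\<^bsub>M\<^esub> u)"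
      using h(1,2) cN cE sc tR by (simp add: smult_r_distr smult_assoc1[symmetric] R.m_comm)
    also have "\<dots> \<in> P" using h(3) Pc(4) t by simp
    finally show "t \<odot>\<^bsub>M\<^esub> x \<in> L d"
      using Ec(4)[OF t h(2)] tclosedD(4)[OF N(1) t h(1)] unfolding L_def by blast
  qed
  have LSuc: "L d \<subseteq> L (Suc d)" for d
  proof
    fix x assume "x \<in> L d"
    then obtain u where h: "x \<in> N" "u \<in> hpart d s N" "(s [^] d) \<odot>\<^bsub>M\<^esub> x \<oplus>\<^bsub>M\<^esub> u \<in> P" unfolding L_def by blast
    have "(s [^] Suc d) \<odot>\<^bsub>M\<^esub> x \<oplus>\<^bsub>M\<^esub> s \<odot>\<^bsub>M\<^esub> u = s \<odot>\<^bsub>M\<^esub> ((s [^] d) \<odot>\<^bsub>M\<^esub> x \<oplus>\<^bsub>M\<^esub> u)"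
      using h(1,2) cN cE s by (simp add: smult_r_distr smult_assoc1[symmetric] R.m_comm)
    also have "\<dots> \<in> P" using h(3) Pc(4) by simp
    finally show "x \<in> L (Suc d)"
      using hpart_smult[OF s N(1) T(1) h(2)] h(1) unfolding L_def by blast
  qed
  have Lmono: "d \<le> e \<Longrightarrow> L d \<subseteq> L e" for d e
    using lift_Suc_mono_le[of L d e] LSuc by blast
  have "tclosed M T (\<Union>d. L d)"
  proof (rule tclosedI)
    show "(\<Union>d. L d) \<subseteq> carrier M" "\<zero>\<^bsub>M\<^esub> \<in> (\<Union>d. L d)" using tclosedD(1,2)[OF Lcl] by auto
    fix x y assume "x \<in> (\<Union>d. L d)" "y \<in> (\<Union>d. L d)"
    then obtain d e where "x \<in> L d" "y \<in> L e" by auto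
    then have "x \<in> L (max d e)" "y \<in> L (max d e)"
      using Lmono[of d "max d e"] Lmono[of e "max d e"] by auto
    then show "x \<oplus>\<^bsub>M\<^esub> y \<in> (\<Union>d. L d)" using tclosedD(3)[OF Lcl] by blast
  next
    fix t x assume "t \<in> T" "x \<in> (\<Union>d. L d)"
    then show "t \<odot>\<^bsub>M\<^esub> x \<in> (\<Union>d. L d)" using tclosedD(4)[OF Lcl] by blast
  qed
  moreover have "(\<Union>d. L d) \<subseteq> N" by (auto simp: L_def)
  ultimately obtain S0 where S0: "finite S0" "S0 \<subseteq> (\<Union>d. L d)" "(\<Union>d. L d) \<subseteq> tspan M T S0"
    using tnoetherianD[OF N(2)] by metis
  \<comment> \<open>The chain \<open>L\<close> is ascending and \<open>S0\<close> is finite, so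
    \<open>S0\<close> already lies in one member; from \<open>D\<close> on, \<open>S0\<close>
    generates every \<open>L d\<close>.\<close>
  have "\<exists>D. S0 \<subseteq> L D"
    using S0(1,2)
  proof (induct S0 rule: finite_induct)
    case (insert x F)
    then obtain D d where "F \<subseteq> L D" "x \<in> L d" by auto
    then have "insert x F \<subseteq> L (max d D)"
      using Lmono[of d "max d D"] Lmono[of D "max d D"] by auto
    then show ?case by blast
  qed simp
  then obtain D where D: "S0 \<subseteq> L D" by blast
  have "\<forall>d. \<exists>S. finite S \<and> S \<subseteq> L d \<and> L d \<subseteq> tspan M T S"
  proof
    fix d
    have "L d \<subseteq> N" by (auto simp: L_def)
    then show "\<exists>S. finite S \<and> S \<subseteq> L d \<and> L d \<subseteq> tspan M T S"
      using tnoetherianD[OF N(2) Lcl] by metis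
  qed
  then obtain S where S: "\<And>d. finite (S d)" "\<And>d. S d \<subseteq> L d" "\<And>d. L d \<subseteq> tspan M T (S d)"
    by metis
  have "\<forall>d n. n \<in> L d \<longrightarrow> (\<exists>y. y \<in> hpart d s N \<and> (s [^] d) \<odot>\<^bsub>M\<^esub> n \<oplus>\<^bsub>M\<^esub> y \<in> P)"
    unfolding L_def by blast
  then obtain g where g: "\<And>d n. n \<in> L d \<Longrightarrow> g d n \<in> hpart d s N \<and> (s [^] d) \<odot>\<^bsub>M\<^esub> n \<oplus>\<^bsub>M\<^esub> g d n \<in> P"
    by metis
  \<comment> \<open>Below \<open>D\<close> each degree has its own generators; all degrees from
    \<open>D\<close> on share \<open>S0\<close>, lifted in degree \<open>D\<close>. Hence
    \<open>min d D\<close> is the degree whose lifts take care of \<open>L d\<close>, and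
    \<open>Q\<close> is finite.\<close>
  define S' where "S' d = (if d < D then S d else S0)" for d
  have LS0: "L d \<subseteq> tspan M T S0" for d using S0(3) by blast
  have S'L: "S' (min d D) \<subseteq> L (min d D)" for d
    using S(2) D by (cases "d < D") (simp_all add: S'_def min_def)
  have S'span: "L d \<subseteq> tspan M T (S' (min d D))" for d
    using S(3) LS0 by (cases "d < D") (simp_all add: S'_def min_def)
  define Q where "Q = (\<Union>d\<in>{..D}. (\<lambda>n. (s [^] d) \<odot>\<^bsub>M\<^esub> n \<oplus>\<^bsub>M\<^esub> g d n) ` S' d)"
  have finQ: "finite Q" using S(1) S0(1) by (auto simp: Q_def S'_def)
  have QP: "Q \<subseteq> P"
  proof
    fix q assume "q \<in> Q"
    then obtain d n where "d \<le> D" "n \<in> S' d" "q = (s [^] d) \<odot>\<^bsub>M\<^esub> n \<oplus>\<^bsub>M\<^esub> g d n" by (auto simp: Q_def)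
    then show "q \<in> P" using g[of n d] S'L[of d] by (auto simp: min_absorb1)
  qed
  have spP: "tspan M ?T Q \<subseteq> P" by (rule tspan_subset[OF P(1) QP])
  \<comment> \<open>A generator lifted in degree \<open>e\<close> is multiplied by
    \<open>s [^] (d - e)\<close> so that it leads in degree \<open>d\<close>. The lower terms of the
    result are not controlled beyond lying in \<open>hpart d s N\<close>.\<close>
  have lift: "\<exists>y\<in>hpart d s N. (s [^] d) \<odot>\<^bsub>M\<^esub> n \<oplus>\<^bsub>M\<^esub> y \<in> tspan M ?T Q \<and> n \<in> N"
    if "n \<in> tspan M T (S' e)" "e \<le> d" "e \<le> D" for n d e
    using that(1)
  proof induct
    case tspan_zero
    show ?case using Ec(2) tclosedD(2)[OF N(1)] sc tspan.tspan_zero[of M ?T Q]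
      by (intro bexI[of _ "\<zero>\<^bsub>M\<^esub>"]) simp_all
  next
    case (tspan_base n)
    have nL: "n \<in> L e" using tspan_base S'L[of e] that(3) by (auto simp: min_absorb1)
    have nN: "n \<in> N" using nL by (auto simp: L_def)
    have gE: "g e n \<in> hpart e s N" using g[OF nL] by simp
    have q: "(s [^] e) \<odot>\<^bsub>M\<^esub> n \<oplus>\<^bsub>M\<^esub> g e n \<in> tspan M ?T Q"
      using tspan_base that(3) by (intro tspan.tspan_base) (auto simp: Q_def)
    have pw: "x \<in> tspan M ?T Q \<Longrightarrow> (s [^] k) \<odot>\<^bsub>M\<^esub> x \<in> tspan M ?T Q" for x and k :: nat
    proof (induct k)
      case 0
      then show ?case using spP Pc(1) by auto
    next
      case (Suc k)
      have "x \<in> carrier M" using Suc(2) spP Pc(1) by auto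
      then have "(s [^] Suc k) \<odot>\<^bsub>M\<^esub> x = s \<odot>\<^bsub>M\<^esub> ((s [^] k) \<odot>\<^bsub>M\<^esub> x)"
        using s by (simp add: smult_assoc1[symmetric] R.m_comm)
      then show ?case using tspan.tspan_smult[of s ?T, OF _ Suc(1)[OF Suc(2)]] by simp
    qed
    have "s [^] (d - e) \<otimes> s [^] e = s [^] d"
      using s that(2) by (simp add: R.nat_pow_mult)
    then have "(s [^] (d - e)) \<odot>\<^bsub>M\<^esub> ((s [^] e) \<odot>\<^bsub>M\<^esub> n \<oplus>\<^bsub>M\<^esub> g e n)
        = (s [^] d) \<odot>\<^bsub>M\<^esub> n \<oplus>\<^bsub>M\<^esub> (s [^] (d - e)) \<odot>\<^bsub>M\<^esub> g e n"
      using cN[OF nN] cE[OF gE] sc by (simp add: smult_r_distr smult_assoc1[symmetric])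
    moreover have "(s [^] (d - e)) \<odot>\<^bsub>M\<^esub> g e n \<in> hpart d s N"
      using hpart_pow_smult[OF s N(1) T(1) gE, of "d - e"] that(2) by simp
    ultimately show ?case using pw[OF q, of "d - e"] nN by auto
  next
    case (tspan_add x y)
    then obtain u v where h: "x \<in> N" "y \<in> N" "u \<in> hpart d s N" "v \<in> hpart d s N"
      "(s [^] d) \<odot>\<^bsub>M\<^esub> x \<oplus>\<^bsub>M\<^esub> u \<in> tspan M ?T Q" "(s [^] d) \<odot>\<^bsub>M\<^esub> y \<oplus>\<^bsub>M\<^esub> v \<in> tspan M ?T Q" by auto
    have "(s [^] d) \<odot>\<^bsub>M\<^esub> (x \<oplus>\<^bsub>M\<^esub> y) \<oplus>\<^bsub>M\<^esub> (u \<oplus>\<^bsub>M\<^esub> v) = ((s [^] d) \<odot>\<^bsub>M\<^esub> x \<oplus>\<^bsub>M\<^esub> u) \<oplus>\<^bsub>M\<^esub> ((s [^] d) \<odot>\<^bsub>M\<^esub> y \<oplus>\<^bsub>M\<^esub> v)"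
      using h(1-4) cN cE sc by (simp add: smult_r_distr add_interchange)
    also have "\<dots> \<in> tspan M ?T Q" by (rule tspan.tspan_add) (fact h)+
    finally show ?case using Ec(3)[OF h(3,4)] tclosedD(3)[OF N(1) h(1,2)] by blast
  next
    case (tspan_smult t x)
    then obtain u where h: "x \<in> N" "u \<in> hpart d s N" "(s [^] d) \<odot>\<^bsub>M\<^esub> x \<oplus>\<^bsub>M\<^esub> u \<in> tspan M ?T Q" by auto
    have t: "t \<in> T" by fact
    have tR: "t \<in> carrier R" using t T by auto
    have "(s [^] d) \<odot>\<^bsub>M\<^esub> (t \<odot>\<^bsub>M\<^esub> x) \<oplus>\<^bsub>M\<^esub> t \<odot>\<^bsub>M\<^esub> u = t \<odot>\<^bsub>M\<^esub> ((s [^] d) \<odot>\<^bsub>M\<^esub> x \<oplus>\<^bsub>M\<^esub> u)"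
      using h(1,2) cN cE sc tR by (simp add: smult_r_distr smult_assoc1[symmetric] R.m_comm)
    also have "\<dots> \<in> tspan M ?T Q" by (rule tspan.tspan_smult) (use t h in auto)
    finally show ?case using Ec(4)[OF t h(2)] tclosedD(4)[OF N(1) t h(1)] by blast
  qed
  \<comment> \<open>Subtracting a combination of \<open>Q\<close> with the same leading coefficient
    cancels the top power and leaves an element of \<open>P\<close> in \<open>hpart d s N\<close>,
    to which the induction applies.\<close>
  have main: "x \<in> P \<Longrightarrow> x \<in> hpart d s N \<Longrightarrow> x \<in> tspan M ?T Q" for d x
  proof (induct d arbitrary: x)
    case 0
    then show ?case by (simp add: hpart_0 tspan.tspan_zero)
  next
    case (Suc d)
    from Suc(3) obtain n y where h: "n \<in> N" "y \<in> hpart d s N" "x = (s [^] d) \<odot>\<^bsub>M\<^esub> n \<oplus>\<^bsub>M\<^esub> y"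
      by (elim hpart_SucE)
    have "n \<in> L d" using h Suc(2) unfolding L_def by blast
    then have "n \<in> tspan M T (S' (min d D))" using S'span by blast
    then obtain y' where y': "y' \<in> hpart d s N" "(s [^] d) \<odot>\<^bsub>M\<^esub> n \<oplus>\<^bsub>M\<^esub> y' \<in> tspan M ?T Q"
      using lift[of n "min d D" d] by auto
    have c: "n \<in> carrier M" "y \<in> carrier M" "y' \<in> carrier M" using h y' cN cE by auto
    have e: "x \<ominus>\<^bsub>M\<^esub> ((s [^] d) \<odot>\<^bsub>M\<^esub> n \<oplus>\<^bsub>M\<^esub> y') = y \<ominus>\<^bsub>M\<^esub> y'"
      using c sc h(3) by (simp add: add_minus_cancel_left)
    have "y \<ominus>\<^bsub>M\<^esub> y' \<in> P"
      using tclosed_minus[OF PT T(2) Suc(2), of "(s [^] d) \<odot>\<^bsub>M\<^esub> n \<oplus>\<^bsub>M\<^esub> y'"] spP y' e by auto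
    moreover have "y \<ominus>\<^bsub>M\<^esub> y' \<in> hpart d s N"
      using tclosed_minus[OF tclosed_hpart[OF T(1) s N(1)] T(2)] h y' by simp
    ultimately have "y \<ominus>\<^bsub>M\<^esub> y' \<in> tspan M ?T Q" by (rule Suc(1))
    moreover have "x = ((s [^] d) \<odot>\<^bsub>M\<^esub> n \<oplus>\<^bsub>M\<^esub> y') \<oplus>\<^bsub>M\<^esub> (y \<ominus>\<^bsub>M\<^esub> y')"
      using c sc h(3) by (simp add: add_add_minus_cancel)
    ultimately show ?case using tspan.tspan_add[OF y'(2)] by simp
  qed
  have "P \<subseteq> tspan M ?T Q" using main PE unfolding E_def by blast
  then show "\<exists>S. finite S \<and> S \<subseteq> P \<and> P \<subseteq> tspan M ?T S" using finQ QP by (intro exI[of _ Q]) simp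
qed

section \<open>Exchange arguments over a field\<close>

lemma subfield_minus_one:
  assumes "subfield K R"
  shows "\<ominus> \<one> \<in> K" "K \<subseteq> carrier R" "\<zero> \<in> K" "\<one> \<in> K"
  using subringE[OF subfieldE(1)[OF assms]] by auto

lemma tspan_insert:
  assumes K: "subfield K R" and y: "y \<in> carrier M" and B: "B \<subseteq> carrier M"
    and x: "x \<in> tspan M K (insert y B)"
  shows "\<exists>c\<in>K. \<exists>b\<in>tspan M K B. x = c \<odot>\<^bsub>M\<^esub> y \<oplus>\<^bsub>M\<^esub> b"
proof -
  note Kc = subfield_minus_one[OF K] and Kr = subringE[OF subfieldE(1)[OF K]]
  have sp: "b \<in> tspan M K B \<Longrightarrow> b \<in> carrier M" for b
    using tclosedD(1)[OF tclosed_tspan[OF Kc(2) B]] by auto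
  show ?thesis
    using x
  proof induct
    case tspan_zero
    have "\<zero>\<^bsub>M\<^esub> = \<zero> \<odot>\<^bsub>M\<^esub> y \<oplus>\<^bsub>M\<^esub> \<zero>\<^bsub>M\<^esub>" using y by simp
    then show ?case using Kc(3) tspan.tspan_zero[of M K B] by blast
  next
    case (tspan_base x)
    show ?case
    proof (cases "x = y")
      case True
      have "x = \<one> \<odot>\<^bsub>M\<^esub> y \<oplus>\<^bsub>M\<^esub> \<zero>\<^bsub>M\<^esub>" using y True by simp
      then show ?thesis using Kc(4) tspan.tspan_zero[of M K B] by blast
    next
      case False
      then have "x \<in> B" using tspan_base by simp
      then have "x = \<zero> \<odot>\<^bsub>M\<^esub> y \<oplus>\<^bsub>M\<^esub> x" using y B by auto
      then show ?thesis using Kc(3) tspan.tspan_base[OF \<open>x \<in> B\<close>, of M K] by blast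
    qed
  next
    case (tspan_add u v)
    then obtain c d a b where h: "c \<in> K" "d \<in> K" "a \<in> tspan M K B" "b \<in> tspan M K B"
      "u = c \<odot>\<^bsub>M\<^esub> y \<oplus>\<^bsub>M\<^esub> a" "v = d \<odot>\<^bsub>M\<^esub> y \<oplus>\<^bsub>M\<^esub> b" by auto
    have "u \<oplus>\<^bsub>M\<^esub> v = (c \<oplus> d) \<odot>\<^bsub>M\<^esub> y \<oplus>\<^bsub>M\<^esub> (a \<oplus>\<^bsub>M\<^esub> b)"
      using h sp y Kc(2) by (simp add: subset_iff smult_l_distr add_interchange)
    then show ?case using Kr(7)[OF h(1,2)] tspan.tspan_add[OF h(3,4)] by blast
  next
    case (tspan_smult t u)
    then obtain c a where h: "c \<in> K" "a \<in> tspan M K B" "u = c \<odot>\<^bsub>M\<^esub> y \<oplus>\<^bsub>M\<^esub> a" by auto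
    have "t \<odot>\<^bsub>M\<^esub> u = (t \<otimes> c) \<odot>\<^bsub>M\<^esub> y \<oplus>\<^bsub>M\<^esub> t \<odot>\<^bsub>M\<^esub> a"
      using h sp y Kc(2) tspan_smult(1) by (simp add: subset_iff smult_r_distr smult_assoc1)
    then show ?case using Kr(6)[OF tspan_smult(1) h(1)] tspan.tspan_smult[OF tspan_smult(1) h(2)] by blast
  qed
qed

text \<open>The coefficient of \<open>y\<close> in \<open>x\<close> is nonzero because
  \<open>x\<close> is outside the span of \<open>B\<close>, so the relation can be solved for
  \<open>y\<close>.\<close>

lemma tspan_exchange:
  assumes K: "subfield K R" and y: "y \<in> carrier M" and B: "B \<subseteq> carrier M"
    and x: "x \<in> tspan M K (insert y B)" "x \<notin> tspan M K B"
  shows "y \<in> tspan M K (insert x B)"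
proof -
  note Kc = subfield_minus_one[OF K]
  obtain c b where h: "c \<in> K" "b \<in> tspan M K B" "x = c \<odot>\<^bsub>M\<^esub> y \<oplus>\<^bsub>M\<^esub> b"
    using tspan_insert[OF K y B x(1)] by auto
  have bM: "b \<in> carrier M" using h tclosedD(1)[OF tclosed_tspan[OF Kc(2) B]] by auto
  have cR: "c \<in> carrier R" using h Kc by auto
  have "c \<noteq> \<zero>" using h x(2) y bM by auto
  then have ic: "inv c \<in> K" "inv c \<otimes> c = \<one>" using R.subfield_m_inv[OF K, of c] h by auto
  have icR: "inv c \<in> carrier R" using ic Kc by auto
  have xM: "x \<in> carrier M" using h(3) cR y bM by simp
  have "x \<ominus>\<^bsub>M\<^esub> b = c \<odot>\<^bsub>M\<^esub> y"
    using h(3) cR y bM by (simp add: M.minus_eq M.a_assoc M.r_neg)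
  then have "y = inv c \<odot>\<^bsub>M\<^esub> (x \<ominus>\<^bsub>M\<^esub> b)" using ic icR cR y by (simp add: smult_assoc1[symmetric])
  moreover have "x \<ominus>\<^bsub>M\<^esub> b \<in> tspan M K (insert x B)"
  proof (rule tclosed_minus[OF tclosed_tspan[OF Kc(2)] Kc(1)])
    show "insert x B \<subseteq> carrier M" using xM B by simp
    show "x \<in> tspan M K (insert x B)" by (simp add: tspan_base)
    show "b \<in> tspan M K (insert x B)" using h(2) tspan_mono[of B "insert x B" K K M] by auto
  qed
  ultimately show ?thesis using tspan_smult[OF ic(1)] by metis
qed

text \<open>When the elements of \<open>Y\<close> are adjoined to \<open>B\<close> one at a time,
  \<open>x\<close> enters the span at some \<open>y\<close>, and this \<open>y\<close> can be
  exchanged for \<open>x\<close>.\<close>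

lemma tspan_exchange_finite:
  assumes K: "subfield K R" and "finite Y" "Y \<subseteq> carrier M" and B: "B \<subseteq> carrier M"
    and "x \<in> tspan M K (Y \<union> B)" "x \<notin> tspan M K B"
  shows "\<exists>y\<in>Y. y \<in> tspan M K (insert x ((Y - {y}) \<union> B))"
  using assms(2,3,5)
proof (induct Y rule: finite_induct)
  case empty
  then show ?case using assms(6) by simp
next
  case (insert y Y)
  show ?case
  proof (cases "x \<in> tspan M K (Y \<union> B)")
    case True
    then obtain z where z: "z \<in> Y" "z \<in> tspan M K (insert x ((Y - {z}) \<union> B))" using insert by auto
    have "tspan M K (insert x ((Y - {z}) \<union> B)) \<subseteq> tspan M K (insert x ((insert y Y - {z}) \<union> B))"
      by (rule tspan_mono) auto
    then show ?thesis using z by blast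
  next
    case False
    have "insert y Y - {y} = Y" using insert by auto
    then show ?thesis
      using tspan_exchange[OF K, of y "Y \<union> B" x] insert(4,5) B False by auto
  qed
qed

end

text \<open>Linear independence modulo the span of \<open>B\<close>, in a form that lets a vector be
  prepended as soon as it lies outside the span of the rest. This is how lists of homology classes
  are extended, with \<open>B\<close> the boundaries.\<close>

primrec indep_mod :: "('a, 'b, 'm) module_scheme \<Rightarrow> 'a set \<Rightarrow> 'b set \<Rightarrow> 'b list \<Rightarrow> bool" where
  "indep_mod M K B [] \<longleftrightarrow> True"
| "indep_mod M K B (x # xs) \<longleftrightarrow> x \<notin> tspan M K (set xs \<union> B) \<and> indep_mod M K B xs"

context module
begin

text \<open>Replacement relative to \<open>B\<close>: the entries of \<open>xs\<close>, from the
  last to the first, displace elements of \<open>Y\<close>. With \<open>B\<close> the boundaries it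
  bounds independent homology classes by the dimension, without a basis of the quotient.\<close>

lemma steinitz:
  assumes K: "subfield K R" and Y: "finite Y" "Y \<subseteq> carrier M" and B: "B \<subseteq> carrier M"
    and xs: "indep_mod M K B xs" "set xs \<subseteq> tspan M K (Y \<union> B)"
  shows "length xs \<le> card Y"
proof -
  note Kc = subfield_minus_one[OF K]
  have YB: "tspan M K (Y \<union> B) \<subseteq> carrier M"
    by (rule tclosedD(1)[OF tclosed_tspan[OF Kc(2)]]) (use Y B in auto)
  \<comment> \<open>\<open>Y'\<close> consists of the elements of \<open>Y\<close> that have not
    been displaced yet.\<close>
  have "\<exists>Y'\<subseteq>Y. card Y' + length xs = card Y \<and> Y \<subseteq> tspan M K (Y' \<union> (set xs \<union> B))"
    using xs
  proof (induct xs)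
    case Nil
    show ?case by (intro exI[of _ Y]) (auto intro: tspan_base)
  next
    case (Cons x xs)
    then obtain Y' where Y': "Y' \<subseteq> Y" "card Y' + length xs = card Y" "Y \<subseteq> tspan M K (Y' \<union> (set xs \<union> B))"
      by auto
    have sub: "Y \<union> B \<subseteq> tspan M K (Y' \<union> (set xs \<union> B))"
      using Y'(3) by (auto intro: tspan_base)
    have x: "x \<in> tspan M K (Y' \<union> (set xs \<union> B))"
      by (rule tspan_trans[OF _ sub order_refl]) (use Cons(3) in auto)
    have "\<exists>y\<in>Y'. y \<in> tspan M K (insert x ((Y' - {y}) \<union> (set xs \<union> B)))"
      by (rule tspan_exchange_finite[OF K _ _ _ x])
        (use Y' Y B Cons(2,3) YB in \<open>auto dest: finite_subset\<close>)
    then obtain y where y: "y \<in> Y'" "y \<in> tspan M K (insert x ((Y' - {y}) \<union> (set xs \<union> B)))" by blast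
    have eq: "insert x ((Y' - {y}) \<union> (set xs \<union> B)) = (Y' - {y}) \<union> (set (x # xs) \<union> B)" by auto
    have sub2: "Y' \<union> (set xs \<union> B) \<subseteq> tspan M K ((Y' - {y}) \<union> (set (x # xs) \<union> B))"
      using y(2) unfolding eq by (auto intro: tspan_base)
    have "Y \<subseteq> tspan M K ((Y' - {y}) \<union> (set (x # xs) \<union> B))"
      using Y'(3) tspan_trans[OF _ sub2 order_refl] by blast
    moreover have "card (Y' - {y}) + length (x # xs) = card Y"
      using Y' y(1) Y(1) card_Suc_Diff1[of Y' y] by (auto dest: finite_subset)
    ultimately show ?case using Y'(1) by (intro exI[of _ "Y' - {y}"]) auto
  qed
  then show ?thesis by auto
qed

section \<open>Noetherian property of finitely generated algebras over a field\<close>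

text \<open>Any nonzero element of \<open>P\<close> can be exchanged for \<open>x\<close> and
  therefore generates the whole line.\<close>

lemma tnoetherian_line:
  assumes K: "subfield K R" and x: "x \<in> carrier M"
  shows "tnoetherian M K (tspan M K {x})"
  unfolding tnoetherian_def
proof (intro allI impI)
  note Kc = subfield_minus_one[OF K]
  fix P assume P: "tclosed M K P" "P \<subseteq> tspan M K {x}"
  show "\<exists>S. finite S \<and> S \<subseteq> P \<and> P \<subseteq> tspan M K S"
  proof (cases "P = {\<zero>\<^bsub>M\<^esub>}")
    case True
    then show ?thesis using tspan_zero[of M K "{}"] by (intro exI[of _ "{}"]) simp
  next
    case False
    then obtain p where p: "p \<in> P" "p \<noteq> \<zero>\<^bsub>M\<^esub>" using tclosedD(2)[OF P(1)] by auto
    have 0: "tspan M K {} \<subseteq> {\<zero>\<^bsub>M\<^esub>}"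
      by (rule tspan_subset) (use Kc in \<open>auto simp: tclosed_def\<close>)
    have "x \<in> tspan M K (insert p {})"
      by (rule tspan_exchange[OF K x]) (use p P 0 in auto)
    then have "tspan M K {x} \<subseteq> tspan M K {p}" using tspan_trans[of _ M K "{x}" K "{p}"] by auto
    then show ?thesis using p P by (intro exI[of _ "{p}"]) auto
  qed
qed

lemma tnoetherian_finite_span:
  assumes K: "subfield K R" and S: "finite S" "S \<subseteq> carrier M"
  shows "tnoetherian M K (tspan M K S)"
  using S
proof (induct S rule: finite_induct)
  case empty
  have "tspan M K {} \<subseteq> {\<zero>\<^bsub>M\<^esub>}"
    by (rule tspan_subset) (use subfield_minus_one[OF K] in \<open>auto simp: tclosed_def\<close>)
  also have "\<dots> \<subseteq> tspan M K {\<zero>\<^bsub>M\<^esub>}" by (auto intro: tspan_base)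
  finally show ?case using tnoetherian_mono[OF tnoetherian_line[OF K, of "\<zero>\<^bsub>M\<^esub>"]] by simp
next
  case (insert x S)
  note Kc = subfield_minus_one[OF K]
  have "tnoetherian M K {a \<oplus>\<^bsub>M\<^esub> b | a b. a \<in> tspan M K {x} \<and> b \<in> tspan M K S}"
    by (rule tnoetherian_sum[OF Kc(2,1)])
      (use insert Kc in \<open>auto intro: tclosed_tspan tnoetherian_line[OF K]\<close>)
  moreover have "tspan M K (insert x S) \<subseteq> {a \<oplus>\<^bsub>M\<^esub> b | a b. a \<in> tspan M K {x} \<and> b \<in> tspan M K S}"
  proof
    fix z assume "z \<in> tspan M K (insert x S)"
    then obtain c b where "c \<in> K" "b \<in> tspan M K S" "z = c \<odot>\<^bsub>M\<^esub> x \<oplus>\<^bsub>M\<^esub> b"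
      using tspan_insert[OF K, of x S z] insert by auto
    then show "z \<in> {a \<oplus>\<^bsub>M\<^esub> b | a b. a \<in> tspan M K {x} \<and> b \<in> tspan M K S}"
      using tspan_smult[of c K x M "{x}"] tspan_base[of x "{x}" M K] by blast
  qed
  ultimately show ?case by (rule tnoetherian_mono)
qed

lemma tnoetherian_adjoin_finite:
  assumes T: "T \<subseteq> carrier R" "\<ominus> \<one> \<in> T" and F: "finite F" "F \<subseteq> carrier R"
    and N: "N \<subseteq> carrier M" "tnoetherian M T (tspan M T N)"
  shows "tnoetherian M (F \<union> T) (tspan M (F \<union> T) N)"
  using F
proof (induct F rule: finite_induct)
  case empty
  then show ?case using N by simp
next
  case (insert s F)
  have FT: "F \<union> T \<subseteq> carrier R" "\<ominus> \<one> \<in> F \<union> T" using insert T by auto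
  have "tnoetherian M (insert s (F \<union> T)) (tspan M (insert s (F \<union> T)) (tspan M (F \<union> T) N))"
    by (rule tnoetherian_adjoin[OF FT]) (use insert tclosed_tspan[OF FT(1) N(1)] in auto)
  moreover have "tspan M (insert s (F \<union> T)) N \<subseteq> tspan M (insert s (F \<union> T)) (tspan M (F \<union> T) N)"
    by (rule tspan_mono) (auto intro: tspan_base)
  ultimately show ?case using tnoetherian_mono by simp
qed

text \<open>This leads back from bare operator sets to the ring: operators adjoined one by one give
  closure under \<open>H\<close>, and sums and products of operators add nothing. Negatives are
  reduced to \<open>\<ominus> \<one>\<close>.\<close>

lemma tclosed_generate_ring:
  assumes "tclosed M H N" "H \<subseteq> carrier R" "\<ominus> \<one> \<in> H"
  shows "tclosed M (generate_ring R H) N"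
proof -
  note Nc = tclosedD[OF assms(1)]
  have "a \<in> carrier R \<and> (\<forall>x\<in>N. a \<odot>\<^bsub>M\<^esub> x \<in> N)" if "a \<in> generate_ring R H" for a
    using that
  proof induct
    case one
    then show ?case using Nc(1) by auto
  next
    case (incl h)
    then show ?case using Nc(4) assms(2) by auto
  next
    case (a_inv h)
    have "(\<ominus> h) \<odot>\<^bsub>M\<^esub> x \<in> N" if x: "x \<in> N" for x
    proof -
      have "(\<ominus> h) \<odot>\<^bsub>M\<^esub> x = (\<ominus> \<one>) \<odot>\<^bsub>M\<^esub> (h \<odot>\<^bsub>M\<^esub> x)"
        using a_inv x Nc(1) by (auto simp: smult_l_minus)
      then show ?thesis using a_inv x Nc(4)[OF assms(3)] by simp
    qed
    then show ?case using a_inv by simp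
  next
    case (eng_add h k)
    have "(h \<oplus> k) \<odot>\<^bsub>M\<^esub> x = h \<odot>\<^bsub>M\<^esub> x \<oplus>\<^bsub>M\<^esub> k \<odot>\<^bsub>M\<^esub> x" if "x \<in> N" for x
      using eng_add that Nc(1) by (intro smult_l_distr) auto
    then show ?case using eng_add Nc(3) by simp
  next
    case (eng_mult h k)
    have "(h \<otimes> k) \<odot>\<^bsub>M\<^esub> x = h \<odot>\<^bsub>M\<^esub> (k \<odot>\<^bsub>M\<^esub> x)" if "x \<in> N" for x
      using eng_mult that Nc(1) by (intro smult_assoc1) auto
    then show ?case using eng_mult by simp
  qed
  then show ?thesis using Nc(1-3) by (intro tclosedI) auto
qed

text \<open>Finite spans over \<open>K\<close> are Noetherian by exchange, and the algebra
  generators \<open>F\<close> are then adjoined by Hilbert's theorem. The span of \<open>S\<close>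
  over \<open>F \<union> K\<close> is closed under all of \<open>R\<close>, so it already contains
  the \<open>R\<close>-span of \<open>S\<close> and with it \<open>P\<close>.\<close>

theorem submodule_finitely_generated:
  assumes K: "subfield K R" and F: "finite F" "F \<subseteq> carrier R" "generate_ring R (K \<union> F) = carrier R"
    and S: "finite S" "S \<subseteq> carrier M"
    and P: "tclosed M (carrier R) P" "P \<subseteq> tspan M (carrier R) S"
  obtains Q where "finite Q" "Q \<subseteq> P" "P = tspan M (carrier R) Q"
proof -
  note Kc = subfield_minus_one[OF K]
  have FK: "F \<union> K \<subseteq> carrier R" "\<ominus> \<one> \<in> F \<union> K" using F Kc by auto
  have noeth: "tnoetherian M (F \<union> K) (tspan M (F \<union> K) S)"
    by (rule tnoetherian_adjoin_finite[OF Kc(2,1) F(1,2) S(2) tnoetherian_finite_span[OF K S]])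
  have "tclosed M (carrier R) (tspan M (F \<union> K) S)"
    using tclosed_generate_ring[OF tclosed_tspan[OF FK(1) S(2)] FK] F(3) by (simp add: Un_commute)
  then have "tspan M (carrier R) S \<subseteq> tspan M (F \<union> K) S"
    by (rule tspan_subset) (auto intro: tspan_base)
  then have sub: "P \<subseteq> tspan M (F \<union> K) S" using P(2) by simp
  have "tclosed M (F \<union> K) P" using P(1) FK(1) by (auto simp: tclosed_def)
  then obtain Q where Q: "finite Q" "Q \<subseteq> P" "P \<subseteq> tspan M (F \<union> K) Q"
    using tnoetherianD[OF noeth _ sub] by metis
  have "tspan M (F \<union> K) Q \<subseteq> tspan M (carrier R) Q" using FK(1) by (intro tspan_mono) auto
  moreover have "tspan M (carrier R) Q \<subseteq> P" by (rule tspan_subset[OF P(1) Q(2)])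
  ultimately show ?thesis using Q by (intro that[of Q]) auto
qed

end

section \<open>Dimension of subquotients\<close>

context vectorspace
begin

lemma tclosed_neg: "tclosed V (carrier K) B \<Longrightarrow> x \<in> B \<Longrightarrow> \<ominus>\<^bsub>V\<^esub> x \<in> B"
  using tclosedD[of V "carrier K" B] smult_l_minus[of "\<one>\<^bsub>K\<^esub>" x]
  by (metis R.add.inv_closed R.one_closed smult_one subsetD)

lemma tclosed_diff: "tclosed V (carrier K) B \<Longrightarrow> x \<in> B \<Longrightarrow> y \<in> B \<Longrightarrow> x \<ominus>\<^bsub>V\<^esub> y \<in> B"
  using tclosed_minus[of "carrier K" B x y] by simp

lemma coset_mem:
  assumes B: "tclosed V (carrier K) B" and x: "x \<in> carrier V"
  shows "v \<in> B +>\<^bsub>V\<^esub> x \<longleftrightarrow> v \<in> carrier V \<and> v \<ominus>\<^bsub>V\<^esub> x \<in> B"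
proof
  assume "v \<in> B +>\<^bsub>V\<^esub> x"
  then obtain b where b: "b \<in> B" "v = b \<oplus>\<^bsub>V\<^esub> x" by (auto simp: a_r_coset_def')
  have bV: "b \<in> carrier V" using b tclosedD(1)[OF B] by auto
  have "v \<ominus>\<^bsub>V\<^esub> x = b" using bV x b(2) by (simp add: M.minus_eq M.a_assoc M.r_neg)
  then show "v \<in> carrier V \<and> v \<ominus>\<^bsub>V\<^esub> x \<in> B" using b bV x by simp
next
  assume v: "v \<in> carrier V \<and> v \<ominus>\<^bsub>V\<^esub> x \<in> B"
  then have "v = (v \<ominus>\<^bsub>V\<^esub> x) \<oplus>\<^bsub>V\<^esub> x" using x by (simp add: M.minus_eq M.a_assoc M.l_neg)
  then show "v \<in> B +>\<^bsub>V\<^esub> x" using v unfolding a_r_coset_def' by blast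
qed

lemma coset_eq_iff:
  assumes B: "tclosed V (carrier K) B" and x: "x \<in> carrier V" "y \<in> carrier V"
  shows "B +>\<^bsub>V\<^esub> x = B +>\<^bsub>V\<^esub> y \<longleftrightarrow> x \<ominus>\<^bsub>V\<^esub> y \<in> B"
proof
  assume eq: "B +>\<^bsub>V\<^esub> x = B +>\<^bsub>V\<^esub> y"
  have "x \<in> B +>\<^bsub>V\<^esub> x" using x tclosedD(2)[OF B] by (simp add: coset_mem[OF B] M.minus_eq M.r_neg)
  then show "x \<ominus>\<^bsub>V\<^esub> y \<in> B" using eq x coset_mem[OF B x(2)] by simp
next
  assume d: "x \<ominus>\<^bsub>V\<^esub> y \<in> B"
  have 1: "v \<ominus>\<^bsub>V\<^esub> y = (v \<ominus>\<^bsub>V\<^esub> x) \<oplus>\<^bsub>V\<^esub> (x \<ominus>\<^bsub>V\<^esub> y)" if "v \<in> carrier V" for v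
    using that x by (simp add: M.minus_eq M.a_assoc M.r_neg1)
  have 2: "v \<ominus>\<^bsub>V\<^esub> x = (v \<ominus>\<^bsub>V\<^esub> y) \<ominus>\<^bsub>V\<^esub> (x \<ominus>\<^bsub>V\<^esub> y)" if "v \<in> carrier V" for v
    using that x by (simp add: M.minus_eq M.a_assoc M.minus_add M.r_neg1 M.r_neg2 M.a_comm[of "\<ominus>\<^bsub>V\<^esub> x"])
  show "B +>\<^bsub>V\<^esub> x = B +>\<^bsub>V\<^esub> y"
  proof (rule Set.set_eqI)
    fix v
    show "v \<in> B +>\<^bsub>V\<^esub> x \<longleftrightarrow> v \<in> B +>\<^bsub>V\<^esub> y"
      using 1[of v] 2[of v] tclosedD(3)[OF B, of "v \<ominus>\<^bsub>V\<^esub> x" "x \<ominus>\<^bsub>V\<^esub> y"]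
        tclosed_diff[OF B, of "v \<ominus>\<^bsub>V\<^esub> y" "x \<ominus>\<^bsub>V\<^esub> y"] d
      unfolding coset_mem[OF B x(1)] coset_mem[OF B x(2)] by metis
  qed
qed

lemma coset_zero: "tclosed V (carrier K) B \<Longrightarrow> B +>\<^bsub>V\<^esub> \<zero>\<^bsub>V\<^esub> = B"
  using coset_mem[of B "\<zero>\<^bsub>V\<^esub>"] tclosedD(1)[of V "carrier K" B] by (auto simp: M.minus_eq)

lemma coset_eq_self_iff:
  assumes B: "tclosed V (carrier K) B" and x: "x \<in> carrier V"
  shows "B +>\<^bsub>V\<^esub> x = B \<longleftrightarrow> x \<in> B"
  using coset_eq_iff[OF B x, of "\<zero>\<^bsub>V\<^esub>"] coset_zero[OF B] x
    M.minus_equality[of "\<zero>\<^bsub>V\<^esub>" "\<zero>\<^bsub>V\<^esub>"] by (simp add: M.minus_eq)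

lemma coset_add:
  assumes B: "tclosed V (carrier K) B" and x: "x \<in> carrier V" "y \<in> carrier V"
  shows "(B +>\<^bsub>V\<^esub> x) <+>\<^bsub>V\<^esub> (B +>\<^bsub>V\<^esub> y) = B +>\<^bsub>V\<^esub> (x \<oplus>\<^bsub>V\<^esub> y)"
proof (rule Set.set_eqI)
  have BV: "b \<in> B \<Longrightarrow> b \<in> carrier V" for b using tclosedD(1)[OF B] by auto
  fix v
  show "v \<in> (B +>\<^bsub>V\<^esub> x) <+>\<^bsub>V\<^esub> (B +>\<^bsub>V\<^esub> y) \<longleftrightarrow> v \<in> B +>\<^bsub>V\<^esub> (x \<oplus>\<^bsub>V\<^esub> y)"
  proof
    assume "v \<in> (B +>\<^bsub>V\<^esub> x) <+>\<^bsub>V\<^esub> (B +>\<^bsub>V\<^esub> y)"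
    then obtain b c where h: "b \<in> B" "c \<in> B" "v = (b \<oplus>\<^bsub>V\<^esub> x) \<oplus>\<^bsub>V\<^esub> (c \<oplus>\<^bsub>V\<^esub> y)"
      unfolding set_add_def' a_r_coset_def' by blast
    then have "v = (b \<oplus>\<^bsub>V\<^esub> c) \<oplus>\<^bsub>V\<^esub> (x \<oplus>\<^bsub>V\<^esub> y)" using add_interchange[of b x c y] BV x by simp
    then show "v \<in> B +>\<^bsub>V\<^esub> (x \<oplus>\<^bsub>V\<^esub> y)"
      using tclosedD(3)[OF B h(1,2)] unfolding a_r_coset_def' by blast
  next
    assume "v \<in> B +>\<^bsub>V\<^esub> (x \<oplus>\<^bsub>V\<^esub> y)"
    then obtain b where h: "b \<in> B" "v = b \<oplus>\<^bsub>V\<^esub> (x \<oplus>\<^bsub>V\<^esub> y)" unfolding a_r_coset_def' by blast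
    then have "v = (b \<oplus>\<^bsub>V\<^esub> x) \<oplus>\<^bsub>V\<^esub> (\<zero>\<^bsub>V\<^esub> \<oplus>\<^bsub>V\<^esub> y)" using BV x by (simp add: M.a_assoc)
    then show "v \<in> (B +>\<^bsub>V\<^esub> x) <+>\<^bsub>V\<^esub> (B +>\<^bsub>V\<^esub> y)"
      using h(1) tclosedD(2)[OF B] unfolding set_add_def' a_r_coset_def' by blast
  qed
qed

end

text \<open>The scalar may come from a larger ring than the base field, as for the associated graded module.\<close>

lemma coset_smult_image:
  assumes V: "vectorspace K V" and B: "tclosed V (carrier K) B" and x: "x \<in> carrier V"
    and C: "C \<subseteq> carrier V" "\<zero>\<^bsub>V\<^esub> \<in> C" and fC: "f ` C \<subseteq> B" and fx: "f x \<in> carrier V"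
    and hom: "\<And>c. c \<in> C \<Longrightarrow> f (c \<oplus>\<^bsub>V\<^esub> x) = f c \<oplus>\<^bsub>V\<^esub> f x"
  shows "B <+>\<^bsub>V\<^esub> f ` (C +>\<^bsub>V\<^esub> x) = B +>\<^bsub>V\<^esub> f x"
proof (rule Set.set_eqI)
  interpret V: vectorspace K V by fact
  have BV: "b \<in> B \<Longrightarrow> b \<in> carrier V" for b using tclosedD(1)[OF B] by auto
  fix v
  show "v \<in> B <+>\<^bsub>V\<^esub> f ` (C +>\<^bsub>V\<^esub> x) \<longleftrightarrow> v \<in> B +>\<^bsub>V\<^esub> f x"
  proof
    assume "v \<in> B <+>\<^bsub>V\<^esub> f ` (C +>\<^bsub>V\<^esub> x)"
    then obtain b c where h: "b \<in> B" "c \<in> C" "v = b \<oplus>\<^bsub>V\<^esub> f (c \<oplus>\<^bsub>V\<^esub> x)"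
      unfolding set_add_def' a_r_coset_def' by blast
    have fc: "f c \<in> B" using fC h(2) by auto
    have "v = (b \<oplus>\<^bsub>V\<^esub> f c) \<oplus>\<^bsub>V\<^esub> f x" using h hom fx BV fc by (simp add: V.M.a_assoc)
    then show "v \<in> B +>\<^bsub>V\<^esub> f x" using tclosedD(3)[OF B h(1) fc] unfolding a_r_coset_def' by blast
  next
    assume "v \<in> B +>\<^bsub>V\<^esub> f x"
    then obtain b where h: "b \<in> B" "v = b \<oplus>\<^bsub>V\<^esub> f x" unfolding a_r_coset_def' by blast
    have "v = b \<oplus>\<^bsub>V\<^esub> f (\<zero>\<^bsub>V\<^esub> \<oplus>\<^bsub>V\<^esub> x)" using h x by simp
    then show "v \<in> B <+>\<^bsub>V\<^esub> f ` (C +>\<^bsub>V\<^esub> x)"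
      using h(1) C(2) unfolding set_add_def' a_r_coset_def' by blast
  qed
qed

context vectorspace
begin

lemma coset_smult:
  assumes B: "tclosed V (carrier K) B" and x: "x \<in> carrier V" and a: "a \<in> carrier K"
  shows "B <+>\<^bsub>V\<^esub> (\<lambda>x. a \<odot>\<^bsub>V\<^esub> x) ` (B +>\<^bsub>V\<^esub> x) = B +>\<^bsub>V\<^esub> (a \<odot>\<^bsub>V\<^esub> x)"
  by (rule coset_smult_image[OF vectorspace_axioms B x tclosedD(1,2)[OF B]])
    (use a x tclosedD[OF B] in \<open>auto intro: smult_r_distr\<close>)

lemma subquotient_simps:
  "carrier (subquotient V W B) = {B +>\<^bsub>V\<^esub> z | z. z \<in> W}"
  "\<zero>\<^bsub>subquotient V W B\<^esub> = B"
  "X \<oplus>\<^bsub>subquotient V W B\<^esub> Y = X <+>\<^bsub>V\<^esub> Y"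
  "a \<odot>\<^bsub>subquotient V W B\<^esub> X = B <+>\<^bsub>V\<^esub> (\<lambda>x. a \<odot>\<^bsub>V\<^esub> x) ` X"
  by (simp_all add: subquotient_def)

text \<open>The elements are the cosets of \<open>B\<close> represented in \<open>W\<close>, so the
  space is (W + B)/B. This fits the graded pieces of Tor, where \<open>W\<close> has a single degree
  while \<open>B\<close> contains boundaries of all degrees.\<close>

lemma vectorspace_subquotient:
  assumes W: "tclosed V (carrier K) W" and B: "tclosed V (carrier K) B"
  shows "vectorspace K (subquotient V W B)"
proof -
  note Wc = tclosedD[OF W]
  have WV: "w \<in> W \<Longrightarrow> w \<in> carrier V" for w using Wc(1) by auto
  note s = subquotient_simps coset_add[OF B] coset_smult[OF B] WV
  have z: "B = B +>\<^bsub>V\<^esub> \<zero>\<^bsub>V\<^esub>" using coset_zero[OF B] by simp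
  have neg: "\<exists>n\<in>{B +>\<^bsub>V\<^esub> z | z. z \<in> W}. (B +>\<^bsub>V\<^esub> w) <+>\<^bsub>V\<^esub> n = B" if w: "w \<in> W" for w
  proof (rule bexI)
    show "(B +>\<^bsub>V\<^esub> w) <+>\<^bsub>V\<^esub> (B +>\<^bsub>V\<^esub> (\<ominus>\<^bsub>V\<^esub> w)) = B"
      using w WV by (simp add: coset_add[OF B] M.r_neg coset_zero[OF B])
    show "B +>\<^bsub>V\<^esub> (\<ominus>\<^bsub>V\<^esub> w) \<in> {B +>\<^bsub>V\<^esub> z | z. z \<in> W}" using tclosed_neg[OF W w] by blast
  qed
  show ?thesis
  proof (rule vs_criteria)
    show "field K" ..
    show "\<zero>\<^bsub>subquotient V W B\<^esub> \<in> carrier (subquotient V W B)"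
      using z Wc(2) unfolding subquotient_simps by blast
    show "\<forall>v w. v \<in> carrier (subquotient V W B) \<and> w \<in> carrier (subquotient V W B) \<longrightarrow>
        v \<oplus>\<^bsub>subquotient V W B\<^esub> w \<in> carrier (subquotient V W B)"
      using Wc(3) by (auto simp: s)
    show "\<forall>v\<in>carrier (subquotient V W B). \<exists>neg_v\<in>carrier (subquotient V W B).
        v \<oplus>\<^bsub>subquotient V W B\<^esub> neg_v = \<zero>\<^bsub>subquotient V W B\<^esub>"
      using neg unfolding subquotient_simps by blast
    show "\<forall>c v. c \<in> carrier K \<and> v \<in> carrier (subquotient V W B) \<longrightarrow>
        c \<odot>\<^bsub>subquotient V W B\<^esub> v \<in> carrier (subquotient V W B)"
      using Wc(4) by (auto simp: s)
    show "\<forall>v w. v \<in> carrier (subquotient V W B) \<and> w \<in> carrier (subquotient V W B) \<longrightarrow>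
        v \<oplus>\<^bsub>subquotient V W B\<^esub> w = w \<oplus>\<^bsub>subquotient V W B\<^esub> v"
      by (auto simp: s M.a_comm)
    show "\<forall>u v w. u \<in> carrier (subquotient V W B) \<and> v \<in> carrier (subquotient V W B) \<and> w \<in> carrier (subquotient V W B) \<longrightarrow>
        u \<oplus>\<^bsub>subquotient V W B\<^esub> v \<oplus>\<^bsub>subquotient V W B\<^esub> w = u \<oplus>\<^bsub>subquotient V W B\<^esub> (v \<oplus>\<^bsub>subquotient V W B\<^esub> w)"
      by (auto simp: s M.a_assoc)
    show "\<forall>v\<in>carrier (subquotient V W B). v \<oplus>\<^bsub>subquotient V W B\<^esub> \<zero>\<^bsub>subquotient V W B\<^esub> = v"
    proof
      fix v assume "v \<in> carrier (subquotient V W B)"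
      then obtain w where w: "w \<in> W" "v = B +>\<^bsub>V\<^esub> w" by (auto simp: subquotient_simps)
      have "v <+>\<^bsub>V\<^esub> (B +>\<^bsub>V\<^esub> \<zero>\<^bsub>V\<^esub>) = v" using w WV by (simp add: coset_add[OF B] del: coset_zero)
      then show "v \<oplus>\<^bsub>subquotient V W B\<^esub> \<zero>\<^bsub>subquotient V W B\<^esub> = v"
        by (simp add: subquotient_simps coset_zero[OF B])
    qed
    show "\<forall>a b v. a \<in> carrier K \<and> b \<in> carrier K \<and> v \<in> carrier (subquotient V W B) \<longrightarrow>
        (a \<otimes>\<^bsub>K\<^esub> b) \<odot>\<^bsub>subquotient V W B\<^esub> v = a \<odot>\<^bsub>subquotient V W B\<^esub> (b \<odot>\<^bsub>subquotient V W B\<^esub> v)"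
      by (auto simp: s smult_assoc1)
    show "\<forall>v\<in>carrier (subquotient V W B). \<one>\<^bsub>K\<^esub> \<odot>\<^bsub>subquotient V W B\<^esub> v = v"
    proof
      fix v assume "v \<in> carrier (subquotient V W B)"
      then obtain w where w: "w \<in> W" "v = B +>\<^bsub>V\<^esub> w" by (auto simp: subquotient_simps)
      then show "\<one>\<^bsub>K\<^esub> \<odot>\<^bsub>subquotient V W B\<^esub> v = v"
        using WV by (simp add: subquotient_simps(4) coset_smult[OF B])
    qed
    show "\<forall>a b v. a \<in> carrier K \<and> b \<in> carrier K \<and> v \<in> carrier (subquotient V W B) \<longrightarrow>
        (a \<oplus>\<^bsub>K\<^esub> b) \<odot>\<^bsub>subquotient V W B\<^esub> v =
        a \<odot>\<^bsub>subquotient V W B\<^esub> v \<oplus>\<^bsub>subquotient V W B\<^esub> b \<odot>\<^bsub>subquotient V W B\<^esub> v"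
      by (auto simp: s smult_l_distr)
    show "\<forall>a v w. a \<in> carrier K \<and> v \<in> carrier (subquotient V W B) \<and> w \<in> carrier (subquotient V W B) \<longrightarrow>
        a \<odot>\<^bsub>subquotient V W B\<^esub> (v \<oplus>\<^bsub>subquotient V W B\<^esub> w) =
        a \<odot>\<^bsub>subquotient V W B\<^esub> v \<oplus>\<^bsub>subquotient V W B\<^esub> a \<odot>\<^bsub>subquotient V W B\<^esub> w"
      by (auto simp: s smult_r_distr)
  qed
qed

text \<open>Together with its converse below, this translates dimensions of quotients into finite
  spanning sets modulo \<open>B\<close> inside \<open>V\<close>, where the exchange lemmas
  apply.\<close>

lemma subquotient_generated:
  assumes W: "tclosed V (carrier K) W" and B: "tclosed V (carrier K) B"
    and Y: "finite Y" "Y \<subseteq> W" "W \<subseteq> tspan V (carrier K) (Y \<union> B)"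
  shows "vdim K (subquotient V W B) \<le> enat (card Y)"
proof -
  let ?Q = "subquotient V W B"
  interpret Q: vectorspace K ?Q by (rule vectorspace_subquotient[OF W B])
  define X where "X = (\<lambda>y. B +>\<^bsub>V\<^esub> y) ` Y"
  have WV: "w \<in> W \<Longrightarrow> w \<in> carrier V" for w using tclosedD(1)[OF W] by auto
  have BV: "w \<in> B \<Longrightarrow> w \<in> carrier V" for w using tclosedD(1)[OF B] by auto
  have XQ: "X \<subseteq> carrier ?Q" using Y by (auto simp: X_def subquotient_simps)
  note sp = Q.span_is_submodule[OF XQ]
  have tV: "tspan V (carrier K) (Y \<union> B) \<subseteq> carrier V"
    by (rule tclosedD(1)[OF tclosed_tspan]) (use Y WV BV in auto)
  have *: "B +>\<^bsub>V\<^esub> v \<in> Q.span X" if "v \<in> tspan V (carrier K) (Y \<union> B)" for v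
    using that
  proof induct
    case tspan_zero
    show ?case using submodule.zero_closed[OF sp] coset_zero[OF B] by (simp add: subquotient_simps)
  next
    case (tspan_base x)
    show ?case
    proof (cases "x \<in> B")
      case True
      then show ?thesis using coset_eq_self_iff[OF B BV[OF True]] submodule.zero_closed[OF sp]
        by (simp add: subquotient_simps)
    next
      case False
      then show ?thesis using tspan_base Q.in_own_span[OF XQ] by (auto simp: X_def)
    qed
  next
    case (tspan_add x y)
    then have "x \<in> carrier V" "y \<in> carrier V" using subsetD[OF tV] by simp_all
    then show ?case using submodule.m_closed[OF sp tspan_add(2,4)]
      by (simp add: subquotient_simps coset_add[OF B])
  next
    case (tspan_smult t x)
    then have "x \<in> carrier V" using subsetD[OF tV] by simp
    then show ?case using submodule.smult_closed[OF sp tspan_smult(1,3)] tspan_smult(1)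
      by (simp add: subquotient_simps coset_smult[OF B])
  qed
  have "carrier ?Q \<subseteq> Q.span X" using * Y(3) by (auto simp: subquotient_simps)
  then have gen: "Q.span X = carrier ?Q" using Q.span_is_subset2[OF XQ] by auto
  have fX: "finite X" using Y by (simp add: X_def)
  have fd: "Q.fin_dim" unfolding Q.fin_dim_def using fX XQ gen by (intro exI[of _ X]) simp
  have "Q.dim \<le> card X" by (rule Q.gen_ge_dim[OF fX XQ gen])
  also have "card X \<le> card Y" unfolding X_def by (rule card_image_le[OF Y(1)])
  finally show ?thesis using fd by (simp add: vdim_def)
qed

lemma subquotient_generatedE:
  assumes W: "tclosed V (carrier K) W" and B: "tclosed V (carrier K) B"
    and n: "vdim K (subquotient V W B) \<le> enat n"
  obtains Y where "finite Y" "Y \<subseteq> W" "card Y \<le> n" "W \<subseteq> tspan V (carrier K) (Y \<union> B)"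
proof -
  let ?Q = "subquotient V W B"
  interpret Q: vectorspace K ?Q by (rule vectorspace_subquotient[OF W B])
  have WV: "w \<in> W \<Longrightarrow> w \<in> carrier V" for w using tclosedD(1)[OF W] by auto
  have BV: "w \<in> B \<Longrightarrow> w \<in> carrier V" for w using tclosedD(1)[OF B] by auto
  \<comment> \<open>\<open>vdim\<close> is infinite unless the space is finite dimensional, so the
    bound also yields \<open>fin_dim\<close>.\<close>
  have fd: "Q.fin_dim" and dn: "Q.dim \<le> n" using n by (auto simp: vdim_def split: if_splits)
  obtain X where "finite X" "Q.basis X" using Q.finite_basis_exists[OF fd] by blast
  then have X: "finite X" "X \<subseteq> carrier ?Q" "Q.span X = carrier ?Q" "card X \<le> n"
    using Q.dim_basis[of X] dn by (auto simp: Q.basis_def)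
  have "\<forall>x\<in>X. \<exists>w\<in>W. x = B +>\<^bsub>V\<^esub> w" using X(2) by (auto simp: subquotient_simps)
  then obtain r where r: "\<And>x. x \<in> X \<Longrightarrow> r x \<in> W \<and> x = B +>\<^bsub>V\<^esub> r x" by metis
  define Y where "Y = r ` X"
  \<comment> \<open>The classes reached by the representatives \<open>Y\<close>. They form a
    subspace containing the basis \<open>X\<close>, hence are all classes.\<close>
  define N where "N = {B +>\<^bsub>V\<^esub> z | z. z \<in> W \<inter> tspan V (carrier K) (Y \<union> B)}"
  have YW: "Y \<subseteq> W" using r by (auto simp: Y_def)
  have YBV: "Y \<union> B \<subseteq> carrier V" using YW WV BV by auto
  have tc: "tclosed V (carrier K) (W \<inter> tspan V (carrier K) (Y \<union> B))"
    using W tclosed_tspan[OF order_refl YBV] by (auto simp: tclosed_def)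
  note tcd = tclosedD[OF tc]
  have sub: "submodule K N ?Q"
  proof (rule submodule.intro)
    show "module K ?Q" ..
    show "N \<subseteq> carrier ?Q" by (auto simp: N_def subquotient_simps)
    show "\<zero>\<^bsub>?Q\<^esub> \<in> N" using tcd(2) coset_zero[OF B] unfolding N_def subquotient_simps by blast
  next
    fix v w assume "v \<in> N" "w \<in> N"
    then obtain a b where h: "v = B +>\<^bsub>V\<^esub> a" "w = B +>\<^bsub>V\<^esub> b" "a \<in> W \<inter> tspan V (carrier K) (Y \<union> B)"
      "b \<in> W \<inter> tspan V (carrier K) (Y \<union> B)" unfolding N_def by blast
    have "v \<oplus>\<^bsub>?Q\<^esub> w = B +>\<^bsub>V\<^esub> (a \<oplus>\<^bsub>V\<^esub> b)"
      using h WV by (simp add: subquotient_simps coset_add[OF B])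
    then show "v \<oplus>\<^bsub>?Q\<^esub> w \<in> N" using tcd(3)[OF h(3,4)] unfolding N_def by blast
  next
    fix c v assume c: "c \<in> carrier K" and "v \<in> N"
    then obtain a where h: "v = B +>\<^bsub>V\<^esub> a" "a \<in> W \<inter> tspan V (carrier K) (Y \<union> B)" unfolding N_def by blast
    have "c \<odot>\<^bsub>?Q\<^esub> v = B +>\<^bsub>V\<^esub> (c \<odot>\<^bsub>V\<^esub> a)"
      using h WV c by (simp add: subquotient_simps coset_smult[OF B])
    then show "c \<odot>\<^bsub>?Q\<^esub> v \<in> N" using tcd(4)[OF c h(2)] unfolding N_def by blast
  qed
  have "X \<subseteq> N"
  proof
    fix x assume "x \<in> X"
    then have "r x \<in> W \<inter> tspan V (carrier K) (Y \<union> B)" "x = B +>\<^bsub>V\<^esub> r x"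
      using r by (auto simp: Y_def intro: tspan_base)
    then show "x \<in> N" unfolding N_def by blast
  qed
  then have QN: "carrier ?Q \<subseteq> N" using Q.span_is_subset[OF _ sub] X(3) by auto
  have "W \<subseteq> tspan V (carrier K) (Y \<union> B)"
  proof
    fix w assume w: "w \<in> W"
    then have "B +>\<^bsub>V\<^esub> w \<in> N" using QN by (auto simp: subquotient_simps)
    then obtain z where z: "B +>\<^bsub>V\<^esub> w = B +>\<^bsub>V\<^esub> z" "z \<in> W" "z \<in> tspan V (carrier K) (Y \<union> B)"
      unfolding N_def by blast
    then have d: "w \<ominus>\<^bsub>V\<^esub> z \<in> B" using coset_eq_iff[OF B WV[OF w] WV[OF z(2)]] by simp
    have "w = (w \<ominus>\<^bsub>V\<^esub> z) \<oplus>\<^bsub>V\<^esub> z"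
      using WV[OF w] WV[OF z(2)] by (simp add: M.minus_eq M.a_assoc M.l_neg)
    moreover have "w \<ominus>\<^bsub>V\<^esub> z \<in> tspan V (carrier K) (Y \<union> B)" using d by (intro tspan_base) simp
    ultimately show "w \<in> tspan V (carrier K) (Y \<union> B)" using z(3) tspan_add by metis
  qed
  moreover have "card Y \<le> n" using card_image_le[OF X(1), of r] X(4) by (simp add: Y_def)
  ultimately show ?thesis using that[of Y] X(1) YW by (simp add: Y_def)
qed

text \<open>The empty spanning set is allowed on both sides. Vanishing of a graded Betti number thus
  becomes an inclusion of cycles in boundaries.\<close>

lemma vdim_subquotient_eq_0_iff:
  assumes W: "tclosed V (carrier K) W" and B: "tclosed V (carrier K) B"
  shows "vdim K (subquotient V W B) = 0 \<longleftrightarrow> W \<subseteq> B"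
proof
  have BB: "tspan V (carrier K) B \<subseteq> B" by (rule tspan_subset[OF B order_refl])
  assume "vdim K (subquotient V W B) = 0"
  then have "vdim K (subquotient V W B) \<le> enat 0" by (simp only: zero_enat_def order_refl)
  then obtain Y where "finite Y" "card Y \<le> 0" "W \<subseteq> tspan V (carrier K) (Y \<union> B)"
    using subquotient_generatedE[OF W B] by metis
  then show "W \<subseteq> B" using BB by simp
next
  assume WB: "W \<subseteq> B"
  have "vdim K (subquotient V W B) \<le> enat (card {})"
    using subquotient_generated[OF W B, of "{}"] WB tspan_base[of _ B V "carrier K"] by auto
  then show "vdim K (subquotient V W B) = 0" by (simp add: zero_enat_def[symmetric])
qed

end

section \<open>Free modules and matrices\<close>

text \<open>Phrased for ring schemes since only addition is involved. It applies to scalars of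
  \<open>R\<close> acting on the associated graded module, which is made a module over the ground
  field only.\<close>

definition additive_map :: "('b, 'm) ring_scheme \<Rightarrow> ('c, 'n) ring_scheme \<Rightarrow> ('b \<Rightarrow> 'c) \<Rightarrow> bool" where
  "additive_map M N f \<longleftrightarrow> (\<forall>x\<in>carrier M. f x \<in> carrier N) \<and>
     (\<forall>x\<in>carrier M. \<forall>y\<in>carrier M. f (x \<oplus>\<^bsub>M\<^esub> y) = f x \<oplus>\<^bsub>N\<^esub> f y)"

lemma additive_mapD:
  assumes "additive_map M N f"
  shows "x \<in> carrier M \<Longrightarrow> f x \<in> carrier N"
    "x \<in> carrier M \<Longrightarrow> y \<in> carrier M \<Longrightarrow> f (x \<oplus>\<^bsub>M\<^esub> y) = f x \<oplus>\<^bsub>N\<^esub> f y"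
  using assms by (auto simp: additive_map_def)

lemma additive_map_zero:
  assumes "abelian_group M" "abelian_group N" "additive_map M N f"
  shows "f \<zero>\<^bsub>M\<^esub> = \<zero>\<^bsub>N\<^esub>"
proof -
  interpret M: abelian_group M by fact
  interpret N: abelian_group N by fact
  note f = additive_mapD[OF assms(3)]
  have "f \<zero>\<^bsub>M\<^esub> \<oplus>\<^bsub>N\<^esub> f \<zero>\<^bsub>M\<^esub> = f \<zero>\<^bsub>M\<^esub>" using f(2)[of "\<zero>\<^bsub>M\<^esub>" "\<zero>\<^bsub>M\<^esub>"] by simp
  then show ?thesis using f(1)[of "\<zero>\<^bsub>M\<^esub>"] N.add.r_cancel_one' by (metis M.zero_closed)
qed

lemma additive_map_uminus:
  assumes "abelian_group M" "abelian_group N" "additive_map M N f" "x \<in> carrier M"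
  shows "f (\<ominus>\<^bsub>M\<^esub> x) = \<ominus>\<^bsub>N\<^esub> f x"
proof -
  interpret M: abelian_group M by fact
  interpret N: abelian_group N by fact
  note f = additive_mapD[OF assms(3)]
  have "f (\<ominus>\<^bsub>M\<^esub> x) \<oplus>\<^bsub>N\<^esub> f x = f \<zero>\<^bsub>M\<^esub>"
    using f(2)[of "\<ominus>\<^bsub>M\<^esub> x" x] assms(4) by (simp add: M.l_neg)
  then show ?thesis
    using N.minus_equality[of "f (\<ominus>\<^bsub>M\<^esub> x)" "f x"] f(1) assms(4) additive_map_zero[OF assms(1-3)] by simp
qed

lemma additive_map_minus:
  assumes "abelian_group M" "abelian_group N" "additive_map M N f" "x \<in> carrier M" "y \<in> carrier M"
  shows "f (x \<ominus>\<^bsub>M\<^esub> y) = f x \<ominus>\<^bsub>N\<^esub> f y"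
proof -
  interpret M: abelian_group M by fact
  show ?thesis
    using additive_mapD(2)[OF assms(3), of x "\<ominus>\<^bsub>M\<^esub> y"] additive_map_uminus[OF assms(1-3,5)] assms(4,5)
    by (simp add: a_minus_def)
qed

lemma additive_map_finsum:
  assumes "abelian_group M" "abelian_group N" "additive_map M N f" "finite S" "g \<in> S \<rightarrow> carrier M"
  shows "f (finsum M g S) = finsum N (\<lambda>i. f (g i)) S"
proof -
  interpret M: abelian_group M by fact
  interpret N: abelian_group N by fact
  show ?thesis
    using assms(4,5)
  proof (induct S rule: finite_induct)
    case empty
    then show ?case using additive_map_zero[OF assms(1-3)] by simp
  next
    case (insert i S)
    have "f (finsum M g (insert i S)) = f (g i) \<oplus>\<^bsub>N\<^esub> f (finsum M g S)"
      using insert additive_mapD(2)[OF assms(3)] by (simp add: Pi_def)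
    also have "\<dots> = finsum N (\<lambda>i. f (g i)) (insert i S)"
      using insert additive_mapD(1)[OF assms(3)] by (simp add: Pi_def)
    finally show ?case .
  qed
qed

lemma power_module_simps:
  "carrier (power_module M n) = {..<n} \<rightarrow>\<^sub>E carrier M"
  "\<zero>\<^bsub>power_module M n\<^esub> = (\<lambda>l\<in>{..<n}. \<zero>\<^bsub>M\<^esub>)"
  "x \<oplus>\<^bsub>power_module M n\<^esub> y = (\<lambda>l\<in>{..<n}. x l \<oplus>\<^bsub>M\<^esub> y l)"
  "a \<odot>\<^bsub>power_module M n\<^esub> x = (\<lambda>l\<in>{..<n}. a \<odot>\<^bsub>M\<^esub> x l)"
  by (simp_all add: power_module_def)

lemma module_power_module:
  assumes "module R M"
  shows "module R (power_module M n)"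
proof -
  interpret module R M by fact
  have mem: "x l \<in> carrier M" if "x \<in> {..<n} \<rightarrow>\<^sub>E carrier M" "l < n" for x l using that by auto
  have ext: "x = y" if "x \<in> {..<n} \<rightarrow>\<^sub>E carrier M" "y \<in> {..<n} \<rightarrow>\<^sub>E carrier M" "\<And>l. l < n \<Longrightarrow> x l = y l" for x y
    using that by (intro PiE_ext[of x "{..<n}" "\<lambda>_. carrier M" y]) auto
  have neg: "\<exists>y\<in>{..<n} \<rightarrow>\<^sub>E carrier M. (\<lambda>l\<in>{..<n}. x l \<oplus>\<^bsub>M\<^esub> y l) = (\<lambda>l\<in>{..<n}. \<zero>\<^bsub>M\<^esub>)"
    if "x \<in> {..<n} \<rightarrow>\<^sub>E carrier M" for x
    by (rule bexI[of _ "\<lambda>l\<in>{..<n}. \<ominus>\<^bsub>M\<^esub> x l"]) (use mem[OF that] in \<open>auto simp: M.r_neg\<close>)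
  show ?thesis
  proof (rule module_criteria)
    show "cring R" ..
    show "\<zero>\<^bsub>power_module M n\<^esub> \<in> carrier (power_module M n)" by (auto simp: power_module_simps)
    show "\<forall>v w. v \<in> carrier (power_module M n) \<and> w \<in> carrier (power_module M n) \<longrightarrow>
      v \<oplus>\<^bsub>power_module M n\<^esub> w \<in> carrier (power_module M n)"
      using mem by (auto simp: power_module_simps)
    show "\<forall>v\<in>carrier (power_module M n). \<exists>neg_v\<in>carrier (power_module M n).
      v \<oplus>\<^bsub>power_module M n\<^esub> neg_v = \<zero>\<^bsub>power_module M n\<^esub>"
      using neg by (simp add: power_module_simps)
    show "\<forall>c v. c \<in> carrier R \<and> v \<in> carrier (power_module M n) \<longrightarrow>
      c \<odot>\<^bsub>power_module M n\<^esub> v \<in> carrier (power_module M n)"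
      using mem by (auto simp: power_module_simps)
    show "\<forall>v w. v \<in> carrier (power_module M n) \<and> w \<in> carrier (power_module M n) \<longrightarrow>
      v \<oplus>\<^bsub>power_module M n\<^esub> w = w \<oplus>\<^bsub>power_module M n\<^esub> v"
      using mem by (auto simp: power_module_simps M.a_comm intro!: restrict_ext)
    show "\<forall>u v w. u \<in> carrier (power_module M n) \<and> v \<in> carrier (power_module M n) \<and> w \<in> carrier (power_module M n) \<longrightarrow>
      u \<oplus>\<^bsub>power_module M n\<^esub> v \<oplus>\<^bsub>power_module M n\<^esub> w = u \<oplus>\<^bsub>power_module M n\<^esub> (v \<oplus>\<^bsub>power_module M n\<^esub> w)"
      using mem by (auto simp: power_module_simps M.a_assoc intro!: restrict_ext)
    show "\<forall>v\<in>carrier (power_module M n). v \<oplus>\<^bsub>power_module M n\<^esub> \<zero>\<^bsub>power_module M n\<^esub> = v"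
      using mem by (auto simp: power_module_simps intro!: ext)
    show "\<forall>a b v. a \<in> carrier R \<and> b \<in> carrier R \<and> v \<in> carrier (power_module M n) \<longrightarrow>
      (a \<otimes>\<^bsub>R\<^esub> b) \<odot>\<^bsub>power_module M n\<^esub> v = a \<odot>\<^bsub>power_module M n\<^esub> (b \<odot>\<^bsub>power_module M n\<^esub> v)"
      using mem by (auto simp: power_module_simps smult_assoc1 intro!: restrict_ext)
    show "\<forall>v\<in>carrier (power_module M n). \<one>\<^bsub>R\<^esub> \<odot>\<^bsub>power_module M n\<^esub> v = v"
      using mem by (auto simp: power_module_simps intro!: ext)
    show "\<forall>a b v. a \<in> carrier R \<and> b \<in> carrier R \<and> v \<in> carrier (power_module M n) \<longrightarrow>
      (a \<oplus>\<^bsub>R\<^esub> b) \<odot>\<^bsub>power_module M n\<^esub> v = a \<odot>\<^bsub>power_module M n\<^esub> v \<oplus>\<^bsub>power_module M n\<^esub> b \<odot>\<^bsub>power_module M n\<^esub> v"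
      using mem by (auto simp: power_module_simps smult_l_distr intro!: restrict_ext)
    show "\<forall>a v w. a \<in> carrier R \<and> v \<in> carrier (power_module M n) \<and> w \<in> carrier (power_module M n) \<longrightarrow>
      a \<odot>\<^bsub>power_module M n\<^esub> (v \<oplus>\<^bsub>power_module M n\<^esub> w) =
      a \<odot>\<^bsub>power_module M n\<^esub> v \<oplus>\<^bsub>power_module M n\<^esub> a \<odot>\<^bsub>power_module M n\<^esub> w"
      using mem by (auto simp: power_module_simps smult_r_distr intro!: restrict_ext)
  qed
qed

lemma vectorspace_power_module: "vectorspace K V \<Longrightarrow> vectorspace K (power_module V n)"
  by (simp add: vectorspace_def module_power_module)

lemma power_module_memD: "x \<in> carrier (power_module M n) \<Longrightarrow> l < n \<Longrightarrow> x l \<in> carrier M"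
  by (auto simp: power_module_simps)

lemma power_module_eqI:
  "x \<in> carrier (power_module M n) \<Longrightarrow> y \<in> carrier (power_module M n) \<Longrightarrow>
    (\<And>l. l < n \<Longrightarrow> x l = y l) \<Longrightarrow> x = y"
  unfolding power_module_simps by (rule PiE_ext) auto

text \<open>Induction over the truncations of \<open>x\<close> to its first \<open>m\<close>
  coordinates.\<close>

lemma power_module_mem_imp:
  assumes M: "module R M" and x: "x \<in> carrier (power_module M n)"
    and N: "\<zero>\<^bsub>power_module M n\<^esub> \<in> N" "\<And>u v. u \<in> N \<Longrightarrow> v \<in> N \<Longrightarrow> u \<oplus>\<^bsub>power_module M n\<^esub> v \<in> N"
    and single: "\<And>m. m < n \<Longrightarrow> (\<lambda>l\<in>{..<n}. if l = m then x m else \<zero>\<^bsub>M\<^esub>) \<in> N"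
  shows "x \<in> N"
proof -
  interpret module R M by fact
  note xM = power_module_memD[OF x]
  have "(\<lambda>l\<in>{..<n}. if l < m then x l else \<zero>\<^bsub>M\<^esub>) \<in> N" if "m \<le> n" for m
    using that
  proof (induct m)
    case 0
    have "(\<lambda>l\<in>{..<n}. if l < 0 then x l else \<zero>\<^bsub>M\<^esub>) = \<zero>\<^bsub>power_module M n\<^esub>" by (simp add: power_module_simps)
    then show ?case using N(1) by simp
  next
    case (Suc m)
    have "(\<lambda>l\<in>{..<n}. if l < Suc m then x l else \<zero>\<^bsub>M\<^esub>) =
        (\<lambda>l\<in>{..<n}. if l < m then x l else \<zero>\<^bsub>M\<^esub>) \<oplus>\<^bsub>power_module M n\<^esub>
        (\<lambda>l\<in>{..<n}. if l = m then x m else \<zero>\<^bsub>M\<^esub>)"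
      using xM Suc(2) by (auto simp: power_module_simps less_Suc_eq intro!: restrict_ext)
    moreover have "m < n" using Suc(2) by simp
    ultimately show ?case using N(2)[OF Suc(1)[OF Suc_leD[OF Suc(2)]] single[of m]] by (simp only:)
  qed
  from this[OF order_refl] have "(\<lambda>l\<in>{..<n}. if l < n then x l else \<zero>\<^bsub>M\<^esub>) \<in> N" .
  moreover have "(\<lambda>l\<in>{..<n}. if l < n then x l else \<zero>\<^bsub>M\<^esub>) = x"
    by (rule power_module_eqI[OF _ x]) (use xM in \<open>auto simp: power_module_simps\<close>)
  ultimately show ?thesis by (simp only:)
qed

text \<open>Over the base field \<open>K\<close>; \<open>R\<close> acts on the associated graded module, seen as a vector space only, by such operators.\<close>

definition linear_scalar :: "('a, 'k) ring_scheme \<Rightarrow> ('a, 'b, 'm) module_scheme \<Rightarrow> 'a \<Rightarrow> bool" where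
  "linear_scalar K V a \<longleftrightarrow> additive_map V V (\<lambda>x. a \<odot>\<^bsub>V\<^esub> x) \<and>
     (\<forall>k\<in>carrier K. \<forall>x\<in>carrier V. a \<odot>\<^bsub>V\<^esub> (k \<odot>\<^bsub>V\<^esub> x) = k \<odot>\<^bsub>V\<^esub> (a \<odot>\<^bsub>V\<^esub> x))"

lemma linear_scalarD:
  assumes "linear_scalar K V a"
  shows "x \<in> carrier V \<Longrightarrow> a \<odot>\<^bsub>V\<^esub> x \<in> carrier V"
    "x \<in> carrier V \<Longrightarrow> y \<in> carrier V \<Longrightarrow> a \<odot>\<^bsub>V\<^esub> (x \<oplus>\<^bsub>V\<^esub> y) = a \<odot>\<^bsub>V\<^esub> x \<oplus>\<^bsub>V\<^esub> a \<odot>\<^bsub>V\<^esub> y"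
    "k \<in> carrier K \<Longrightarrow> x \<in> carrier V \<Longrightarrow> a \<odot>\<^bsub>V\<^esub> (k \<odot>\<^bsub>V\<^esub> x) = k \<odot>\<^bsub>V\<^esub> (a \<odot>\<^bsub>V\<^esub> x)"
  using assms by (auto simp: linear_scalar_def additive_map_def)

lemma matrix_map_apply: "r < m \<Longrightarrow> matrix_map N m n \<phi> x r = (\<Oplus>\<^bsub>N\<^esub>c\<in>{..<n}. \<phi> r c \<odot>\<^bsub>N\<^esub> x c)"
  by (simp add: matrix_map_def)

context module
begin

lemma matrix_map_closed:
  assumes "\<And>r c. r < m \<Longrightarrow> c < n \<Longrightarrow> linear_scalar R M (\<phi> r c)" "x \<in> carrier (power_module M n)"
  shows "matrix_map M m n \<phi> x \<in> carrier (power_module M m)"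
  using linear_scalarD(1)[OF assms(1)] power_module_memD[OF assms(2)]
  by (auto simp: matrix_map_def power_module_simps intro!: M.finsum_closed)

lemma matrix_map_add:
  assumes "\<And>r c. r < m \<Longrightarrow> c < n \<Longrightarrow> linear_scalar R M (\<phi> r c)"
    "x \<in> carrier (power_module M n)" "y \<in> carrier (power_module M n)"
  shows "matrix_map M m n \<phi> (x \<oplus>\<^bsub>power_module M n\<^esub> y) =
    matrix_map M m n \<phi> x \<oplus>\<^bsub>power_module M m\<^esub> matrix_map M m n \<phi> y"
proof (rule power_module_eqI)
  interpret P: module R "power_module M n" by (rule module_power_module) (rule module_axioms)
  interpret Q: module R "power_module M m" by (rule module_power_module) (rule module_axioms)
  note cl = matrix_map_closed[of m n \<phi>, OF assms(1)]
  show "matrix_map M m n \<phi> (x \<oplus>\<^bsub>power_module M n\<^esub> y) \<in> carrier (power_module M m)"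
    by (rule cl) (use assms in auto)
  show "matrix_map M m n \<phi> x \<oplus>\<^bsub>power_module M m\<^esub> matrix_map M m n \<phi> y \<in> carrier (power_module M m)"
    by (intro Q.M.a_closed cl) (use assms in auto)
  fix r assume r: "r < m"
  have "(\<Oplus>\<^bsub>M\<^esub>c\<in>{..<n}. \<phi> r c \<odot>\<^bsub>M\<^esub> (x \<oplus>\<^bsub>power_module M n\<^esub> y) c) =
      (\<Oplus>\<^bsub>M\<^esub>c\<in>{..<n}. \<phi> r c \<odot>\<^bsub>M\<^esub> x c \<oplus>\<^bsub>M\<^esub> \<phi> r c \<odot>\<^bsub>M\<^esub> y c)"
    using linear_scalarD(1,2)[OF assms(1)[OF r]] power_module_memD[OF assms(2)] power_module_memD[OF assms(3)]
    by (intro M.finsum_cong') (auto simp: power_module_simps)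
  also have "\<dots> = (\<Oplus>\<^bsub>M\<^esub>c\<in>{..<n}. \<phi> r c \<odot>\<^bsub>M\<^esub> x c) \<oplus>\<^bsub>M\<^esub> (\<Oplus>\<^bsub>M\<^esub>c\<in>{..<n}. \<phi> r c \<odot>\<^bsub>M\<^esub> y c)"
    using linear_scalarD(1)[OF assms(1)[OF r]] power_module_memD[OF assms(2)] power_module_memD[OF assms(3)]
    by (intro M.finsum_addf) auto
  finally show "matrix_map M m n \<phi> (x \<oplus>\<^bsub>power_module M n\<^esub> y) r =
      (matrix_map M m n \<phi> x \<oplus>\<^bsub>power_module M m\<^esub> matrix_map M m n \<phi> y) r"
    using r by (simp add: matrix_map_apply power_module_simps)
qed

lemma matrix_map_additive:
  assumes "\<And>r c. r < m \<Longrightarrow> c < n \<Longrightarrow> linear_scalar R M (\<phi> r c)"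
  shows "additive_map (power_module M n) (power_module M m) (matrix_map M m n \<phi>)"
  using matrix_map_closed[of m n \<phi>] matrix_map_add[of m n \<phi>] assms by (auto simp: additive_map_def)

lemma matrix_map_smult:
  assumes "\<And>r c. r < m \<Longrightarrow> c < n \<Longrightarrow> linear_scalar R M (\<phi> r c)"
    "x \<in> carrier (power_module M n)" "k \<in> carrier R"
  shows "matrix_map M m n \<phi> (k \<odot>\<^bsub>power_module M n\<^esub> x) = k \<odot>\<^bsub>power_module M m\<^esub> matrix_map M m n \<phi> x"
proof (rule power_module_eqI)
  interpret P: module R "power_module M n" by (rule module_power_module) (rule module_axioms)
  interpret Q: module R "power_module M m" by (rule module_power_module) (rule module_axioms)
  note cl = matrix_map_closed[of m n \<phi>, OF assms(1)]
  show "matrix_map M m n \<phi> (k \<odot>\<^bsub>power_module M n\<^esub> x) \<in> carrier (power_module M m)"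
    by (rule cl) (use assms in auto)
  show "k \<odot>\<^bsub>power_module M m\<^esub> matrix_map M m n \<phi> x \<in> carrier (power_module M m)"
    by (intro Q.smult_closed cl) (use assms in auto)
  fix r assume r: "r < m"
  have "(\<Oplus>\<^bsub>M\<^esub>c\<in>{..<n}. \<phi> r c \<odot>\<^bsub>M\<^esub> (k \<odot>\<^bsub>power_module M n\<^esub> x) c) =
      (\<Oplus>\<^bsub>M\<^esub>c\<in>{..<n}. k \<odot>\<^bsub>M\<^esub> (\<phi> r c \<odot>\<^bsub>M\<^esub> x c))"
    using linear_scalarD(1,3)[OF assms(1)[OF r]] power_module_memD[OF assms(2)] assms(3)
    by (intro M.finsum_cong') (auto simp: power_module_simps)
  also have "\<dots> = k \<odot>\<^bsub>M\<^esub> (\<Oplus>\<^bsub>M\<^esub>c\<in>{..<n}. \<phi> r c \<odot>\<^bsub>M\<^esub> x c)"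
    using linear_scalarD(1)[OF assms(1)[OF r]] power_module_memD[OF assms(2)] assms(3)
    by (intro finsum_smult_ldistr[symmetric]) auto
  finally show "matrix_map M m n \<phi> (k \<odot>\<^bsub>power_module M n\<^esub> x) r =
      (k \<odot>\<^bsub>power_module M m\<^esub> matrix_map M m n \<phi> x) r"
    using r by (simp add: matrix_map_apply power_module_simps)
qed

lemma tclosed_matrix_map_kernel:
  assumes "\<And>r c. r < m \<Longrightarrow> c < n \<Longrightarrow> linear_scalar R M (\<phi> r c)"
  shows "tclosed (power_module M n) (carrier R)
    {x \<in> carrier (power_module M n). matrix_map M m n \<phi> x = \<zero>\<^bsub>power_module M m\<^esub>}"
proof -
  interpret P: module R "power_module M n" by (rule module_power_module) (rule module_axioms)
  interpret Q: module R "power_module M m" by (rule module_power_module) (rule module_axioms)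
  have 0: "matrix_map M m n \<phi> \<zero>\<^bsub>power_module M n\<^esub> = \<zero>\<^bsub>power_module M m\<^esub>"
    by (rule additive_map_zero[OF P.abelian_group_axioms Q.abelian_group_axioms matrix_map_additive])
      (rule assms)
  show ?thesis
    by (rule tclosedI) (use 0 in \<open>auto simp: matrix_map_add[of m n \<phi>, OF assms] matrix_map_smult[of m n \<phi>, OF assms]\<close>)
qed

lemma tclosed_matrix_map_image:
  assumes "\<And>r c. r < m \<Longrightarrow> c < n \<Longrightarrow> linear_scalar R M (\<phi> r c)"
  shows "tclosed (power_module M m) (carrier R) (matrix_map M m n \<phi> ` carrier (power_module M n))"
proof -
  interpret P: module R "power_module M n" by (rule module_power_module) (rule module_axioms)
  interpret Q: module R "power_module M m" by (rule module_power_module) (rule module_axioms)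
  have 0: "matrix_map M m n \<phi> \<zero>\<^bsub>power_module M n\<^esub> = \<zero>\<^bsub>power_module M m\<^esub>"
    by (rule additive_map_zero[OF P.abelian_group_axioms Q.abelian_group_axioms matrix_map_additive])
      (rule assms)
  show ?thesis
  proof (rule tclosedI)
    show "matrix_map M m n \<phi> ` carrier (power_module M n) \<subseteq> carrier (power_module M m)"
      using matrix_map_closed[of m n \<phi>, OF assms] by auto
    show "\<zero>\<^bsub>power_module M m\<^esub> \<in> matrix_map M m n \<phi> ` carrier (power_module M n)"
      using 0 P.M.zero_closed by (metis imageI)
  next
    fix x y assume "x \<in> matrix_map M m n \<phi> ` carrier (power_module M n)"
      "y \<in> matrix_map M m n \<phi> ` carrier (power_module M n)"
    then show "x \<oplus>\<^bsub>power_module M m\<^esub> y \<in> matrix_map M m n \<phi> ` carrier (power_module M n)"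
      using matrix_map_add[of m n \<phi>, OF assms] P.M.a_closed by (smt (verit) image_iff)
  next
    fix t x assume "t \<in> carrier R" "x \<in> matrix_map M m n \<phi> ` carrier (power_module M n)"
    then show "t \<odot>\<^bsub>power_module M m\<^esub> x \<in> matrix_map M m n \<phi> ` carrier (power_module M n)"
      using matrix_map_smult[of m n \<phi>, OF assms] P.smult_closed by (smt (verit) image_iff)
  qed
qed

lemma linear_scalar_carrier: "a \<in> carrier R \<Longrightarrow> linear_scalar R M a"
  unfolding linear_scalar_def additive_map_def
  by (auto simp: smult_r_distr smult_assoc1[symmetric] R.m_comm)

text \<open>The resolution gives the vanishing of matrix products over \<open>R\<close>; this
  formula carries it over to the maps between powers of \<open>M\<close>.\<close>

lemma matrix_map_comp:
  assumes "\<And>r c. r < m \<Longrightarrow> c < n \<Longrightarrow> \<phi> r c \<in> carrier R" "\<And>c s. c < n \<Longrightarrow> s < p \<Longrightarrow> \<psi> c s \<in> carrier R"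
    and x: "x \<in> carrier (power_module M p)"
    and r: "r < m"
  shows "matrix_map M m n \<phi> (matrix_map M n p \<psi> x) r =
    (\<Oplus>\<^bsub>M\<^esub>s\<in>{..<p}. (\<Oplus>c\<in>{..<n}. \<phi> r c \<otimes> \<psi> c s) \<odot>\<^bsub>M\<^esub> x s)"
proof -
  note xM = power_module_memD[OF x]
  have ldistr: "(\<Oplus>i\<in>S. f i) \<odot>\<^bsub>M\<^esub> y = (\<Oplus>\<^bsub>M\<^esub>i\<in>S. f i \<odot>\<^bsub>M\<^esub> y)"
    if "finite S" "f \<in> S \<rightarrow> carrier R" "y \<in> carrier M" for f y and S :: "nat set"
    using that(1,2)
    by (induct S rule: finite_induct) (auto simp: Pi_def that(3) smult_l_distr)
  have "matrix_map M m n \<phi> (matrix_map M n p \<psi> x) r =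
      (\<Oplus>\<^bsub>M\<^esub>c\<in>{..<n}. \<phi> r c \<odot>\<^bsub>M\<^esub> (\<Oplus>\<^bsub>M\<^esub>s\<in>{..<p}. \<psi> c s \<odot>\<^bsub>M\<^esub> x s))"
    unfolding matrix_map_apply[OF r]
    by (rule M.finsum_cong') (use assms xM r in \<open>auto simp: matrix_map_apply intro!: smult_closed M.finsum_closed\<close>)
  also have "\<dots> = (\<Oplus>\<^bsub>M\<^esub>c\<in>{..<n}. (\<Oplus>\<^bsub>M\<^esub>s\<in>{..<p}. (\<phi> r c \<otimes> \<psi> c s) \<odot>\<^bsub>M\<^esub> x s))"
    by (rule M.finsum_cong')
      (use assms xM r in \<open>auto simp: finsum_smult_ldistr Pi_def smult_assoc1 intro!: M.finsum_closed M.finsum_cong'\<close>)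
  also have "\<dots> = (\<Oplus>\<^bsub>M\<^esub>s\<in>{..<p}. (\<Oplus>\<^bsub>M\<^esub>c\<in>{..<n}. (\<phi> r c \<otimes> \<psi> c s) \<odot>\<^bsub>M\<^esub> x s))"
    by (rule M.add.finprod_finprod_swap[folded finsum_def]) (use assms xM r in auto)
  also have "\<dots> = (\<Oplus>\<^bsub>M\<^esub>s\<in>{..<p}. (\<Oplus>c\<in>{..<n}. \<phi> r c \<otimes> \<psi> c s) \<odot>\<^bsub>M\<^esub> x s)"
    by (rule M.finsum_cong') (use assms xM r in \<open>auto simp: ldistr Pi_def intro!: R.finsum_closed\<close>)
  finally show ?thesis .
qed

end

section \<open>Gradings\<close>

text \<open>Only the additive structure is recorded, so the same facts serve \<open>R\<close>,
  \<open>M\<close> and the powers of \<open>M\<close> with twisted gradings.\<close>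

locale graded_group = abelian_group M
  for M :: "('b, 'm) ring_scheme" (structure) and G :: "nat \<Rightarrow> 'b set" +
  assumes ids: "internal_direct_sum M G"
begin

abbreviation "hcomp i x \<equiv> hom_component M G i x"

lemma G_subset: "x \<in> G i \<Longrightarrow> x \<in> carrier M"
  and G_zero: "\<zero> \<in> G i"
  and G_add: "x \<in> G i \<Longrightarrow> y \<in> G i \<Longrightarrow> x \<oplus> y \<in> G i"
  and G_uminus: "x \<in> G i \<Longrightarrow> \<ominus> x \<in> G i"
proof -
  have "subgroup (G i) (add_monoid M)" using ids by (simp add: internal_direct_sum_def)
  from subgroup.subset[OF this] subgroup.one_closed[OF this] subgroup.m_closed[OF this] subgroup.m_inv_closed[OF this]
  show "x \<in> G i \<Longrightarrow> x \<in> carrier M" "\<zero> \<in> G i" "x \<in> G i \<Longrightarrow> y \<in> G i \<Longrightarrow> x \<oplus> y \<in> G i" "x \<in> G i \<Longrightarrow> \<ominus> x \<in> G i"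
    by (auto simp: a_inv_def)
qed

lemma is_decomposition_comp: "x \<in> carrier M \<Longrightarrow> is_decomposition M G x (\<lambda>i. hcomp i x)"
  using theI'[of "is_decomposition M G x"] ids by (simp add: internal_direct_sum_def hom_component_def)

lemma comp_unique:
  assumes "is_decomposition M G x c"
  shows "hcomp i x = c i"
proof -
  have "c \<in> S \<rightarrow> carrier M" for S using assms G_subset by (auto simp: is_decomposition_def)
  then have "x \<in> carrier M" using assms finsum_closed by (force simp: is_decomposition_def)
  then have "(THE c. is_decomposition M G x c) = c"
    using ids assms by (intro the1_equality) (auto simp: internal_direct_sum_def)
  then show ?thesis by (simp add: hom_component_def)
qed

lemma comp_in: "x \<in> carrier M \<Longrightarrow> hcomp i x \<in> G i"
  using is_decomposition_comp by (auto simp: is_decomposition_def)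

lemma comp_carrier: "x \<in> carrier M \<Longrightarrow> hcomp i x \<in> carrier M"
  using comp_in G_subset by blast

lemma finsum_neutral_superset:
  assumes "finite S" "\<And>i. i \<notin> S \<Longrightarrow> c i = \<zero>" "\<And>i. c i \<in> carrier M"
  shows "finsum M c {i. c i \<noteq> \<zero>} = finsum M c S"
  by (rule add.finprod_mono_neutral_cong_left[folded finsum_def, simplified]) (use assms in auto)

lemma is_decompositionI:
  assumes "finite S" "\<And>i. i \<notin> S \<Longrightarrow> c i = \<zero>" "\<And>i. c i \<in> G i" "finsum M c S = x"
  shows "is_decomposition M G x c"
proof -
  have "{i. c i \<noteq> \<zero>} \<subseteq> S" using assms(2) by auto
  moreover have "finsum M c {i. c i \<noteq> \<zero>} = finsum M c S"
    by (rule finsum_neutral_superset) (use assms G_subset in blast)+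
  ultimately show ?thesis
    using assms finite_subset by (auto simp: is_decomposition_def)
qed

lemma comp_hom:
  assumes "x \<in> G i"
  shows "hcomp j x = (if j = i then x else \<zero>)"
proof (rule comp_unique, rule is_decompositionI[of "{i}"])
  show "finsum M (\<lambda>j. if j = i then x else \<zero>) {i} = x" using G_subset[OF assms] by simp
qed (use assms G_zero in auto)

lemma comp_zero: "hcomp j \<zero> = \<zero>"
  using comp_hom[OF G_zero[of j], of j] by simp

lemma finsum_comp:
  assumes "x \<in> carrier M" "finite S" "\<And>i. i \<notin> S \<Longrightarrow> hcomp i x = \<zero>"
  shows "finsum M (\<lambda>i. hcomp i x) S = x"
proof -
  have "finsum M (\<lambda>i. hcomp i x) {i. hcomp i x \<noteq> \<zero>} = finsum M (\<lambda>i. hcomp i x) S"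
    by (rule finsum_neutral_superset) (use assms comp_carrier in auto)
  then show ?thesis using is_decomposition_comp[OF assms(1)] by (simp add: is_decomposition_def)
qed

lemma comp_add:
  assumes "x \<in> carrier M" "y \<in> carrier M"
  shows "hcomp i (x \<oplus> y) = hcomp i x \<oplus> hcomp i y"
proof -
  let ?S = "{i. hcomp i x \<noteq> \<zero>} \<union> {i. hcomp i y \<noteq> \<zero>}"
  note dx = is_decomposition_comp[OF assms(1)] and dy = is_decomposition_comp[OF assms(2)]
  have fin: "finite ?S" using dx dy by (simp add: is_decomposition_def)
  have sx: "finsum M (\<lambda>i. hcomp i x) ?S = x"
    by (rule finsum_comp[OF assms(1) fin]) simp
  have sy: "finsum M (\<lambda>i. hcomp i y) ?S = y"
    by (rule finsum_comp[OF assms(2) fin]) simp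
  have "is_decomposition M G (x \<oplus> y) (\<lambda>i. hcomp i x \<oplus> hcomp i y)"
  proof (rule is_decompositionI[OF fin])
    show "finsum M (\<lambda>i. hcomp i x \<oplus> hcomp i y) ?S = x \<oplus> y"
      using finsum_addf[of "\<lambda>i. hcomp i x" ?S "\<lambda>i. hcomp i y"] comp_carrier[OF assms(1)] comp_carrier[OF assms(2)]
      unfolding sx sy by simp
  qed (use comp_in assms G_add in auto)
  then show ?thesis by (rule comp_unique)
qed

lemma comp_additive: "additive_map M M (hcomp i)"
  using comp_add comp_carrier by (auto simp: additive_map_def)

lemma finite_comp: "x \<in> carrier M \<Longrightarrow> finite {i. hcomp i x \<noteq> \<zero>}"
  using is_decomposition_comp by (auto simp: is_decomposition_def)

lemma comp_mem_imp:
  assumes x: "x \<in> carrier M" and N: "\<zero> \<in> N" "\<And>u v. u \<in> N \<Longrightarrow> v \<in> N \<Longrightarrow> u \<oplus> v \<in> N"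
    and c: "\<And>i. hcomp i x \<in> N"
  shows "x \<in> N"
proof -
  have "finsum M (\<lambda>i. hcomp i x) S \<in> N" if "finite S" for S
    using that
  proof (induct S rule: finite_induct)
    case (insert i S)
    then show ?case using N(2)[OF c[of i]] comp_carrier[OF x] by (simp add: Pi_def)
  qed (use N in simp)
  moreover have "finsum M (\<lambda>i. hcomp i x) {i. hcomp i x \<noteq> \<zero>} = x"
    using is_decomposition_comp[OF x] by (simp add: is_decomposition_def)
  ultimately show ?thesis using finite_comp[OF x] by metis
qed

lemma graded_induct [consumes 1, case_names zero add hom]:
  assumes "x \<in> carrier M" "P \<zero>"
    "\<And>x y. x \<in> carrier M \<Longrightarrow> y \<in> carrier M \<Longrightarrow> P x \<Longrightarrow> P y \<Longrightarrow> P (x \<oplus> y)"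
    "\<And>i x. x \<in> G i \<Longrightarrow> P x"
  shows "P x"
proof -
  have "x \<in> {x \<in> carrier M. P x}"
  proof (rule comp_mem_imp[OF assms(1)])
    show "hcomp i x \<in> {x \<in> carrier M. P x}" for i
      using assms(4)[OF comp_in[OF assms(1)]] comp_carrier[OF assms(1)] by simp
  qed (use assms(2,3) in auto)
  then show ?thesis by simp
qed

end

text \<open>Both sides are additive in \<open>x\<close>, so it suffices to compare them on
  homogeneous elements.\<close>

lemma graded_hom_comp:
  assumes "graded_group M G" "graded_group N H" "additive_map M N f"
    "\<And>i x. x \<in> G i \<Longrightarrow> f x \<in> H i" and x: "x \<in> carrier M"
  shows "hom_component N H j (f x) = f (hom_component M G j x)"
proof -
  interpret M: graded_group M G by fact
  interpret N: graded_group N H by fact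
  note f = additive_mapD[OF assms(3)] and f0 = additive_map_zero[OF M.abelian_group_axioms N.abelian_group_axioms assms(3)]
  show ?thesis
    using x
  proof (induct x rule: M.graded_induct)
    case zero
    then show ?case by (simp add: f0 M.comp_zero N.comp_zero)
  next
    case (add x y)
    then show ?case using f by (simp add: M.comp_add N.comp_add M.comp_carrier)
  next
    case (hom i x)
    then show ?case using N.comp_hom[OF assms(4)[OF hom]] M.comp_hom[OF hom] f0 by simp
  qed
qed

text \<open>Uniqueness of a decomposition follows by applying \<open>pr j\<close> to the sum,
  existence by building elements up from homogeneous ones. With no operators,
  \<open>tspan M {}\<close> allows only zero, generators and sums.\<close>

lemma graded_groupI:
  fixes M :: "('a, 'b, 'm) module_scheme"
  assumes M: "abelian_group M" and sub: "\<And>i. subgroup (G i) (add_monoid M)"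
    and gen: "\<And>x. x \<in> carrier M \<Longrightarrow> x \<in> tspan M {} (\<Union>i. G i)"
    and pr: "\<And>j. additive_map M M (pr j)" "\<And>i j x. x \<in> G i \<Longrightarrow> pr j x = (if j = i then x else \<zero>\<^bsub>M\<^esub>)"
  shows "graded_group M G" "x \<in> carrier M \<Longrightarrow> hom_component M G j x = pr j x"
proof -
  interpret M: abelian_group M by fact
  have GM: "x \<in> G i \<Longrightarrow> x \<in> carrier M" for x i using subgroup.subset[OF sub[of i]] by auto
  have G0: "\<zero>\<^bsub>M\<^esub> \<in> G i" for i using subgroup.one_closed[OF sub[of i]] by simp
  have Ga: "x \<in> G i \<Longrightarrow> y \<in> G i \<Longrightarrow> x \<oplus>\<^bsub>M\<^esub> y \<in> G i" for x y i
    using subgroup.m_closed[OF sub[of i]] by simp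
  have neutral: "finsum M c {i. c i \<noteq> \<zero>\<^bsub>M\<^esub>} = finsum M c S"
    if "finite S" "\<And>i. i \<notin> S \<Longrightarrow> c i = \<zero>\<^bsub>M\<^esub>" "\<And>i. c i \<in> carrier M" for S :: "nat set" and c
    by (rule M.add.finprod_mono_neutral_cong_left[folded finsum_def, simplified]) (use that in auto)
  have uniq: "c j = pr j x" if c: "is_decomposition M G x c" for c j x
  proof -
    have cM: "c i \<in> carrier M" for i using c GM by (auto simp: is_decomposition_def)
    have cG: "c i \<in> G i" for i using c by (auto simp: is_decomposition_def)
    let ?S = "insert j {i. c i \<noteq> \<zero>\<^bsub>M\<^esub>}"
    have fin: "finite ?S" using c by (simp add: is_decomposition_def)
    have "finsum M c {i. c i \<noteq> \<zero>\<^bsub>M\<^esub>} = finsum M c ?S" by (rule neutral[OF fin]) (use cM in auto)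
    then have "pr j x = pr j (finsum M c ?S)" using c by (simp add: is_decomposition_def)
    also have "\<dots> = finsum M (\<lambda>i. pr j (c i)) ?S"
      by (rule additive_map_finsum[OF M M pr(1) fin]) (use cM in simp)
    also have "\<dots> = finsum M (\<lambda>i. if j = i then c i else \<zero>\<^bsub>M\<^esub>) ?S"
      by (rule M.finsum_cong') (use pr(2)[OF cG] cM in simp_all)
    also have "\<dots> = c j" by (rule M.finsum_singleton) (use fin cM in auto)
    finally show ?thesis by simp
  qed
  have ex: "\<exists>c. is_decomposition M G x c" if "x \<in> tspan M {} (\<Union>i. G i)" for x
    using that
  proof (induct rule: tspan.induct)
    case tspan_zero
    show ?case by (rule exI[of _ "\<lambda>_. \<zero>\<^bsub>M\<^esub>"]) (use G0 in \<open>simp add: is_decomposition_def\<close>)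
  next
    case (tspan_base x)
    then obtain i where i: "x \<in> G i" by auto
    show ?case
    proof (rule exI[of _ "\<lambda>j. if j = i then x else \<zero>\<^bsub>M\<^esub>"])
      show "is_decomposition M G x (\<lambda>j. if j = i then x else \<zero>\<^bsub>M\<^esub>)"
        using i G0 GM[OF i] neutral[of "{i}" "\<lambda>j. if j = i then x else \<zero>\<^bsub>M\<^esub>"]
        by (auto simp: is_decomposition_def)
    qed
  next
    case (tspan_add x y)
    then obtain c d where cd: "is_decomposition M G x c" "is_decomposition M G y d" by auto
    have cM: "c i \<in> carrier M" "d i \<in> carrier M" for i using cd GM by (auto simp: is_decomposition_def)
    let ?S = "{i. c i \<noteq> \<zero>\<^bsub>M\<^esub>} \<union> {i. d i \<noteq> \<zero>\<^bsub>M\<^esub>}"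
    let ?e = "\<lambda>i. c i \<oplus>\<^bsub>M\<^esub> d i"
    have fin: "finite ?S" using cd by (simp add: is_decomposition_def)
    have "finsum M c ?S = x" "finsum M d ?S = y"
      using neutral[OF fin, of c] neutral[OF fin, of d] cd cM by (auto simp: is_decomposition_def)
    then have "finsum M ?e ?S = x \<oplus>\<^bsub>M\<^esub> y" using M.finsum_addf[of c ?S d] cM by auto
    then have "finsum M ?e {i. ?e i \<noteq> \<zero>\<^bsub>M\<^esub>} = x \<oplus>\<^bsub>M\<^esub> y" using neutral[OF fin, of ?e] cM by auto
    moreover have "finite {i. ?e i \<noteq> \<zero>\<^bsub>M\<^esub>}" by (rule finite_subset[OF _ fin]) auto
    ultimately show ?case using cd Ga by (intro exI[of _ ?e]) (auto simp: is_decomposition_def)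
  qed (simp)
  show gg: "graded_group M G"
  proof (intro graded_group.intro M graded_group_axioms.intro)
    have "\<exists>!c. is_decomposition M G x c" if "x \<in> carrier M" for x
      using ex[OF gen[OF that]] uniq by (metis ext)
    then show "internal_direct_sum M G" using sub by (simp add: internal_direct_sum_def)
  qed
  show "hom_component M G j x = pr j x" if "x \<in> carrier M"
    using uniq[OF graded_group.is_decomposition_comp[OF gg that]] .
qed

context graded_module
begin

lemma graded_group_R: "graded_group R A"
  by (intro graded_group.intro graded_group_axioms.intro ring.is_abelian_group[OF ring_axioms] direct_sum)

lemma graded_group_M: "graded_group M G"
  by (intro graded_group.intro graded_group_axioms.intro M.abelian_group_axioms module_direct_sum)

definition power_grading :: "(nat \<Rightarrow> nat) \<Rightarrow> nat \<Rightarrow> nat \<Rightarrow> (nat \<Rightarrow> 'b) set" where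
  "power_grading d n j = (\<Pi>\<^sub>E l\<in>{..<n}. twist M G (d l) j)"

text \<open>The guard matters: for \<open>j < d l\<close> truncated subtraction would pick the
  component of degree zero instead of zero.\<close>

definition power_comp :: "(nat \<Rightarrow> nat) \<Rightarrow> nat \<Rightarrow> nat \<Rightarrow> (nat \<Rightarrow> 'b) \<Rightarrow> (nat \<Rightarrow> 'b)" where
  "power_comp d n j x = (\<lambda>l\<in>{..<n}. if d l \<le> j then hom_component M G (j - d l) (x l) else \<zero>\<^bsub>M\<^esub>)"

text \<open>The maps \<open>power_comp\<close> are the projections required by the criterion above.
  Generation is checked one coordinate at a time.\<close>

lemma power_graded:
  shows "graded_group (power_module M n) (power_grading d n)"
    and "x \<in> carrier (power_module M n) \<Longrightarrow>
      hom_component (power_module M n) (power_grading d n) j x = power_comp d n j x"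
proof -
  interpret g: graded_group M G by (rule graded_group_M)
  interpret P: module R "power_module M n" by (rule module_power_module) (rule module_axioms)
  have tw: "x \<in> twist M G e j \<Longrightarrow> x \<in> carrier M" "\<zero>\<^bsub>M\<^esub> \<in> twist M G e j"
    "x \<in> twist M G e j \<Longrightarrow> y \<in> twist M G e j \<Longrightarrow> x \<oplus>\<^bsub>M\<^esub> y \<in> twist M G e j"
    "x \<in> twist M G e j \<Longrightarrow> \<ominus>\<^bsub>M\<^esub> x \<in> twist M G e j" for x y e j
    using g.G_subset g.G_zero g.G_add g.G_uminus M.minus_equality[of "\<zero>\<^bsub>M\<^esub>" "\<zero>\<^bsub>M\<^esub>"]
    by (auto simp: twist_def split: if_splits)
  have PM: "x \<in> power_grading d n j \<Longrightarrow> x \<in> carrier (power_module M n)" for x j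
    using tw(1) by (fastforce simp: power_grading_def power_module_simps PiE_iff)
  have sub: "subgroup (power_grading d n j) (add_monoid (power_module M n))" for j
  proof (rule group.subgroupI)
    show "group (add_monoid (power_module M n))" by (rule P.M.a_group)
    show "power_grading d n j \<subseteq> carrier (add_monoid (power_module M n))" using PM by auto
    have "(\<lambda>l\<in>{..<n}. \<zero>\<^bsub>M\<^esub>) \<in> power_grading d n j" using tw(2) by (auto simp: power_grading_def)
    then show "power_grading d n j \<noteq> {}" by auto
    fix x assume x: "x \<in> power_grading d n j"
    have "\<ominus>\<^bsub>power_module M n\<^esub> x = (\<lambda>l\<in>{..<n}. \<ominus>\<^bsub>M\<^esub> x l)"
    proof (rule P.M.minus_equality)
      show xc: "x \<in> carrier (power_module M n)" using PM[OF x] .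
      show "(\<lambda>l\<in>{..<n}. \<ominus>\<^bsub>M\<^esub> x l) \<in> carrier (power_module M n)"
        using power_module_memD[OF xc] by (auto simp: power_module_simps)
      show "(\<lambda>l\<in>{..<n}. \<ominus>\<^bsub>M\<^esub> x l) \<oplus>\<^bsub>power_module M n\<^esub> x = \<zero>\<^bsub>power_module M n\<^esub>"
        using power_module_memD[OF xc] by (auto simp: power_module_simps M.l_neg intro!: restrict_ext)
    qed
    then have "\<ominus>\<^bsub>power_module M n\<^esub> x \<in> power_grading d n j"
      using x tw(4) by (auto simp: power_grading_def)
    then show "inv\<^bsub>add_monoid (power_module M n)\<^esub> x \<in> power_grading d n j" by (simp add: a_inv_def)
  next
    fix x y assume "x \<in> power_grading d n j" "y \<in> power_grading d n j"
    then show "x \<otimes>\<^bsub>add_monoid (power_module M n)\<^esub> y \<in> power_grading d n j"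
      using tw(3)[of "x l" "d l" j "y l" for l] unfolding power_grading_def by (simp add: power_module_simps PiE_iff)
  qed
  let ?T = "tspan (power_module M n) {} (\<Union>j. power_grading d n j)"
  define single where "single m y = (\<lambda>l\<in>{..<n}. if l = m then y else \<zero>\<^bsub>M\<^esub>)" for m and y :: 'b
  have single: "single m y \<in> ?T" if "y \<in> carrier M" for m y
    using that
  proof (induct y rule: g.graded_induct)
    case zero
    have "single m \<zero>\<^bsub>M\<^esub> = \<zero>\<^bsub>power_module M n\<^esub>" by (auto simp: single_def power_module_simps)
    then show ?case using tspan_zero by metis
  next
    case (add x y)
    have "single m (x \<oplus>\<^bsub>M\<^esub> y) = single m x \<oplus>\<^bsub>power_module M n\<^esub> single m y"
      using add by (auto simp: single_def power_module_simps intro!: restrict_ext)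
    then show ?case using add tspan_add by metis
  next
    case (hom i y)
    \<comment> \<open>In position \<open>m\<close> the internal degree \<open>i\<close> is raised by
      the twist \<open>d m\<close>.\<close>
    have "single m y \<in> power_grading d n (i + d m)"
      using hom tw(2) by (auto simp: single_def power_grading_def) (auto simp: twist_def)
    then show ?case by (intro tspan_base) auto
  qed
  have gen: "x \<in> ?T" if x: "x \<in> carrier (power_module M n)" for x
    by (rule power_module_mem_imp[OF module_axioms x tspan_zero tspan_add])
      (use single power_module_memD[OF x] in \<open>auto simp: single_def\<close>)
  have pr1: "additive_map (power_module M n) (power_module M n) (power_comp d n j)" for j
    unfolding additive_map_def
  proof (intro conjI ballI)
    fix x assume x: "x \<in> carrier (power_module M n)"
    show "power_comp d n j x \<in> carrier (power_module M n)"
      using power_module_memD[OF x] g.comp_carrier by (auto simp: power_comp_def power_module_simps)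
    fix y assume y: "y \<in> carrier (power_module M n)"
    show "power_comp d n j (x \<oplus>\<^bsub>power_module M n\<^esub> y) = power_comp d n j x \<oplus>\<^bsub>power_module M n\<^esub> power_comp d n j y"
      using power_module_memD[OF x] power_module_memD[OF y] g.comp_add
      by (auto simp: power_comp_def power_module_simps intro!: restrict_ext)
  qed
  have pr2: "power_comp d n j x = (if j = i then x else \<zero>\<^bsub>power_module M n\<^esub>)" if x: "x \<in> power_grading d n i" for i j x
  proof (rule power_module_eqI)
    have xc: "x \<in> carrier (power_module M n)" by (rule PM[OF x])
    show "power_comp d n j x \<in> carrier (power_module M n)" using additive_mapD(1)[OF pr1 xc] .
    show "(if j = i then x else \<zero>\<^bsub>power_module M n\<^esub>) \<in> carrier (power_module M n)" using xc by simp
    fix l assume l: "l < n"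
    have "x l \<in> twist M G (d l) i" using x l by (auto simp: power_grading_def)
    then have "(if d l \<le> j then hom_component M G (j - d l) (x l) else \<zero>\<^bsub>M\<^esub>) = (if j = i then x l else \<zero>\<^bsub>M\<^esub>)"
      using g.comp_hom[of "x l" "i - d l" "j - d l"] g.comp_zero by (auto simp: twist_def split: if_splits)
    then show "power_comp d n j x l = (if j = i then x else \<zero>\<^bsub>power_module M n\<^esub>) l"
      using l by (auto simp: power_comp_def power_module_simps)
  qed
  show "graded_group (power_module M n) (power_grading d n)"
    by (rule graded_groupI(1)[OF P.M.abelian_group_axioms sub gen pr1 pr2])
  show "hom_component (power_module M n) (power_grading d n) j x = power_comp d n j x"
    if "x \<in> carrier (power_module M n)"
    by (rule graded_groupI(2)[OF P.M.abelian_group_axioms sub gen pr1 pr2 that])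
qed

end

section \<open>Existence of graded free resolutions\<close>

lemma vectorspace_restrict_scalars:
  assumes "module R M" "subfield K R"
  shows "vectorspace (R\<lparr>carrier := K\<rparr>) M"
proof -
  interpret module R M by fact
  have K: "field (R\<lparr>carrier := K\<rparr>)" using R.subfield_iff(2)[OF assms(2)] .
  have KR: "k \<in> K \<Longrightarrow> k \<in> carrier R" for k using subfieldE(3)[OF assms(2)] by auto
  have "module (R\<lparr>carrier := K\<rparr>) M"
    by (rule moduleI)
      (use K KR in \<open>auto simp: smult_l_distr smult_r_distr smult_assoc1 M.abelian_group_axioms
        intro: fieldE(1)\<close>)
  then show ?thesis using K by (simp add: vectorspace_def)
qed

context graded_module
begin

lemma twist_subset: "x \<in> twist M G e j \<Longrightarrow> x \<in> carrier M"
  and twist_zero: "\<zero>\<^bsub>M\<^esub> \<in> twist M G e j"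
  and twist_add: "x \<in> twist M G e j \<Longrightarrow> y \<in> twist M G e j \<Longrightarrow> x \<oplus>\<^bsub>M\<^esub> y \<in> twist M G e j"
proof -
  interpret g: graded_group M G by (rule graded_group_M)
  show "x \<in> twist M G e j \<Longrightarrow> x \<in> carrier M" "\<zero>\<^bsub>M\<^esub> \<in> twist M G e j"
    "x \<in> twist M G e j \<Longrightarrow> y \<in> twist M G e j \<Longrightarrow> x \<oplus>\<^bsub>M\<^esub> y \<in> twist M G e j"
    using g.G_subset g.G_zero g.G_add by (auto simp: twist_def split: if_splits)
qed

lemma twist_finsum:
  "finite S \<Longrightarrow> (\<And>i. i \<in> S \<Longrightarrow> f i \<in> twist M G e j) \<Longrightarrow> finsum M f S \<in> twist M G e j"
proof (induct S rule: finite_induct)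
  case empty
  then show ?case by (simp add: twist_zero)
next
  case (insert i S)
  then have "f \<in> S \<rightarrow> carrier M" "f i \<in> carrier M" using twist_subset by blast+
  then have "finsum M f (insert i S) = f i \<oplus>\<^bsub>M\<^esub> finsum M f S" using insert(1,2) by simp
  then show ?case using insert by (simp add: twist_add)
qed

lemma twist_R_carrier: "a \<in> twist R A e d \<Longrightarrow> a \<in> carrier R"
proof -
  interpret r: graded_group R A by (rule graded_group_R)
  show "a \<in> twist R A e d \<Longrightarrow> a \<in> carrier R" using r.G_subset by (auto simp: twist_def split: if_splits)
qed

text \<open>A nonzero \<open>a\<close> has degree \<open>d - e\<close>, exactly the shift between
  degree \<open>j\<close> of M(-d) and degree \<open>j\<close> of M(-e). If the inequalities between
  \<open>e\<close>, \<open>d\<close> and \<open>j\<close> fail, one of the factors is zero.\<close>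

lemma twist_smult:
  assumes "a \<in> twist R A e d" "x \<in> twist M G d j"
  shows "a \<odot>\<^bsub>M\<^esub> x \<in> twist M G e j"
proof (cases "e \<le> d \<and> d \<le> j")
  case True
  then have "a \<odot>\<^bsub>M\<^esub> x \<in> G ((d - e) + (j - d))" using assms by (intro smult_degree) (auto simp: twist_def)
  then show ?thesis using True by (simp add: twist_def)
next
  case False
  then have "a \<odot>\<^bsub>M\<^esub> x = \<zero>\<^bsub>M\<^esub>"
    using assms twist_subset[OF assms(2)] twist_R_carrier[OF assms(1)]
    by (auto simp: twist_def split: if_splits)
  then show ?thesis by (simp add: twist_zero)
qed

lemma matrix_map_homogeneous:
  assumes "\<And>r c. r < m \<Longrightarrow> c < n \<Longrightarrow> \<phi> r c \<in> twist R A (e r) (d c)"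
    and "x \<in> power_grading d n j"
  shows "matrix_map M m n \<phi> x \<in> power_grading e m j"
  unfolding power_grading_def matrix_map_def
  by (rule restrict_PiE_iff[THEN iffD2])
    (use assms in \<open>auto simp: power_grading_def intro!: twist_finsum intro: twist_smult\<close>)

lemma graded_group_power: "graded_group (power_module M n) (power_grading d n)"
  by (rule power_graded(1))

lemma power_comp_matrix_map:
  assumes \<phi>: "\<And>r c. r < m \<Longrightarrow> c < n \<Longrightarrow> \<phi> r c \<in> twist R A (e r) (d c)"
    and x: "x \<in> carrier (power_module M n)"
  shows "power_comp e m j (matrix_map M m n \<phi> x) = matrix_map M m n \<phi> (power_comp d n j x)"
proof -
  have ls: "linear_scalar R M (\<phi> r c)" if "r < m" "c < n" for r c
    using linear_scalar_carrier twist_R_carrier \<phi> that by metis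
  have "hom_component (power_module M m) (power_grading e m) j (matrix_map M m n \<phi> x) =
      matrix_map M m n \<phi> (hom_component (power_module M n) (power_grading d n) j x)"
    by (rule graded_hom_comp[OF graded_group_power graded_group_power matrix_map_additive _ x])
      (use ls matrix_map_homogeneous[of m n \<phi> e d, OF \<phi>] in auto)
  then show ?thesis
    using power_graded(2)[OF x, of d j] power_graded(2)[OF matrix_map_closed[of m n \<phi>, OF ls x], of e j] by simp
qed

end

section \<open>Construction of a resolution of the residue field\<close>

context standard_graded_algebra
begin

lemma self_module_simps:
  "carrier (self_module R) = carrier R" "\<zero>\<^bsub>self_module R\<^esub> = \<zero>"
  "x \<oplus>\<^bsub>self_module R\<^esub> y = x \<oplus> y" "a \<odot>\<^bsub>self_module R\<^esub> x = a \<otimes> x"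
  by (simp_all add: self_module_def)

lemma add_monoid_self_module: "subgroup X (add_monoid (self_module R)) \<longleftrightarrow> subgroup X (add_monoid R)"
  by (simp add: subgroup_def self_module_simps m_inv_def)

lemma finsum_self_module: "finsum (self_module R) f S = finsum R f S"
  by (simp add: finsum_def finprod_def self_module_def)

lemma is_decomposition_self_module: "is_decomposition (self_module R) = is_decomposition R"
  by (intro ext) (simp add: is_decomposition_def self_module_simps finsum_self_module)

lemma hom_component_self_module: "hom_component (self_module R) A = hom_component R A"
  by (intro ext) (simp add: hom_component_def is_decomposition_self_module)

lemma module_self_module: "module R (self_module R)"
proof (rule moduleI)
  show "abelian_group (self_module R)"
    by (rule abelian_groupI) (auto simp: self_module_simps a_ac intro: bexI[of _ "\<ominus> x" for x] l_neg)
qed (auto simp: self_module_simps l_distr r_distr m_assoc is_cring)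

lemma graded_module_self: "graded_module R A (self_module R) A"
proof (intro graded_module.intro graded_module_axioms.intro)
  show "standard_graded_algebra R A" ..
  show "module R (self_module R)" by (rule module_self_module)
  show "internal_direct_sum (self_module R) A"
    using direct_sum unfolding internal_direct_sum_def add_monoid_self_module
    by (simp add: is_decomposition_self_module self_module_simps)
qed (simp add: self_module_simps mult_degree)

definition unit_vector :: "nat \<Rightarrow> nat \<Rightarrow> nat \<Rightarrow> 'a" where
  "unit_vector n c = (\<lambda>l\<in>{..<n}. if l = c then \<one> else \<zero>)"

lemma unit_vector_carrier: "unit_vector n c \<in> carrier (power_module (self_module R) n)"
  by (auto simp: unit_vector_def power_module_simps self_module_simps)

lemma unit_vector_span:
  assumes x: "x \<in> carrier (power_module (self_module R) n)"
  shows "x \<in> tspan (power_module (self_module R) n) (carrier R) (unit_vector n ` {..<n})"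
proof -
  let ?P = "power_module (self_module R) n"
  let ?T = "tspan ?P (carrier R) (unit_vector n ` {..<n})"
  have xR: "l < n \<Longrightarrow> x l \<in> carrier R" for l using power_module_memD[OF x] by (simp add: self_module_simps)
  show ?thesis
  proof (rule power_module_mem_imp[OF module_self_module x tspan_zero tspan_add])
    fix m assume m: "m < n"
    have "(\<lambda>l\<in>{..<n}. if l = m then x m else \<zero>\<^bsub>self_module R\<^esub>) = x m \<odot>\<^bsub>?P\<^esub> unit_vector n m"
      using xR m by (auto simp: unit_vector_def power_module_simps self_module_simps intro!: restrict_ext)
    moreover have "x m \<odot>\<^bsub>?P\<^esub> unit_vector n m \<in> ?T"
      using xR m by (intro tspan_smult tspan_base) auto
    ultimately show "(\<lambda>l\<in>{..<n}. if l = m then x m else \<zero>\<^bsub>self_module R\<^esub>) \<in> ?T" by simp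
  qed
qed

lemma matrix_map_unit_vector:
  assumes "\<And>r c. r < m \<Longrightarrow> c < n \<Longrightarrow> \<phi> r c \<in> carrier R" "c < n"
  shows "matrix_map (self_module R) m n \<phi> (unit_vector n c) = (\<lambda>r\<in>{..<m}. \<phi> r c)"
  unfolding matrix_map_def
proof (rule restrict_ext)
  fix r assume r: "r \<in> {..<m}"
  have "(\<Oplus>\<^bsub>self_module R\<^esub>k\<in>{..<n}. \<phi> r k \<odot>\<^bsub>self_module R\<^esub> unit_vector n c k) =
      (\<Oplus>k\<in>{..<n}. if c = k then \<phi> r k else \<zero>)"
    unfolding finsum_self_module self_module_simps
    by (rule finsum_cong') (use assms r in \<open>auto simp: unit_vector_def\<close>)
  also have "\<dots> = \<phi> r c" by (rule finsum_singleton) (use assms r in auto)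
  finally show "(\<Oplus>\<^bsub>self_module R\<^esub>k\<in>{..<n}. \<phi> r k \<odot>\<^bsub>self_module R\<^esub> unit_vector n c k) = \<phi> r c" .
qed

abbreviation "R_comp \<equiv> graded_module.power_comp (self_module R) A"
abbreviation "R_grading \<equiv> graded_module.power_grading (self_module R) A"

text \<open>A finite generating set exists by the Noetherian property. Since \<open>N\<close> is
  graded, the homogeneous components of the generators stay in \<open>N\<close>; they still generate
  and become the columns of the matrix.\<close>

lemma homogeneous_presentation:
  assumes N: "tclosed (power_module (self_module R) m) (carrier R) N"
    and gr: "\<And>x j. x \<in> N \<Longrightarrow> R_comp d m j x \<in> N"
  shows "\<exists>n d' \<phi>. (\<forall>r<m. \<forall>c<n. \<phi> r c \<in> twist R A (d r) (d' c)) \<and>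
    matrix_map (self_module R) m n \<phi> ` carrier (power_module (self_module R) n) = N"
proof -
  let ?S = "self_module R" and ?P = "power_module (self_module R) m"
  interpret S: graded_module R A ?S A by (rule graded_module_self)
  interpret P: module R ?P by (rule module_power_module[OF module_self_module])
  interpret g: graded_group ?P "R_grading d m" by (rule S.graded_group_power)
  obtain F where F: "finite F" "F \<subseteq> A 1" "generate_ring R (A 0 \<union> F) = carrier R"
    using generated_in_degree_1 by blast
  have FR: "F \<subseteq> carrier R" using F(2) graded_group.G_subset[OF S.graded_group_R] by blast
  have NP: "N \<subseteq> carrier ?P" using tclosedD(1)[OF N] .
  have "N \<subseteq> tspan ?P (carrier R) (unit_vector m ` {..<m})" using unit_vector_span NP by blast
  then obtain Q where Q: "finite Q" "Q \<subseteq> N" "N = tspan ?P (carrier R) Q"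
    using P.submodule_finitely_generated[OF ground_field F(1) FR F(3) _ _ N, of "unit_vector m ` {..<m}"]
      unit_vector_carrier by blast
  \<comment> \<open>Zero components are dropped, which makes the set finite.\<close>
  define Q' where "Q' = (\<Union>q\<in>Q. (\<lambda>j. R_comp d m j q) ` {j. R_comp d m j q \<noteq> \<zero>\<^bsub>?P\<^esub>})"
  have comp: "hom_component ?P (R_grading d m) j q = R_comp d m j q" if "q \<in> N" for j q
    using S.power_graded(2)[of q m d j] that NP by blast
  have "finite {j. R_comp d m j q \<noteq> \<zero>\<^bsub>?P\<^esub>}" if "q \<in> Q" for q
    using g.finite_comp[of q] comp[of q] that Q(2) NP by (simp add: subset_iff)
  then have finQ': "finite Q'" unfolding Q'_def using Q(1) by blast
  have Q'N: "Q' \<subseteq> N" using gr Q(2) by (auto simp: Q'_def)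
  have homQ': "\<exists>j. q \<in> R_grading d m j" if q': "q \<in> Q'" for q
  proof -
    obtain p j where p: "p \<in> Q" "q = R_comp d m j p" using q' by (auto simp: Q'_def)
    then have "q = hom_component ?P (R_grading d m) j p" using comp[of p j] Q(2) by auto
    then show ?thesis using g.comp_in[of p j] p(1) Q(2) NP by blast
  qed
  have QQ': "Q \<subseteq> tspan ?P (carrier R) Q'"
  proof
    fix q assume q: "q \<in> Q"
    then have qP: "q \<in> carrier ?P" using Q(2) NP by auto
    show "q \<in> tspan ?P (carrier R) Q'"
    proof (rule g.comp_mem_imp[OF qP tspan_zero tspan_add])
      fix j
      show "hom_component ?P (R_grading d m) j q \<in> tspan ?P (carrier R) Q'"
      proof (cases "R_comp d m j q = \<zero>\<^bsub>?P\<^esub>")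
        case True
        then show ?thesis using comp[of q j] q Q(2) tspan_zero[of ?P] by auto
      next
        case False
        then have "R_comp d m j q \<in> Q'" using q by (auto simp: Q'_def)
        then show ?thesis using comp[of q j] q Q(2) tspan_base[of _ Q' ?P] by auto
      qed
    qed
  qed
  have NQ': "N \<subseteq> tspan ?P (carrier R) Q'"
    unfolding Q(3) using tspan_trans[OF _ QQ' order_refl] by blast
  obtain h where h: "bij_betw h {0..<card Q'} Q'" using ex_bij_betw_nat_finite[OF finQ'] by blast
  define n where "n = card Q'"
  have hQ: "h c \<in> Q'" if "c < n" for c using h that by (auto simp: bij_betw_def n_def)
  have hQ2: "\<exists>c<n. q = h c" if "q \<in> Q'" for q using h that by (force simp: bij_betw_def n_def)
  have "\<forall>c\<in>{..<n}. \<exists>j. h c \<in> R_grading d m j" using homQ' hQ by blast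
  then obtain d' where d': "\<And>c. c < n \<Longrightarrow> h c \<in> R_grading d m (d' c)" unfolding bchoice_iff by blast
  \<comment> \<open>Column \<open>c\<close> is the generator \<open>h c\<close>, of degree
    \<open>d' c\<close>; its entry in row \<open>r\<close> therefore lies in the twist by
    \<open>d r\<close>.\<close>
  define \<phi> where "\<phi> r c = h c r" for r c :: nat
  have \<phi>: "\<phi> r c \<in> twist R A (d r) (d' c)" if "r < m" "c < n" for r c
  proof -
    have "\<phi> r c \<in> twist ?S A (d r) (d' c)" using d'[OF that(2)] that(1) by (auto simp: \<phi>_def S.power_grading_def)
    then show ?thesis by (simp add: twist_def self_module_simps split: if_splits)
  qed
  have \<phi>R: "r < m \<Longrightarrow> c < n \<Longrightarrow> \<phi> r c \<in> carrier R" for r c using \<phi> S.twist_R_carrier by blast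
  have ls: "r < m \<Longrightarrow> c < n \<Longrightarrow> linear_scalar R ?S (\<phi> r c)" for r c using S.linear_scalar_carrier \<phi>R by blast
  have uv: "matrix_map ?S m n \<phi> (unit_vector n c) = h c" if "c < n" for c
  proof (rule power_module_eqI)
    show "h c \<in> carrier ?P" using hQ[OF that] Q'N NP by auto
    show "matrix_map ?S m n \<phi> (unit_vector n c) \<in> carrier ?P"
      by (rule S.matrix_map_closed[OF ls unit_vector_carrier])
    fix l assume "l < m"
    then show "matrix_map ?S m n \<phi> (unit_vector n c) l = h c l"
      using matrix_map_unit_vector[of m n \<phi> c] \<phi>R that by (simp add: \<phi>_def)
  qed
  have "matrix_map ?S m n \<phi> x \<in> N" if "x \<in> carrier (power_module ?S n)" for x
  proof -
    interpret Pn: module R "power_module ?S n" by (rule module_power_module[OF module_self_module])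
    have "x \<in> {x \<in> carrier (power_module ?S n). matrix_map ?S m n \<phi> x \<in> N}"
    proof (rule subsetD[OF tspan_subset unit_vector_span[OF that]])
      show "unit_vector n ` {..<n} \<subseteq> {x \<in> carrier (power_module ?S n). matrix_map ?S m n \<phi> x \<in> N}"
        using uv hQ Q'N unit_vector_carrier by auto
      have "matrix_map ?S m n \<phi> \<zero>\<^bsub>power_module ?S n\<^esub> = \<zero>\<^bsub>?P\<^esub>"
        by (rule additive_map_zero[OF Pn.abelian_group_axioms P.abelian_group_axioms S.matrix_map_additive])
          (rule ls)
      then show "tclosed (power_module ?S n) (carrier R) {x \<in> carrier (power_module ?S n). matrix_map ?S m n \<phi> x \<in> N}"
        using tclosedD(2-4)[OF N]
        by (intro tclosedI) (auto simp: S.matrix_map_add[of m n \<phi>, OF ls] S.matrix_map_smult[of m n \<phi>, OF ls])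
    qed
    then show ?thesis by simp
  qed
  moreover have "N \<subseteq> matrix_map ?S m n \<phi> ` carrier (power_module ?S n)"
  proof (rule order_trans[OF NQ' tspan_subset])
    show "tclosed ?P (carrier R) (matrix_map ?S m n \<phi> ` carrier (power_module ?S n))"
      by (rule S.tclosed_matrix_map_image[of m n \<phi>, OF ls])
    show "Q' \<subseteq> matrix_map ?S m n \<phi> ` carrier (power_module ?S n)"
    proof
      fix q assume "q \<in> Q'"
      then obtain c where "c < n" "q = h c" using hQ2 by blast
      then show "q \<in> matrix_map ?S m n \<phi> ` carrier (power_module ?S n)"
        using uv[of c] unit_vector_carrier by (metis imageI)
    qed
  qed
  ultimately have "matrix_map ?S m n \<phi> ` carrier (power_module ?S n) = N" by blast
  then show ?thesis using \<phi> by blast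
qed

lemma graded_group_self: "graded_group R A"
  by (rule graded_module.graded_group_R[OF graded_module_self])

lemma A_subset: "a \<in> A i \<Longrightarrow> a \<in> carrier R"
  using graded_group.G_subset[OF graded_group_self] .

text \<open>On homogeneous factors of degrees \<open>i\<close> and \<open>j\<close> the product has
  degree zero only if both degrees are zero; the rest is bilinearity. It follows that the irrelevant
  ideal absorbs multiplication by \<open>R\<close>.\<close>

lemma hom_component_0_mult:
  assumes "x \<in> carrier R" "y \<in> carrier R"
  shows "hom_component R A 0 (x \<otimes> y) = hom_component R A 0 x \<otimes> hom_component R A 0 y"
proof -
  interpret r: graded_group R A by (rule graded_group_self)
  show ?thesis
    using assms
  proof (induct x rule: r.graded_induct)
    case zero
    then show ?case by (simp add: r.comp_zero r.comp_carrier)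
  next
    case (add x z)
    then show ?case by (simp add: l_distr r.comp_add r.comp_carrier)
  next
    case (hom i x)
    have xR: "x \<in> carrier R" using hom(1) by (rule A_subset)
    show ?case
      using hom(2)
    proof (induct y rule: r.graded_induct)
      case zero
      then show ?case using xR by (simp add: r.comp_zero r.comp_carrier)
    next
      case (add y z)
      then show ?case using xR by (simp add: r_distr r.comp_add r.comp_carrier)
    next
      case (hom j y)
      have "y \<in> carrier R" using hom by (rule A_subset)
      then show ?case
        using r.comp_hom[OF mult_degree[OF \<open>x \<in> A i\<close> hom], of 0] r.comp_hom[OF \<open>x \<in> A i\<close>, of 0]
          r.comp_hom[OF hom, of 0] xR by auto
    qed
  qed
qed

lemma tclosed_irrelevant_ideal: "tclosed (self_module R) (carrier R) (irrelevant_ideal R A)"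
proof -
  interpret r: graded_group R A by (rule graded_group_self)
  show ?thesis
    by (rule tclosedI)
      (auto simp: irrelevant_ideal_def self_module_simps r.comp_zero r.comp_add hom_component_0_mult r.comp_carrier)
qed

lemma vectorspace_self: "vectorspace (R\<lparr>carrier := A 0\<rparr>) (self_module R)"
  by (rule vectorspace_restrict_scalars[OF module_self_module ground_field])

lemma tclosed_irrelevant_ideal_0: "tclosed (self_module R) (carrier (R\<lparr>carrier := A 0\<rparr>)) (irrelevant_ideal R A)"
  using tclosed_irrelevant_ideal A_subset by (auto simp: tclosed_def)

lemma vectorspace_residue_module: "vectorspace (R\<lparr>carrier := A 0\<rparr>) (residue_module R A)"
  unfolding residue_module_def
proof (rule vectorspace.vectorspace_subquotient[OF vectorspace_self _ tclosed_irrelevant_ideal_0])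
  show "tclosed (self_module R) (carrier (R\<lparr>carrier := A 0\<rparr>)) (carrier R)"
    using A_subset by (auto simp: tclosed_def self_module_simps)
qed

lemma residue_smult_one:
  assumes a: "a \<in> carrier R"
  shows "a \<odot>\<^bsub>residue_module R A\<^esub> (irrelevant_ideal R A +>\<^bsub>self_module R\<^esub> \<one>) = irrelevant_ideal R A +>\<^bsub>self_module R\<^esub> a"
proof -
  note I = tclosedD[OF tclosed_irrelevant_ideal, unfolded self_module_simps]
  have "irrelevant_ideal R A <+>\<^bsub>self_module R\<^esub> (\<lambda>x. a \<odot>\<^bsub>self_module R\<^esub> x) ` (irrelevant_ideal R A +>\<^bsub>self_module R\<^esub> \<one>)
      = irrelevant_ideal R A +>\<^bsub>self_module R\<^esub> (a \<odot>\<^bsub>self_module R\<^esub> \<one>)"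
    by (rule coset_smult_image[OF vectorspace_self tclosed_irrelevant_ideal_0])
      (use a I in \<open>auto simp: self_module_simps r_distr subset_iff\<close>)
  then show ?thesis using a by (simp add: residue_module_def subquotient_def self_module_simps)
qed

lemma residue_augmentation:
  assumes "x \<in> carrier (power_module (self_module R) 1)"
  shows "(\<Oplus>\<^bsub>residue_module R A\<^esub>l\<in>{..<1::nat}. x l \<odot>\<^bsub>residue_module R A\<^esub> (irrelevant_ideal R A +>\<^bsub>self_module R\<^esub> \<one>))
    = irrelevant_ideal R A +>\<^bsub>self_module R\<^esub> x 0"
proof -
  interpret B: vectorspace "R\<lparr>carrier := A 0\<rparr>" "residue_module R A" by (rule vectorspace_residue_module)
  have x0: "x 0 \<in> carrier R" using power_module_memD[OF assms, of 0] by (simp add: self_module_simps)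
  have c: "irrelevant_ideal R A +>\<^bsub>self_module R\<^esub> x 0 \<in> carrier (residue_module R A)"
    using x0 by (auto simp: residue_module_def subquotient_def)
  have "{..<1::nat} = {0}" by auto
  then show ?thesis using c residue_smult_one[OF x0] by simp
qed

text \<open>A state consists of a rank, the generator degrees and a graded submodule
  \<open>N\<close> of that free module. A step covers \<open>N\<close> by a homogeneous matrix and
  passes to the kernel of that matrix, so exactness is built into the transition.\<close>

theorem graded_free_resolution_exists:
  "\<exists>F. graded_free_resolution R A (residue_module R A) (residue_grading R A) F"
proof -
  let ?S = "self_module R" and ?I = "irrelevant_ideal R A" and ?B = "residue_module R A"
  interpret S: graded_module R A ?S A by (rule graded_module_self)
  interpret r: graded_group R A by (rule graded_group_self)
  interpret V: vectorspace "R\<lparr>carrier := A 0\<rparr>" ?S by (rule vectorspace_self)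
  define valid where "valid = (\<lambda>(m, d, N). tclosed (power_module ?S m) (carrier R) N \<and>
    (\<forall>x\<in>N. \<forall>j. R_comp d m j x \<in> N))"
  define step where "step = (\<lambda>(m, d, N) (n, d', N') \<phi>.
    (\<forall>r<m. \<forall>c<n. \<phi> r c \<in> twist R A (d r) (d' c)) \<and>
    matrix_map ?S m n \<phi> ` carrier (power_module ?S n) = N \<and>
    N' = {x \<in> carrier (power_module ?S n). matrix_map ?S m n \<phi> x = \<zero>\<^bsub>power_module ?S m\<^esub>})"
  \<comment> \<open>The start: the kernel of the augmentation from \<open>R\<close>, viewed as a
    free module of rank one generated in degree zero.\<close>
  define N0 where "N0 = {x \<in> carrier (power_module ?S 1). x 0 \<in> ?I}"
  have "valid (1, \<lambda>_. 0, N0)"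
  proof -
    note I = tclosedD[OF tclosed_irrelevant_ideal, unfolded self_module_simps]
    interpret P: module R "power_module ?S 1" by (rule module_power_module[OF module_self_module])
    have "tclosed (power_module ?S 1) (carrier R) N0"
      unfolding N0_def by (rule tclosedI) (use I in \<open>auto simp: power_module_simps self_module_simps\<close>)
    moreover have "R_comp (\<lambda>_. 0) 1 j x \<in> N0" if x: "x \<in> N0" for x j
    proof -
      have xc: "x \<in> carrier (power_module ?S 1)" and xI: "x 0 \<in> ?I" using x by (auto simp: N0_def)
      have x0: "x 0 \<in> carrier R" using xI by (simp add: irrelevant_ideal_def)
      have "R_comp (\<lambda>_. 0) 1 j x \<in> carrier (power_module ?S 1)"
        using graded_group.comp_carrier[OF S.graded_group_power xc] S.power_graded(2)[OF xc] by metis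
      moreover have "R_comp (\<lambda>_. 0) 1 j x 0 = hom_component R A j (x 0)"
        by (simp add: S.power_comp_def hom_component_self_module)
      moreover have "hom_component R A j (x 0) \<in> ?I"
        using xI x0 r.comp_hom[OF r.comp_in[OF x0], of 0 j] r.comp_carrier[OF x0]
        by (auto simp: irrelevant_ideal_def)
      ultimately show ?thesis by (simp add: N0_def)
    qed
    ultimately show ?thesis by (simp add: valid_def)
  qed
  moreover have "\<exists>t. valid t \<and> (\<exists>\<phi>. step s t \<phi>)" if "valid s" for s
  proof -
    obtain m d N where s: "s = (m, d, N)" by (cases s)
    have N: "tclosed (power_module ?S m) (carrier R) N" "\<And>x j. x \<in> N \<Longrightarrow> R_comp d m j x \<in> N"
      using that by (auto simp: s valid_def)
    obtain n d' \<phi> where \<phi>: "\<forall>r<m. \<forall>c<n. \<phi> r c \<in> twist R A (d r) (d' c)"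
      "matrix_map ?S m n \<phi> ` carrier (power_module ?S n) = N"
      using homogeneous_presentation[OF N] by blast
    have \<phi>1: "r < m \<Longrightarrow> c < n \<Longrightarrow> \<phi> r c \<in> twist R A (d r) (d' c)" for r c using \<phi>(1) by blast
    have ls: "r < m \<Longrightarrow> c < n \<Longrightarrow> linear_scalar R ?S (\<phi> r c)" for r c
      using S.linear_scalar_carrier S.twist_R_carrier \<phi>1 by blast
    define N' where "N' = {x \<in> carrier (power_module ?S n). matrix_map ?S m n \<phi> x = \<zero>\<^bsub>power_module ?S m\<^esub>}"
    have "tclosed (power_module ?S n) (carrier R) N'"
      unfolding N'_def by (rule S.tclosed_matrix_map_kernel[of m n \<phi>, OF ls])
    moreover have "R_comp d' n j x \<in> N'" if x: "x \<in> N'" for x j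
    proof -
      have xc: "x \<in> carrier (power_module ?S n)" and x0: "matrix_map ?S m n \<phi> x = \<zero>\<^bsub>power_module ?S m\<^esub>"
        using x by (auto simp: N'_def)
      interpret Pm: module R "power_module ?S m" by (rule module_power_module[OF module_self_module])
      have "R_comp d' n j x \<in> carrier (power_module ?S n)"
        using graded_group.comp_carrier[OF S.graded_group_power xc] S.power_graded(2)[OF xc] by metis
      moreover have "matrix_map ?S m n \<phi> (R_comp d' n j x) = R_comp d m j \<zero>\<^bsub>power_module ?S m\<^esub>"
        using S.power_comp_matrix_map[of m n \<phi> d d' x j, OF \<phi>1 xc] x0 by simp
      moreover have "R_comp d m j \<zero>\<^bsub>power_module ?S m\<^esub> = \<zero>\<^bsub>power_module ?S m\<^esub>"
        using graded_group.comp_zero[OF S.graded_group_power] S.power_graded(2)[OF Pm.M.zero_closed] by metis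
      ultimately show ?thesis by (simp add: N'_def)
    qed
    ultimately have "valid (n, d', N')" by (simp add: valid_def)
    moreover have "step s (n, d', N') \<phi>" using \<phi> by (simp add: step_def s N'_def)
    ultimately show ?thesis by blast
  qed
  \<comment> \<open>Dependent choice: each state depends on the kernel produced by the preceding
    one.\<close>
  ultimately have "\<exists>f. \<forall>i. (valid (f i) \<and> (i = 0 \<longrightarrow> f i = (1, \<lambda>_. 0, N0))) \<and> (\<exists>\<phi>. step (f i) (f (Suc i)) \<phi>)"
    by (intro dependent_nat_choice) simp_all
  then obtain f where f: "\<forall>i. (valid (f i) \<and> (i = 0 \<longrightarrow> f i = (1, \<lambda>_. 0, N0))) \<and> (\<exists>\<phi>. step (f i) (f (Suc i)) \<phi>)" ..
  then have f0: "f 0 = (1, \<lambda>_. 0, N0)" by simp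
  from f have "\<forall>i. \<exists>\<phi>. step (f i) (f (Suc i)) \<phi>" by simp
  then obtain \<phi> where \<phi>: "\<And>i. step (f i) (f (Suc i)) (\<phi> i)" unfolding choice_iff by blast
  define F :: "('a, 'a set) free_res" where
    "F = \<lparr>rk = (\<lambda>i. fst (f i)), gen_deg = (\<lambda>i. fst (snd (f i))), dmat = \<phi>,
      aug = (\<lambda>_. ?I +>\<^bsub>?S\<^esub> \<one>)\<rparr>"
  define K where "K i = snd (snd (f i))" for i
  have dm: "dmat F = \<phi>" by (simp add: F_def)
  have feq: "f i = (rk F i, gen_deg F i, K i)" for i by (simp add: F_def K_def)
  have st: "step (rk F i, gen_deg F i, K i) (rk F (Suc i), gen_deg F (Suc i), K (Suc i)) (dmat F i)" for i
    using \<phi>[of i, unfolded feq] dm by simp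
  have rk0: "rk F 0 = 1" and d0: "gen_deg F 0 = (\<lambda>_. 0)" and K0: "K 0 = N0"
    using f0 by (auto simp: F_def K_def)
  have "graded_free_resolution R A ?B (residue_grading R A) F"
    unfolding graded_free_resolution_def Let_def
  proof (intro conjI allI impI)
    fix l assume "l < rk F 0"
    have "?I +>\<^bsub>?S\<^esub> \<one> \<in> carrier ?B" by (auto simp: residue_module_def subquotient_def)
    then show "aug F l \<in> residue_grading R A (gen_deg F 0 l)"
      by (simp add: residue_grading_def d0) (simp add: F_def)
  next
    fix i r c assume "r < rk F i" "c < rk F (Suc i)"
    then show "dmat F i r c \<in> twist R A (gen_deg F i r) (gen_deg F (Suc i) c)"
      using st[of i] by (simp add: step_def)
  next
    have aug: "aug F l = ?I +>\<^bsub>?S\<^esub> \<one>" for l by (simp add: F_def)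
    have surj: "\<exists>x\<in>carrier (power_module ?S 1). x 0 = a" if "a \<in> carrier R" for a
      by (rule bexI[of _ "\<lambda>l\<in>{..<1}. a"]) (use that in \<open>auto simp: power_module_simps self_module_simps\<close>)
    have mem: "x 0 \<in> carrier R" if "x \<in> carrier (power_module ?S 1)" for x
      using power_module_memD[OF that, of 0] by (simp add: self_module_simps)
    have "(\<lambda>x. \<Oplus>\<^bsub>?B\<^esub>l\<in>{..<1::nat}. x l \<odot>\<^bsub>?B\<^esub> (?I +>\<^bsub>?S\<^esub> \<one>)) ` carrier (power_module ?S 1) =
        (\<lambda>x. ?I +>\<^bsub>?S\<^esub> x 0) ` carrier (power_module ?S 1)"
      by (rule image_cong[OF refl residue_augmentation])
    also have "\<dots> = carrier ?B"
      using surj mem by (fastforce simp: residue_module_def subquotient_def)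
    finally show "(\<lambda>x. \<Oplus>\<^bsub>?B\<^esub>l\<in>{..<rk F 0}. x l \<odot>\<^bsub>?B\<^esub> aug F l) ` carrier (power_module ?S (rk F 0)) = carrier ?B"
      by (simp only: rk0 aug)
    have "?I +>\<^bsub>?S\<^esub> x 0 = \<zero>\<^bsub>?B\<^esub> \<longleftrightarrow> x 0 \<in> ?I" if "x \<in> carrier (power_module ?S 1)" for x
      using V.coset_eq_self_iff[OF tclosed_irrelevant_ideal_0] mem[OF that]
      by (simp add: residue_module_def subquotient_def self_module_simps)
    then have "{x \<in> carrier (power_module ?S 1). (\<Oplus>\<^bsub>?B\<^esub>l\<in>{..<1::nat}. x l \<odot>\<^bsub>?B\<^esub> (?I +>\<^bsub>?S\<^esub> \<one>)) = \<zero>\<^bsub>?B\<^esub>} = N0"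
      using residue_augmentation unfolding N0_def by auto
    then show "res_map ?S F 0 ` carrier (power_module ?S (rk F 1)) =
      {x \<in> carrier (power_module ?S (rk F 0)). (\<Oplus>\<^bsub>?B\<^esub>l\<in>{..<rk F 0}. x l \<odot>\<^bsub>?B\<^esub> aug F l) = \<zero>\<^bsub>?B\<^esub>}"
      using st[of 0] K0 by (simp add: step_def res_map_def rk0 aug)
  next
    fix i
    show "res_map ?S F (Suc i) ` carrier (power_module ?S (rk F (Suc (Suc i)))) =
      {x \<in> carrier (power_module ?S (rk F (Suc i))). res_map ?S F i x = \<zero>\<^bsub>power_module ?S (rk F i)\<^esub>}"
      using st[of i] st[of "Suc i"] by (simp add: step_def res_map_def)
  qed
  then show ?thesis by blast
qed

lemma chosen_resolution:
  "graded_free_resolution R A (residue_module R A) (residue_grading R A)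
    (chosen_resolution R A (residue_module R A) (residue_grading R A))"
  unfolding chosen_resolution_def by (rule someI_ex[OF graded_free_resolution_exists])

end

section \<open>Degrees and filtrations\<close>

context module
begin

lemma tclosed_imp_submodule: "tclosed M (carrier R) N \<Longrightarrow> submodule R N M"
  by (intro submodule.intro module_axioms) (auto simp: tclosed_def)

end

text \<open>Elements of some \<open>E i\<close> with \<open>i \<le> j\<close>, multiplied by
  \<open>j - i\<close> factors from \<open>F\<close>. These sets are finite when \<open>F\<close>
  and all \<open>E i\<close> are.\<close>

primrec degree_products ::
  "('a, 'b, 'm) module_scheme \<Rightarrow> 'a set \<Rightarrow> (nat \<Rightarrow> 'b set) \<Rightarrow> nat \<Rightarrow> 'b set" where
  "degree_products M F E 0 = E 0"
| "degree_products M F E (Suc j) = E (Suc j) \<union> (\<lambda>(s, y). s \<odot>\<^bsub>M\<^esub> y) ` (F \<times> degree_products M F E j)"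

context graded_module
begin

lemma A_0_one: "\<ominus> \<one> \<in> A 0" and A_0_subset: "A 0 \<subseteq> carrier R"
  using subfield_minus_one[OF ground_field] by auto

lemma comp_smult_0:
  assumes "c \<in> A 0" "x \<in> carrier M"
  shows "hom_component M G j (c \<odot>\<^bsub>M\<^esub> x) = c \<odot>\<^bsub>M\<^esub> hom_component M G j x"
proof (rule graded_hom_comp[OF graded_group_M graded_group_M _ _ assms(2)])
  show "additive_map M M (\<lambda>x. c \<odot>\<^bsub>M\<^esub> x)"
    using assms(1) A_0_subset by (auto simp: additive_map_def smult_r_distr)
  show "x \<in> G i \<Longrightarrow> c \<odot>\<^bsub>M\<^esub> x \<in> G i" for i x using smult_degree[OF assms(1), of x i] by simp
qed

text \<open>The span of all products over the ground field is closed under \<open>A 0\<close> and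
  \<open>F\<close>, hence under \<open>R\<close>, and so exhausts \<open>M\<close>. Taking the
  component of degree \<open>j\<close> removes every product of another degree.\<close>

lemma degree_span:
  assumes F: "F \<subseteq> A 1" "generate_ring R (A 0 \<union> F) = carrier R"
    and E: "\<And>j. E j \<subseteq> G j" "carrier M \<subseteq> tspan M (carrier R) (\<Union>j. E j)"
  shows "degree_products M F E j \<subseteq> G j" "G j \<subseteq> tspan M (A 0) (degree_products M F E j)"
proof -
  interpret g: graded_group M G by (rule graded_group_M)
  have FR: "F \<subseteq> carrier R" using F(1) A_subset by blast
  have DG: "degree_products M F E j \<subseteq> G j" for j
  proof (induct j)
    case (Suc j)
    have "s \<odot>\<^bsub>M\<^esub> y \<in> G (Suc j)" if "s \<in> F" "y \<in> degree_products M F E j" for s y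
      using smult_degree[of s 1 y j] that F(1) Suc by auto
    then show ?case using E(1)[of "Suc j"] by auto
  qed (use E in simp)
  then show "degree_products M F E j \<subseteq> G j" .
  let ?D = "\<Union>j. degree_products M F E j"
  have DM: "?D \<subseteq> carrier M" using DG g.G_subset by blast
  have AF: "A 0 \<union> F \<subseteq> carrier R" "\<ominus> \<one> \<in> A 0 \<union> F" using FR A_0_subset A_0_one by auto
  let ?X = "tspan M (A 0) ?D"
  have X: "tclosed M (A 0) ?X" by (rule tclosed_tspan[OF A_0_subset DM])
  have sX: "s \<odot>\<^bsub>M\<^esub> x \<in> ?X" if s: "s \<in> F" and x: "x \<in> ?X" for s x
    using x
  proof (induct rule: tspan.induct)
    case tspan_zero
    then show ?case using s FR tspan.tspan_zero[of M "A 0" ?D] by auto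
  next
    case (tspan_base x)
    then obtain j where "x \<in> degree_products M F E j" by blast
    then have "s \<odot>\<^bsub>M\<^esub> x \<in> degree_products M F E (Suc j)" using s by force
    then show ?case by (intro tspan.tspan_base) blast
  next
    case (tspan_add x y)
    then have "s \<odot>\<^bsub>M\<^esub> (x \<oplus>\<^bsub>M\<^esub> y) = s \<odot>\<^bsub>M\<^esub> x \<oplus>\<^bsub>M\<^esub> s \<odot>\<^bsub>M\<^esub> y"
      using s FR tclosedD(1)[OF X] by (intro smult_r_distr) auto
    then show ?case using tspan.tspan_add[OF tspan_add(2,4)] by simp
  next
    case (tspan_smult t x)
    have "x \<in> carrier M" "s \<in> carrier R" "t \<in> carrier R" using s FR A_0_subset tclosedD(1)[OF X] tspan_smult(1,2) by auto
    then have "s \<odot>\<^bsub>M\<^esub> (t \<odot>\<^bsub>M\<^esub> x) = t \<odot>\<^bsub>M\<^esub> (s \<odot>\<^bsub>M\<^esub> x)"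
      by (simp add: smult_assoc1[symmetric] m_comm)
    then show ?case using tspan.tspan_smult[OF tspan_smult(1,3)] by simp
  qed
  have "tclosed M (A 0 \<union> F) ?X" using X sX by (auto simp: tclosed_def)
  from tclosed_generate_ring[OF this AF] have XR: "tclosed M (carrier R) ?X" by (simp only: F(2))
  have "E j \<subseteq> degree_products M F E j" for j by (cases j) auto
  then have "(\<Union>j. E j) \<subseteq> ?X" using tspan_base[of _ ?D M "A 0"] by blast
  then have MX: "carrier M \<subseteq> ?X" using tspan_subset[OF XR] E(2) by blast
  show "G j \<subseteq> tspan M (A 0) (degree_products M F E j)"
  proof
    fix x assume x: "x \<in> G j"
    have "hom_component M G j z \<in> tspan M (A 0) (degree_products M F E j)" if "z \<in> ?X" for z
      using that
    proof (induct rule: tspan.induct)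
      case tspan_zero
      then show ?case by (simp add: g.comp_zero tspan.tspan_zero)
    next
      case (tspan_base y)
      then obtain i where i: "y \<in> degree_products M F E i" by blast
      then have "y \<in> G i" using DG by blast
      then show ?case using g.comp_hom[of y i j] i tspan.tspan_base tspan.tspan_zero by metis
    next
      case (tspan_add y z)
      then have "y \<in> carrier M" "z \<in> carrier M" using tclosedD(1)[OF X] by auto
      then show ?case using tspan.tspan_add[OF tspan_add(2,4)] by (simp add: g.comp_add)
    next
      case (tspan_smult t y)
      then have "y \<in> carrier M" using tclosedD(1)[OF X] by auto
      then show ?case using tspan.tspan_smult[OF tspan_smult(1,3)] by (simp add: comp_smult_0[OF tspan_smult(1)])
    qed
    then have "hom_component M G j x \<in> tspan M (A 0) (degree_products M F E j)"
      using MX g.G_subset[OF x] by blast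
    then show "x \<in> tspan M (A 0) (degree_products M F E j)" by (simp add: g.comp_hom[OF x])
  qed
qed

text \<open>Induction on the internal degree, available because the algebra is generated in degree
  one. It is applied to \<open>R\<close> to see how far homogeneous scalars raise the filtration,
  and to \<open>M\<close> to locate its degree parts in the filtration.\<close>

lemma degree_induct:
  assumes F: "F \<subseteq> A 1" "generate_ring R (A 0 \<union> F) = carrier R"
    and E: "\<And>j. E j \<subseteq> G j" "carrier M \<subseteq> tspan M (carrier R) (\<Union>j. E j)"
    and P: "\<And>j. tclosed M (A 0) (P j)" "\<And>j. E j \<subseteq> P j"
      "\<And>s j y. s \<in> A 1 \<Longrightarrow> y \<in> P j \<Longrightarrow> s \<odot>\<^bsub>M\<^esub> y \<in> P (Suc j)"
  shows "G j \<subseteq> P j"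
proof -
  have "degree_products M F E j \<subseteq> P j"
  proof (induct j)
    case (Suc j)
    have "s \<odot>\<^bsub>M\<^esub> y \<in> P (Suc j)" if "s \<in> F" "y \<in> degree_products M F E j" for s y
      using P(3)[of s y j] that F(1) Suc by auto
    then show ?case using P(2)[of "Suc j"] by auto
  qed (use P in simp)
  then show ?thesis using degree_span(2)[OF F E] tspan_subset[OF P(1)] by blast
qed

text \<open>The part of \<open>M\<close> in degrees at least \<open>n\<close>.\<close>

definition above :: "nat \<Rightarrow> 'b set" where
  "above n = {x \<in> carrier M. \<forall>j<n. hom_component M G j x = \<zero>\<^bsub>M\<^esub>}"

text \<open>By additivity in both arguments this reduces to homogeneous factors. The case
  \<open>e = 0\<close> makes \<open>above n\<close> a submodule, the case \<open>e = 1\<close>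
  concerns the irrelevant ideal.\<close>

lemma smult_above:
  assumes r: "r \<in> carrier R" "\<And>i. i < e \<Longrightarrow> hom_component R A i r = \<zero>" and x: "x \<in> above n"
  shows "r \<odot>\<^bsub>M\<^esub> x \<in> above (n + e)"
proof -
  interpret g: graded_group M G by (rule graded_group_M)
  interpret h: graded_group R A by (rule graded_group_R)
  have xM: "x \<in> carrier M" using x by (simp add: above_def)
  have ab: "\<zero>\<^bsub>M\<^esub> \<in> above k" "u \<in> above k \<Longrightarrow> v \<in> above k \<Longrightarrow> u \<oplus>\<^bsub>M\<^esub> v \<in> above k" for k u v
    by (auto simp: above_def g.comp_zero g.comp_add)
  have hom: "b \<odot>\<^bsub>M\<^esub> x \<in> above (n + e)" if b: "b \<in> A i" "e \<le> i" for b i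
  proof -
    have bR: "b \<in> carrier R" using b(1) A_subset by blast
    have "x \<in> {x \<in> carrier M. b \<odot>\<^bsub>M\<^esub> x \<in> above (n + e)}"
    proof (rule g.comp_mem_imp[OF xM])
      fix j
      have "b \<odot>\<^bsub>M\<^esub> hom_component M G j x \<in> above (n + e)"
      proof (cases "j < n")
        case True
        then show ?thesis using x bR ab by (simp add: above_def g.comp_zero)
      next
        case False
        have bx: "b \<odot>\<^bsub>M\<^esub> hom_component M G j x \<in> G (i + j)" using smult_degree[OF b(1) g.comp_in[OF xM]] .
        then show ?thesis using g.comp_hom[OF bx] g.G_subset[OF bx] False b(2) by (auto simp: above_def)
      qed
      then show "hom_component M G j x \<in> {x \<in> carrier M. b \<odot>\<^bsub>M\<^esub> x \<in> above (n + e)}"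
        using g.comp_carrier[OF xM] by simp
    qed (use ab bR in \<open>auto simp: smult_r_distr\<close>)
    then show ?thesis by simp
  qed
  have "r \<in> {r \<in> carrier R. r \<odot>\<^bsub>M\<^esub> x \<in> above (n + e)}"
  proof (rule h.comp_mem_imp[OF r(1)])
    fix i
    have "hom_component R A i r \<odot>\<^bsub>M\<^esub> x \<in> above (n + e)"
    proof (cases "i < e")
      case True
      then show ?thesis using r(2) xM ab by simp
    next
      case False
      then show ?thesis using hom[OF h.comp_in[OF r(1), of i]] by simp
    qed
    then show "hom_component R A i r \<in> {r \<in> carrier R. r \<odot>\<^bsub>M\<^esub> x \<in> above (n + e)}"
      using h.comp_carrier[OF r(1)] by simp
  qed (use ab xM in \<open>auto simp: smult_l_distr\<close>)
  then show ?thesis by simp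
qed

lemma tclosed_above: "tclosed M (carrier R) (above n)"
proof -
  interpret g: graded_group M G by (rule graded_group_M)
  show ?thesis
  proof (rule tclosedI)
    show "t \<odot>\<^bsub>M\<^esub> x \<in> above n" if "t \<in> carrier R" "x \<in> above n" for t x
      using smult_above[OF that(1) _ that(2), of 0] by simp
  qed (auto simp: above_def g.comp_zero g.comp_add)
qed

end

section \<open>Filtration steps against internal degrees\<close>

context stable_graded_filtration
begin

lemma tclosed_Fil: "tclosed M (carrier R) (Fil p)"
  using submoduleE(1,4,5)[OF Fil_submodule[of p]] subgroup.one_closed[OF Module.submodule.axioms(1)[OF Fil_submodule[of p]]]
  by (intro tclosedI) auto

lemma Fil_subset: "x \<in> Fil p \<Longrightarrow> x \<in> carrier M"
  and Fil_zero: "\<zero>\<^bsub>M\<^esub> \<in> Fil p"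
  and Fil_add: "x \<in> Fil p \<Longrightarrow> y \<in> Fil p \<Longrightarrow> x \<oplus>\<^bsub>M\<^esub> y \<in> Fil p"
  and Fil_smult: "a \<in> carrier R \<Longrightarrow> x \<in> Fil p \<Longrightarrow> a \<odot>\<^bsub>M\<^esub> x \<in> Fil p"
  using tclosedD[OF tclosed_Fil[of p]] by auto

lemma Fil_antimono: "p \<le> q \<Longrightarrow> Fil q \<subseteq> Fil p"
  by (rule lift_Suc_antimono_le[of Fil, OF Fil_descending])

lemma irrelevant_smult_Fil:
  assumes "a \<in> irrelevant_ideal R A" "x \<in> Fil p"
  shows "a \<odot>\<^bsub>M\<^esub> x \<in> Fil (Suc p)"
proof -
  have "{a \<odot>\<^bsub>M\<^esub> x | a x. a \<in> irrelevant_ideal R A \<and> x \<in> Fil p} \<subseteq> carrier M"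
    using Fil_subset by (auto simp: irrelevant_ideal_def)
  from in_own_span[OF this] have "a \<odot>\<^bsub>M\<^esub> x \<in> ideal_times R M (irrelevant_ideal R A) (Fil p)"
    using assms unfolding ideal_times_def by blast
  then show ?thesis using Fil_mult by blast
qed

lemma A_1_irrelevant: "a \<in> A 1 \<Longrightarrow> a \<in> irrelevant_ideal R A"
  using graded_group.comp_hom[OF graded_group_R, of a 1 0] A_subset by (auto simp: irrelevant_ideal_def)

text \<open>\<open>A e\<close> is spanned over \<open>A 0\<close> by products of \<open>e\<close>
  elements of degree one, and each factor raises the filtration by one step.\<close>

lemma degree_smult_Fil:
  assumes "a \<in> A e" "x \<in> Fil p"
  shows "a \<odot>\<^bsub>M\<^esub> x \<in> Fil (p + e)"
proof -
  interpret S: graded_module R A "self_module R" A by (rule graded_module_self)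
  obtain F where F: "F \<subseteq> A 1" "generate_ring R (A 0 \<union> F) = carrier R"
    using generated_in_degree_1 by blast
  \<comment> \<open>\<open>R\<close> as a module over itself is generated by one element, in degree
    zero.\<close>
  define E where "E j = (if j = 0 then {\<one>} else {})" for j :: nat
  define P where "P e = {a \<in> carrier R. \<forall>p. \<forall>x\<in>Fil p. a \<odot>\<^bsub>M\<^esub> x \<in> Fil (p + e)}" for e
  have "A e \<subseteq> P e"
  proof (rule S.degree_induct[OF F])
    show "E j \<subseteq> A j" for j using subfield_minus_one(4)[OF ground_field] by (simp add: E_def)
    have "a \<in> tspan (self_module R) (carrier R) (\<Union>j. E j)" if a: "a \<in> carrier R" for a
    proof -
      have "\<one> \<in> tspan (self_module R) (carrier R) (\<Union>j. E j)" by (rule tspan_base) (auto simp: E_def)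
      from tspan_smult[OF a this] show ?thesis using a by (simp add: self_module_simps)
    qed
    then show "carrier (self_module R) \<subseteq> tspan (self_module R) (carrier R) (\<Union>j. E j)"
      by (auto simp: self_module_simps)
    show "tclosed (self_module R) (A 0) (P j)" for j
    proof (rule tclosedI)
      fix t x assume "t \<in> A 0" "x \<in> P j"
      then show "t \<odot>\<^bsub>self_module R\<^esub> x \<in> P j"
        by (auto simp: P_def self_module_simps smult_assoc1 Fil_subset subsetD[OF A_0_subset] intro: Fil_smult)
    next
      fix x y assume "x \<in> P j" "y \<in> P j"
      then show "x \<oplus>\<^bsub>self_module R\<^esub> y \<in> P j"
        by (auto simp: P_def self_module_simps smult_l_distr Fil_subset intro: Fil_add)
    qed (auto simp: P_def self_module_simps Fil_subset intro: Fil_zero)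
    show "E j \<subseteq> P j" for j by (auto simp: E_def P_def Fil_subset)
    show "s \<odot>\<^bsub>self_module R\<^esub> y \<in> P (Suc j)" if "s \<in> A 1" "y \<in> P j" for s j y
      using that irrelevant_smult_Fil[OF A_1_irrelevant] A_subset
      by (auto simp: P_def self_module_simps smult_assoc1 Fil_subset)
  qed
  then show ?thesis using assms by (auto simp: P_def)
qed

text \<open>\<open>c\<close> is a stage from which the filtration is stable. Each later step
  multiplies by the irrelevant ideal and so raises the least possible degree by one; as
  \<open>M\<close> lives in degrees at least zero, \<open>Fil (n + c)\<close> lives in degrees at
  least \<open>n\<close>.\<close>

lemma Fil_degree_bound: "\<exists>c. \<forall>p j. \<forall>x\<in>Fil p \<inter> G j. j + c < p \<longrightarrow> x = \<zero>\<^bsub>M\<^esub>"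
proof -
  interpret g: graded_group M G by (rule graded_group_M)
  interpret h: graded_group R A by (rule graded_group_R)
  obtain c where c: "\<And>p. p \<ge> c \<Longrightarrow> ideal_times R M (irrelevant_ideal R A) (Fil p) = Fil (Suc p)"
    using Fil_stable by blast
  have "Fil (n + c) \<subseteq> above n" for n
  proof (induct n)
    case 0
    then show ?case using Fil_subset by (auto simp: above_def)
  next
    case (Suc n)
    have "span {a \<odot>\<^bsub>M\<^esub> x | a x. a \<in> irrelevant_ideal R A \<and> x \<in> Fil (n + c)} \<subseteq> above (Suc n)"
    proof (rule span_is_subset[OF _ tclosed_imp_submodule[OF tclosed_above]])
      have "a \<odot>\<^bsub>M\<^esub> x \<in> above (Suc n)" if a: "a \<in> irrelevant_ideal R A" and x: "x \<in> Fil (n + c)" for a x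
        using smult_above[of a 1 x n] a x Suc by (auto simp: irrelevant_ideal_def)
      then show "{a \<odot>\<^bsub>M\<^esub> x | a x. a \<in> irrelevant_ideal R A \<and> x \<in> Fil (n + c)} \<subseteq> above (Suc n)" by blast
    qed
    then show ?case using c[of "n + c"] by (simp add: ideal_times_def)
  qed
  then have "x = \<zero>\<^bsub>M\<^esub>" if "x \<in> Fil p" "x \<in> G j" "j + c < p" for p j x
  proof -
    \<comment> \<open>\<open>Suc j\<close> is the first bound that excludes degree \<open>j\<close>
      itself, which is why the strict inequality is required.\<close>
    have "x \<in> above (Suc j)" using \<open>\<And>n. Fil (n + c) \<subseteq> above n\<close>[of "Suc j"] Fil_antimono[of "Suc j + c" p] that by auto
    then show ?thesis using g.comp_hom[OF that(2), of j] by (simp add: above_def)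
  qed
  then show ?thesis by blast
qed

text \<open>\<open>c\<close> bounds the degrees in which the generators have nonzero components. An
  element of degree \<open>j\<close> needs at least \<open>j - c\<close> factors of degree one on
  top of a generator, and each raises the filtration; for \<open>j \<le> c\<close> the step is
  \<open>Fil 0\<close>. The same products, finite in number, span each degree over the ground
  field.\<close>

lemma finitely_generated_degrees:
  assumes "finitely_generated_module R M"
  shows "\<exists>c. \<forall>j. G j \<subseteq> Fil (j - c)" "\<exists>Y. finite Y \<and> Y \<subseteq> G j \<and> G j \<subseteq> tspan M (A 0) Y"
proof -
  interpret g: graded_group M G by (rule graded_group_M)
  obtain F where F: "finite F" "F \<subseteq> A 1" "generate_ring R (A 0 \<union> F) = carrier R"
    using generated_in_degree_1 by blast
  obtain S where S: "finite S" "S \<subseteq> carrier M" "span S = carrier M"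
    using assms by (auto simp: finitely_generated_module_def)
  define E where "E j = hom_component M G j ` S" for j
  have EG: "E j \<subseteq> G j" for j using g.comp_in S(2) by (auto simp: E_def)
  have EM: "(\<Union>j. E j) \<subseteq> carrier M" using EG g.G_subset by blast
  have T: "tclosed M (carrier R) (tspan M (carrier R) (\<Union>j. E j))"
    by (rule tclosed_tspan[OF order_refl EM])
  have "S \<subseteq> tspan M (carrier R) (\<Union>j. E j)"
  proof
    fix s assume s: "s \<in> S"
    show "s \<in> tspan M (carrier R) (\<Union>j. E j)"
    proof (rule g.comp_mem_imp[OF _ tspan_zero tspan_add])
      show "s \<in> carrier M" using s S by auto
      show "hom_component M G i s \<in> tspan M (carrier R) (\<Union>j. E j)" for i
        using s by (intro tspan_base) (auto simp: E_def)
    qed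
  qed
  from span_is_subset[OF this tclosed_imp_submodule[OF T]]
  have gen: "carrier M \<subseteq> tspan M (carrier R) (\<Union>j. E j)" unfolding S(3) .
  have "finite (\<Union>s\<in>S. {i. hom_component M G i s \<noteq> \<zero>\<^bsub>M\<^esub>})" using S g.finite_comp by auto
  then obtain c where c: "\<And>i. i \<in> (\<Union>s\<in>S. {i. hom_component M G i s \<noteq> \<zero>\<^bsub>M\<^esub>}) \<Longrightarrow> i \<le> c"
    using finite_nat_set_iff_bounded_le by metis
  have "G j \<subseteq> Fil (j - c)" for j
  proof (rule degree_induct[OF F(2,3) EG gen])
    show "tclosed M (A 0) (Fil (j - c))" for j
      using tclosed_Fil[of "j - c"] A_0_subset by (auto simp: tclosed_def)
    show "E j \<subseteq> Fil (j - c)" for j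
    proof
      fix x assume x: "x \<in> E j"
      then obtain s where s: "s \<in> S" "x = hom_component M G j s" by (auto simp: E_def)
      show "x \<in> Fil (j - c)"
      proof (cases "j \<le> c")
        case True
        then show ?thesis using x EG g.G_subset Fil_0 by auto
      next
        case False
        then have "x = \<zero>\<^bsub>M\<^esub>" using c[of j] s by auto
        then show ?thesis using Fil_zero by simp
      qed
    qed
    show "s \<odot>\<^bsub>M\<^esub> y \<in> Fil (Suc j - c)" if "s \<in> A 1" "y \<in> Fil (j - c)" for s j y
      using subsetD[OF Fil_antimono irrelevant_smult_Fil[OF A_1_irrelevant[OF that(1)] that(2)]] by simp
  qed
  then show "\<exists>c. \<forall>j. G j \<subseteq> Fil (j - c)" by blast
  have "finite (degree_products M F E j)" by (induct j) (use F(1) S(1) in \<open>auto simp: E_def\<close>)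
  then show "\<exists>Y. finite Y \<and> Y \<subseteq> G j \<and> G j \<subseteq> tspan M (A 0) Y"
    using degree_span[OF F(2,3) EG gen, of j] by blast
qed

end

section \<open>The associated graded module\<close>

context stable_graded_filtration
begin

abbreviation "k \<equiv> R\<lparr>carrier := A 0\<rparr>"
abbreviation "gr \<equiv> assoc_graded R A M Fil"

lemma k_carrier: "c \<in> A 0 \<Longrightarrow> c \<in> carrier R"
  using A_0_subset by auto

lemma vectorspace_M: "vectorspace k M"
  by (rule vectorspace_restrict_scalars[OF module_axioms ground_field])

lemma tclosed_Fil_k: "tclosed M (carrier k) (Fil p)"
  using tclosed_Fil[of p] A_0_subset by (auto simp: tclosed_def)

lemma vectorspace_gr_part: "vectorspace k (gr_part M Fil p)"
  unfolding gr_part_def by (rule vectorspace.vectorspace_subquotient[OF vectorspace_M tclosed_Fil_k tclosed_Fil_k])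

lemma gr_part_simps:
  "carrier (gr_part M Fil p) = {Fil (Suc p) +>\<^bsub>M\<^esub> x | x. x \<in> Fil p}"
  "\<zero>\<^bsub>gr_part M Fil p\<^esub> = Fil (Suc p)"
  "X \<oplus>\<^bsub>gr_part M Fil p\<^esub> Y = X <+>\<^bsub>M\<^esub> Y"
  "a \<odot>\<^bsub>gr_part M Fil p\<^esub> X = Fil (Suc p) <+>\<^bsub>M\<^esub> (\<lambda>x. a \<odot>\<^bsub>M\<^esub> x) ` X"
  by (simp_all add: gr_part_def subquotient_def)

lemma gr_simps:
  "f \<in> carrier gr \<longleftrightarrow> (\<forall>p. f p \<in> carrier (gr_part M Fil p)) \<and> finite {p. f p \<noteq> Fil (Suc p)}"
  "\<zero>\<^bsub>gr\<^esub> = (\<lambda>p. Fil (Suc p))"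
  "f \<oplus>\<^bsub>gr\<^esub> g = (\<lambda>p. f p \<oplus>\<^bsub>gr_part M Fil p\<^esub> g p)"
  by (simp_all add: assoc_graded_def gr_part_simps(2))

lemma Fil_coset_eq_self_iff:
  "x \<in> carrier M \<Longrightarrow> Fil q +>\<^bsub>M\<^esub> x = Fil q \<longleftrightarrow> x \<in> Fil q"
  by (rule vectorspace.coset_eq_self_iff[OF vectorspace_M tclosed_Fil_k])

lemma Fil_coset_add:
  "x \<in> carrier M \<Longrightarrow> y \<in> carrier M \<Longrightarrow> (Fil q +>\<^bsub>M\<^esub> x) <+>\<^bsub>M\<^esub> (Fil q +>\<^bsub>M\<^esub> y) = Fil q +>\<^bsub>M\<^esub> (x \<oplus>\<^bsub>M\<^esub> y)"
  by (rule vectorspace.coset_add[OF vectorspace_M tclosed_Fil_k])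

text \<open>Multiplication by \<open>a\<close> sends \<open>Fil (Suc p)\<close> into
  \<open>Fil (Suc (p + e))\<close>, so the result is a single coset.\<close>

lemma gr_smult_coset:
  assumes a: "a \<in> A e" and x: "x \<in> carrier M"
  shows "Fil (Suc (p + e)) <+>\<^bsub>M\<^esub> (\<lambda>x. a \<odot>\<^bsub>M\<^esub> x) ` (Fil (Suc p) +>\<^bsub>M\<^esub> x) = Fil (Suc (p + e)) +>\<^bsub>M\<^esub> (a \<odot>\<^bsub>M\<^esub> x)"
proof (rule coset_smult_image[OF vectorspace_M tclosed_Fil_k x])
  have aR: "a \<in> carrier R" using a A_subset by blast
  show "(\<odot>\<^bsub>M\<^esub>) a ` Fil (Suc p) \<subseteq> Fil (Suc (p + e))" using degree_smult_Fil[OF a, of _ "Suc p"] by auto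
  show "a \<odot>\<^bsub>M\<^esub> x \<in> carrier M" using aR x by simp
  show "a \<odot>\<^bsub>M\<^esub> (c \<oplus>\<^bsub>M\<^esub> x) = a \<odot>\<^bsub>M\<^esub> c \<oplus>\<^bsub>M\<^esub> a \<odot>\<^bsub>M\<^esub> x" if "c \<in> Fil (Suc p)" for c
    using aR x Fil_subset[OF that] by (simp add: smult_r_distr)
qed (use Fil_subset Fil_zero in auto)

lemma gr_smult_zero:
  assumes "X \<in> carrier (gr_part M Fil p)"
  shows "gr_smult M Fil n \<zero> X = Fil (Suc n)"
proof -
  obtain x where x: "x \<in> Fil p" "X = Fil (Suc p) +>\<^bsub>M\<^esub> x" using assms by (auto simp: gr_part_simps)
  have "Fil (Suc n) <+>\<^bsub>M\<^esub> (\<lambda>x. \<zero> \<odot>\<^bsub>M\<^esub> x) ` (Fil (Suc p) +>\<^bsub>M\<^esub> x) = Fil (Suc n) +>\<^bsub>M\<^esub> (\<zero> \<odot>\<^bsub>M\<^esub> x)"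
    by (rule coset_smult_image[OF vectorspace_M tclosed_Fil_k])
      (use Fil_subset[OF x(1)] Fil_subset Fil_zero in auto)
  then show ?thesis using Fil_subset[OF x(1)] Fil_coset_eq_self_iff[of "\<zero>\<^bsub>M\<^esub>" "Suc n"] Fil_zero x(2)
    by (simp add: gr_smult_def)
qed

text \<open>For a homogeneous scalar the convolution collapses to the summand \<open>q = e\<close>;
  for \<open>p < e\<close> this index does not occur and the value is zero.\<close>

lemma gr_smult_homogeneous:
  assumes a: "a \<in> A e" and f: "f \<in> carrier gr"
  shows "(a \<odot>\<^bsub>gr\<^esub> f) p = (if e \<le> p then Fil (Suc p) <+>\<^bsub>M\<^esub> (\<lambda>x. a \<odot>\<^bsub>M\<^esub> x) ` f (p - e) else Fil (Suc p))"
proof -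
  interpret h: graded_group R A by (rule graded_group_R)
  interpret Q: vectorspace k "gr_part M Fil p" by (rule vectorspace_gr_part)
  have fq: "f q \<in> carrier (gr_part M Fil q)" for q using f by (simp add: gr_simps)
  have ae: "Fil (Suc p) <+>\<^bsub>M\<^esub> (\<lambda>x. a \<odot>\<^bsub>M\<^esub> x) ` f (p - e) \<in> carrier (gr_part M Fil p)" if "e \<le> p"
  proof -
    obtain x where x: "x \<in> Fil (p - e)" "f (p - e) = Fil (Suc (p - e)) +>\<^bsub>M\<^esub> x" using fq[of "p - e"] by (auto simp: gr_part_simps)
    show ?thesis
      using gr_smult_coset[OF a Fil_subset[OF x(1)], of "p - e"] degree_smult_Fil[OF a x(1)] that x(2)
      by (auto simp: gr_part_simps)
  qed
  have z: "Fil (Suc p) \<in> carrier (gr_part M Fil p)" using Q.M.zero_closed by (simp add: gr_part_simps(2))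
  have "(a \<odot>\<^bsub>gr\<^esub> f) p = (\<Oplus>\<^bsub>gr_part M Fil p\<^esub>q\<in>{..p}. gr_smult M Fil p (hom_component R A q a) (f (p - q)))"
    by (simp add: assoc_graded_def)
  also have "\<dots> = (\<Oplus>\<^bsub>gr_part M Fil p\<^esub>q\<in>{..p}. if e = q then Fil (Suc p) <+>\<^bsub>M\<^esub> (\<lambda>x. a \<odot>\<^bsub>M\<^esub> x) ` f (p - q) else \<zero>\<^bsub>gr_part M Fil p\<^esub>)"
  proof (rule Q.M.finsum_cong')
    fix q assume "q \<in> {..p}"
    show "gr_smult M Fil p (hom_component R A q a) (f (p - q)) =
      (if e = q then Fil (Suc p) <+>\<^bsub>M\<^esub> (\<lambda>x. a \<odot>\<^bsub>M\<^esub> x) ` f (p - q) else \<zero>\<^bsub>gr_part M Fil p\<^esub>)"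
      using h.comp_hom[OF a, of q] gr_smult_zero[OF fq[of "p - q"], of p]
      by (simp add: gr_smult_def gr_part_simps(2) eq_commute)
  qed (use ae z in \<open>auto simp: gr_part_simps(2)\<close>)
  also have "\<dots> = (if e \<le> p then Fil (Suc p) <+>\<^bsub>M\<^esub> (\<lambda>x. a \<odot>\<^bsub>M\<^esub> x) ` f (p - e) else Fil (Suc p))"
  proof (cases "e \<le> p")
    case True
    let ?g = "\<lambda>q. if e = q then Fil (Suc p) <+>\<^bsub>M\<^esub> (\<lambda>x. a \<odot>\<^bsub>M\<^esub> x) ` f (p - q) else Fil (Suc p)"
    have "(\<Oplus>\<^bsub>gr_part M Fil p\<^esub>q\<in>{..p}. if e = q then ?g q else \<zero>\<^bsub>gr_part M Fil p\<^esub>) = ?g e"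
      by (rule Q.M.finsum_singleton) (use True ae z in auto)
    moreover have "(\<Oplus>\<^bsub>gr_part M Fil p\<^esub>q\<in>{..p}. if e = q then ?g q else \<zero>\<^bsub>gr_part M Fil p\<^esub>) =
      (\<Oplus>\<^bsub>gr_part M Fil p\<^esub>q\<in>{..p}. if e = q then Fil (Suc p) <+>\<^bsub>M\<^esub> (\<lambda>x. a \<odot>\<^bsub>M\<^esub> x) ` f (p - q) else \<zero>\<^bsub>gr_part M Fil p\<^esub>)"
      by (rule arg_cong[of _ _ "\<lambda>g. finsum _ g _"]) (simp add: fun_eq_iff)
    ultimately show ?thesis using True by simp
  next
    case False
    have "(\<Oplus>\<^bsub>gr_part M Fil p\<^esub>q\<in>{..p}. if e = q then Fil (Suc p) <+>\<^bsub>M\<^esub> (\<lambda>x. a \<odot>\<^bsub>M\<^esub> x) ` f (p - q) else \<zero>\<^bsub>gr_part M Fil p\<^esub>)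
        = (\<Oplus>\<^bsub>gr_part M Fil p\<^esub>q\<in>{..p}. \<zero>\<^bsub>gr_part M Fil p\<^esub>)"
      by (rule Q.M.finsum_cong') (use False in auto)
    then show ?thesis using False by (simp add: Q.M.finsum_zero gr_part_simps(2))
  qed
  finally show ?thesis .
qed

lemma gr_lift:
  assumes "f \<in> carrier gr"
  obtains x where "\<And>p. x p \<in> Fil p" "f = (\<lambda>p. Fil (Suc p) +>\<^bsub>M\<^esub> x p)"
proof -
  have "\<forall>p. \<exists>x. x \<in> Fil p \<and> f p = Fil (Suc p) +>\<^bsub>M\<^esub> x" using assms by (auto simp: gr_simps gr_part_simps)
  then obtain x where "\<forall>p. x p \<in> Fil p \<and> f p = Fil (Suc p) +>\<^bsub>M\<^esub> x p" unfolding choice_iff ..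
  then show ?thesis by (intro that[of x]) auto
qed

text \<open>Computations in the associated graded module are moved to representatives in
  \<open>M\<close> through this formula.\<close>

lemma gr_smult_lift:
  assumes a: "a \<in> A e" and f: "f \<in> carrier gr" and x: "\<And>p. x p \<in> Fil p" "f = (\<lambda>p. Fil (Suc p) +>\<^bsub>M\<^esub> x p)"
  shows "(a \<odot>\<^bsub>gr\<^esub> f) p = (if e \<le> p then Fil (Suc p) +>\<^bsub>M\<^esub> (a \<odot>\<^bsub>M\<^esub> x (p - e)) else Fil (Suc p))"
  using gr_smult_homogeneous[OF a f, of p] gr_smult_coset[OF a Fil_subset[OF x(1)[of "p - e"]], of "p - e"]
  by (cases "e \<le> p") (simp_all add: x(2))

lemma gr_smult_0: "c \<in> A 0 \<Longrightarrow> f \<in> carrier gr \<Longrightarrow> (c \<odot>\<^bsub>gr\<^esub> f) = (\<lambda>p. c \<odot>\<^bsub>gr_part M Fil p\<^esub> f p)"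
  using gr_smult_homogeneous[of c 0 f] by (auto simp: gr_part_simps(4))

lemma gr_smult_closed:
  assumes a: "a \<in> A e" and f: "f \<in> carrier gr"
  shows "a \<odot>\<^bsub>gr\<^esub> f \<in> carrier gr"
proof -
  obtain x where x: "\<And>p. x p \<in> Fil p" "f = (\<lambda>p. Fil (Suc p) +>\<^bsub>M\<^esub> x p)" using gr_lift[OF f] by metis
  note s = gr_smult_lift[OF a f x]
  have "{p. (a \<odot>\<^bsub>gr\<^esub> f) p \<noteq> Fil (Suc p)} \<subseteq> (\<lambda>p. p + e) ` {p. f p \<noteq> Fil (Suc p)}"
  proof
    fix p assume p: "p \<in> {p. (a \<odot>\<^bsub>gr\<^esub> f) p \<noteq> Fil (Suc p)}"
    then have ep: "e \<le> p" using s[of p] by (cases "e \<le> p") simp_all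
    have "x (p - e) \<notin> Fil (Suc (p - e))"
    proof
      assume "x (p - e) \<in> Fil (Suc (p - e))"
      from degree_smult_Fil[OF a this] have "a \<odot>\<^bsub>M\<^esub> x (p - e) \<in> Fil (Suc p)" using ep by simp
      then show False using p s[of p] ep Fil_coset_eq_self_iff[of "a \<odot>\<^bsub>M\<^esub> x (p - e)" "Suc p"] Fil_subset by auto
    qed
    then have "f (p - e) \<noteq> Fil (Suc (p - e))"
      using Fil_coset_eq_self_iff[OF Fil_subset[OF x(1)[of "p - e"]], of "Suc (p - e)"] x(2) by simp
    then show "p \<in> (\<lambda>p. p + e) ` {p. f p \<noteq> Fil (Suc p)}" using ep by (intro image_eqI[of _ _ "p - e"]) auto
  qed
  then have fin: "finite {p. (a \<odot>\<^bsub>gr\<^esub> f) p \<noteq> Fil (Suc p)}"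
    by (rule finite_subset) (use f in \<open>simp add: gr_simps\<close>)
  have "(a \<odot>\<^bsub>gr\<^esub> f) p \<in> carrier (gr_part M Fil p)" for p
  proof (cases "e \<le> p")
    case True
    then show ?thesis using s[of p] degree_smult_Fil[OF a x(1), of "p - e"] by (auto simp: gr_part_simps)
  next
    case False
    interpret Q: vectorspace k "gr_part M Fil p" by (rule vectorspace_gr_part)
    show ?thesis using s[of p] False Q.M.zero_closed by (simp add: gr_part_simps(2))
  qed
  then show ?thesis using fin by (simp add: gr_simps)
qed

text \<open>Scalars of \<open>A 0\<close> act separately in each filtration degree, so the axioms
  are inherited from the vector spaces \<open>gr_part M Fil p\<close>.\<close>

lemma vectorspace_gr: "vectorspace k gr"
proof -
  interpret K: field k using vectorspace_M by (simp add: vectorspace_def)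
  interpret Q: vectorspace k "gr_part M Fil p" for p by (rule vectorspace_gr_part)
  have mem: "f \<in> carrier gr \<Longrightarrow> f p \<in> carrier (gr_part M Fil p)" for f p by (simp add: gr_simps)
  have zp: "Fil (Suc p) = \<zero>\<^bsub>gr_part M Fil p\<^esub>" for p by (simp add: gr_part_simps(2))
  have addc: "f \<oplus>\<^bsub>gr\<^esub> g \<in> carrier gr" if "f \<in> carrier gr" "g \<in> carrier gr" for f g
  proof -
    have "{p. (f \<oplus>\<^bsub>gr\<^esub> g) p \<noteq> Fil (Suc p)} \<subseteq> {p. f p \<noteq> Fil (Suc p)} \<union> {p. g p \<noteq> Fil (Suc p)}"
      using Q.M.zero_closed by (auto simp: gr_simps(3) zp)
    then have "finite {p. (f \<oplus>\<^bsub>gr\<^esub> g) p \<noteq> Fil (Suc p)}"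
      by (rule finite_subset) (use that in \<open>simp add: gr_simps\<close>)
    then show ?thesis using mem[OF that(1)] mem[OF that(2)] by (simp add: gr_simps)
  qed
  have smc: "c \<odot>\<^bsub>gr\<^esub> f \<in> carrier gr" if "c \<in> A 0" "f \<in> carrier gr" for c f using gr_smult_closed[OF that] .
  have k: "carrier k = A 0" by simp
  have kops: "a \<in> A 0 \<Longrightarrow> b \<in> A 0 \<Longrightarrow> a \<otimes> b \<in> A 0" "a \<in> A 0 \<Longrightarrow> b \<in> A 0 \<Longrightarrow> a \<oplus> b \<in> A 0" "\<one> \<in> A 0" for a b
    using subringE[OF subfieldE(1)[OF ground_field]] by auto
  show ?thesis
  proof (rule vs_criteria)
    show "field k" by (rule K.field_axioms)
    show z: "\<zero>\<^bsub>gr\<^esub> \<in> carrier gr" using Q.M.zero_closed by (simp add: gr_simps zp)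
    show "\<forall>v w. v \<in> carrier gr \<and> w \<in> carrier gr \<longrightarrow> v \<oplus>\<^bsub>gr\<^esub> w \<in> carrier gr" using addc by simp
    show "\<forall>v\<in>carrier gr. \<exists>neg_v\<in>carrier gr. v \<oplus>\<^bsub>gr\<^esub> neg_v = \<zero>\<^bsub>gr\<^esub>"
    proof
      fix f assume f: "f \<in> carrier gr"
      have e: "\<ominus>\<^bsub>k\<^esub> \<one>\<^bsub>k\<^esub> \<in> A 0" using K.a_inv_closed[OF K.one_closed] by simp
      have "f p \<oplus>\<^bsub>gr_part M Fil p\<^esub> (\<ominus>\<^bsub>k\<^esub> \<one>\<^bsub>k\<^esub>) \<odot>\<^bsub>gr_part M Fil p\<^esub> f p = \<zero>\<^bsub>gr_part M Fil p\<^esub>" for p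
        using Q.smult_l_minus[OF K.one_closed mem[OF f]] Q.smult_one[OF mem[OF f]] Q.M.r_neg[OF mem[OF f]]
        by simp
      then have "f \<oplus>\<^bsub>gr\<^esub> (\<ominus>\<^bsub>k\<^esub> \<one>\<^bsub>k\<^esub>) \<odot>\<^bsub>gr\<^esub> f = \<zero>\<^bsub>gr\<^esub>"
        unfolding gr_smult_0[OF e f] gr_simps zp by simp
      then show "\<exists>g\<in>carrier gr. f \<oplus>\<^bsub>gr\<^esub> g = \<zero>\<^bsub>gr\<^esub>" using smc[OF e f] by blast
    qed
    show "\<forall>c v. c \<in> carrier k \<and> v \<in> carrier gr \<longrightarrow> c \<odot>\<^bsub>gr\<^esub> v \<in> carrier gr" using smc by simp
    show "\<forall>v w. v \<in> carrier gr \<and> w \<in> carrier gr \<longrightarrow> v \<oplus>\<^bsub>gr\<^esub> w = w \<oplus>\<^bsub>gr\<^esub> v"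
      using Q.M.a_comm mem by (simp add: gr_simps(3))
    show "\<forall>u v w. u \<in> carrier gr \<and> v \<in> carrier gr \<and> w \<in> carrier gr \<longrightarrow>
        u \<oplus>\<^bsub>gr\<^esub> v \<oplus>\<^bsub>gr\<^esub> w = u \<oplus>\<^bsub>gr\<^esub> (v \<oplus>\<^bsub>gr\<^esub> w)"
      using Q.M.a_assoc mem by (simp add: gr_simps(3))
    show "\<forall>v\<in>carrier gr. v \<oplus>\<^bsub>gr\<^esub> \<zero>\<^bsub>gr\<^esub> = v"
      using Q.M.r_zero mem by (simp add: gr_simps(2,3) zp)
    show "\<forall>a b v. a \<in> carrier k \<and> b \<in> carrier k \<and> v \<in> carrier gr \<longrightarrow>
        (a \<otimes>\<^bsub>k\<^esub> b) \<odot>\<^bsub>gr\<^esub> v = a \<odot>\<^bsub>gr\<^esub> (b \<odot>\<^bsub>gr\<^esub> v)"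
      using Q.smult_assoc1 mem smc kops by (simp add: gr_smult_0)
    show "\<forall>v\<in>carrier gr. \<one>\<^bsub>k\<^esub> \<odot>\<^bsub>gr\<^esub> v = v"
      using Q.smult_one mem kops by (simp add: gr_smult_0)
    show "\<forall>a b v. a \<in> carrier k \<and> b \<in> carrier k \<and> v \<in> carrier gr \<longrightarrow>
        (a \<oplus>\<^bsub>k\<^esub> b) \<odot>\<^bsub>gr\<^esub> v = a \<odot>\<^bsub>gr\<^esub> v \<oplus>\<^bsub>gr\<^esub> b \<odot>\<^bsub>gr\<^esub> v"
      using Q.smult_l_distr mem kops by (simp add: gr_smult_0 gr_simps(3))
    show "\<forall>a v w. a \<in> carrier k \<and> v \<in> carrier gr \<and> w \<in> carrier gr \<longrightarrow>
        a \<odot>\<^bsub>gr\<^esub> (v \<oplus>\<^bsub>gr\<^esub> w) = a \<odot>\<^bsub>gr\<^esub> v \<oplus>\<^bsub>gr\<^esub> a \<odot>\<^bsub>gr\<^esub> w"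
    proof (intro allI impI)
      fix a v w assume h: "a \<in> carrier k \<and> v \<in> carrier gr \<and> w \<in> carrier gr"
      then have a: "a \<in> A 0" by simp
      have "a \<odot>\<^bsub>gr\<^esub> (v \<oplus>\<^bsub>gr\<^esub> w) = (\<lambda>p. a \<odot>\<^bsub>gr_part M Fil p\<^esub> (v \<oplus>\<^bsub>gr\<^esub> w) p)"
        by (rule gr_smult_0[OF a addc]) (use h in auto)
      then show "a \<odot>\<^bsub>gr\<^esub> (v \<oplus>\<^bsub>gr\<^esub> w) = a \<odot>\<^bsub>gr\<^esub> v \<oplus>\<^bsub>gr\<^esub> a \<odot>\<^bsub>gr\<^esub> w"
        using Q.smult_r_distr[of a] h a mem by (simp add: gr_smult_0 gr_simps(3))
    qed
  qed
qed

lemma linear_scalar_gr: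
  assumes a: "a \<in> A e"
  shows "linear_scalar k gr a"
  unfolding linear_scalar_def additive_map_def
proof (intro conjI ballI)
  interpret W: vectorspace k gr by (rule vectorspace_gr)
  have aR: "a \<in> carrier R" using a A_subset by blast
  fix f assume f: "f \<in> carrier gr"
  show "a \<odot>\<^bsub>gr\<^esub> f \<in> carrier gr" by (rule gr_smult_closed[OF a f])
  obtain x where x: "\<And>p. x p \<in> Fil p" "f = (\<lambda>p. Fil (Suc p) +>\<^bsub>M\<^esub> x p)" using gr_lift[OF f] by metis
  have xM: "x p \<in> carrier M" for p using Fil_subset[OF x(1)] .
  {
    fix g assume g: "g \<in> carrier gr"
    obtain y where y: "\<And>p. y p \<in> Fil p" "g = (\<lambda>p. Fil (Suc p) +>\<^bsub>M\<^esub> y p)" using gr_lift[OF g] by metis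
    have yM: "y p \<in> carrier M" for p using Fil_subset[OF y(1)] .
    have fg: "f \<oplus>\<^bsub>gr\<^esub> g = (\<lambda>p. Fil (Suc p) +>\<^bsub>M\<^esub> (x p \<oplus>\<^bsub>M\<^esub> y p))"
      using Fil_coset_add[OF xM yM] by (simp add: gr_simps(3) gr_part_simps(3) x(2) y(2))
    show "a \<odot>\<^bsub>gr\<^esub> (f \<oplus>\<^bsub>gr\<^esub> g) = a \<odot>\<^bsub>gr\<^esub> f \<oplus>\<^bsub>gr\<^esub> a \<odot>\<^bsub>gr\<^esub> g"
    proof
      fix p
      have z: "Fil (Suc p) = Fil (Suc p) +>\<^bsub>M\<^esub> \<zero>\<^bsub>M\<^esub>"
        using Fil_coset_eq_self_iff[of "\<zero>\<^bsub>M\<^esub>"] Fil_zero by simp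
      have zz: "Fil (Suc p) <+>\<^bsub>M\<^esub> Fil (Suc p) = Fil (Suc p)"
        using Fil_coset_add[of "\<zero>\<^bsub>M\<^esub>" "\<zero>\<^bsub>M\<^esub>" "Suc p"] z by simp
      have "(a \<odot>\<^bsub>gr\<^esub> (f \<oplus>\<^bsub>gr\<^esub> g)) p =
          (if e \<le> p then Fil (Suc p) +>\<^bsub>M\<^esub> (a \<odot>\<^bsub>M\<^esub> (x (p - e) \<oplus>\<^bsub>M\<^esub> y (p - e))) else Fil (Suc p))"
        by (rule gr_smult_lift[OF a _ _ fg]) (use f g x(1) y(1) Fil_add in auto)
      then show "(a \<odot>\<^bsub>gr\<^esub> (f \<oplus>\<^bsub>gr\<^esub> g)) p = (a \<odot>\<^bsub>gr\<^esub> f \<oplus>\<^bsub>gr\<^esub> a \<odot>\<^bsub>gr\<^esub> g) p"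
        using gr_smult_lift[OF a f x, of p] gr_smult_lift[OF a g y, of p] aR xM yM zz
        by (simp add: gr_simps(3) gr_part_simps(3) smult_r_distr Fil_coset_add)
    qed
  next
    fix c assume "c \<in> carrier k"
    then have c: "c \<in> A 0" and cR: "c \<in> carrier R" using k_carrier by auto
    have cf: "c \<odot>\<^bsub>gr\<^esub> f = (\<lambda>p. Fil (Suc p) +>\<^bsub>M\<^esub> (c \<odot>\<^bsub>M\<^esub> x p))"
      using gr_smult_lift[OF c f x] by (intro ext) simp
    show "a \<odot>\<^bsub>gr\<^esub> (c \<odot>\<^bsub>gr\<^esub> f) = c \<odot>\<^bsub>gr\<^esub> (a \<odot>\<^bsub>gr\<^esub> f)"
    proof
      fix p
      have z: "Fil (Suc p) = Fil (Suc p) +>\<^bsub>M\<^esub> \<zero>\<^bsub>M\<^esub>"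
        using Fil_coset_eq_self_iff[of "\<zero>\<^bsub>M\<^esub>"] Fil_zero by simp
      define w where "w p = (if e \<le> p then a \<odot>\<^bsub>M\<^esub> x (p - e) else \<zero>\<^bsub>M\<^esub>)" for p
      have w: "w p \<in> Fil p" for p using degree_smult_Fil[OF a x(1)[of "p - e"]] Fil_zero by (cases "e \<le> p") (simp_all add: w_def)
      have af: "a \<odot>\<^bsub>gr\<^esub> f = (\<lambda>p. Fil (Suc p) +>\<^bsub>M\<^esub> w p)"
        using gr_smult_lift[OF a f x] Fil_coset_eq_self_iff[of "\<zero>\<^bsub>M\<^esub>"] Fil_zero by (intro ext) (simp add: w_def)
      have "(a \<odot>\<^bsub>gr\<^esub> (c \<odot>\<^bsub>gr\<^esub> f)) p =
          (if e \<le> p then Fil (Suc p) +>\<^bsub>M\<^esub> (a \<odot>\<^bsub>M\<^esub> (c \<odot>\<^bsub>M\<^esub> x (p - e))) else Fil (Suc p))"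
        by (rule gr_smult_lift[OF a gr_smult_closed[OF c f] _ cf]) (use x(1) cR Fil_smult in auto)
      moreover have "(c \<odot>\<^bsub>gr\<^esub> (a \<odot>\<^bsub>gr\<^esub> f)) p = Fil (Suc p) +>\<^bsub>M\<^esub> (c \<odot>\<^bsub>M\<^esub> w p)"
        using gr_smult_lift[OF c gr_smult_closed[OF a f] w af, of p] by simp
      ultimately show "(a \<odot>\<^bsub>gr\<^esub> (c \<odot>\<^bsub>gr\<^esub> f)) p = (c \<odot>\<^bsub>gr\<^esub> (a \<odot>\<^bsub>gr\<^esub> f)) p"
        using aR cR xM z by (simp add: w_def smult_assoc1[symmetric] m_comm)
    qed
  }
qed

text \<open>\<open>leading P e\<close> sends an element of the filtration step \<open>P\<close> of \<open>M(-e)\<close> to its class in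
  degree \<open>P\<close> of the associated graded module of \<open>M(-e)\<close>; for \<open>P < e\<close> truncated subtraction makes
  it zero. \<open>gr_degree P e\<close> is the projection onto that degree.\<close>

definition leading :: "nat \<Rightarrow> nat \<Rightarrow> 'b \<Rightarrow> nat \<Rightarrow> 'b set" where
  "leading P e y = (\<lambda>p. if p + e = P then Fil (Suc p) +>\<^bsub>M\<^esub> y else Fil (Suc p))"

definition gr_degree :: "nat \<Rightarrow> nat \<Rightarrow> (nat \<Rightarrow> 'b set) \<Rightarrow> nat \<Rightarrow> 'b set" where
  "gr_degree P e f = (\<lambda>p. if p + e = P then f p else Fil (Suc p))"

lemma leading_closed:
  assumes "y \<in> Fil (P - e)"
  shows "leading P e y \<in> carrier gr"
proof -
  have "{p. leading P e y p \<noteq> Fil (Suc p)} \<subseteq> {P - e}" by (auto simp: leading_def)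
  then have "finite {p. leading P e y p \<noteq> Fil (Suc p)}" by (rule finite_subset) simp
  moreover have "leading P e y p \<in> carrier (gr_part M Fil p)" for p
  proof -
    interpret Q: vectorspace k "gr_part M Fil p" by (rule vectorspace_gr_part)
    have z: "Fil (Suc p) \<in> carrier (gr_part M Fil p)" using Q.M.zero_closed by (simp add: gr_part_simps(2))
    have "Fil (Suc p) +>\<^bsub>M\<^esub> y \<in> carrier (gr_part M Fil p)" if "p + e = P"
      using assms that by (auto simp: gr_part_simps(1))
    then show ?thesis using z by (simp add: leading_def)
  qed
  ultimately show ?thesis by (simp add: gr_simps)
qed

lemma leading_add:
  assumes "x \<in> Fil (P - e)" "y \<in> Fil (P - e)"
  shows "leading P e (x \<oplus>\<^bsub>M\<^esub> y) = leading P e x \<oplus>\<^bsub>gr\<^esub> leading P e y"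
proof
  fix p
  interpret Q: vectorspace k "gr_part M Fil p" by (rule vectorspace_gr_part)
  have "Fil (Suc p) <+>\<^bsub>M\<^esub> Fil (Suc p) = Fil (Suc p)"
    using Q.M.r_zero[OF Q.M.zero_closed] by (simp add: gr_part_simps(2,3))
  then show "leading P e (x \<oplus>\<^bsub>M\<^esub> y) p = (leading P e x \<oplus>\<^bsub>gr\<^esub> leading P e y) p"
    using assms Fil_subset by (simp add: leading_def gr_simps(3) gr_part_simps(3) Fil_coset_add)
qed

text \<open>For \<open>e \<le> P\<close> the next step \<open>Suc P - e\<close> is
  \<open>Suc (P - e)\<close>. For \<open>P < e\<close> both \<open>P - e\<close> and
  \<open>Suc P - e\<close> are zero, and both sides hold.\<close>

lemma leading_eq_zero_iff:
  assumes "y \<in> Fil (P - e)"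
  shows "leading P e y = \<zero>\<^bsub>gr\<^esub> \<longleftrightarrow> y \<in> Fil (Suc P - e)"
proof (cases "e \<le> P")
  case True
  have "leading P e y = \<zero>\<^bsub>gr\<^esub> \<longleftrightarrow> Fil (Suc (P - e)) +>\<^bsub>M\<^esub> y = Fil (Suc (P - e))"
    using True by (auto simp: leading_def gr_simps(2) fun_eq_iff)
  then show ?thesis using Fil_coset_eq_self_iff[OF Fil_subset[OF assms]] True by (simp add: Suc_diff_le)
next
  case False
  then show ?thesis using assms by (auto simp: leading_def gr_simps(2))
qed

lemma leading_zero: "leading P e \<zero>\<^bsub>M\<^esub> = \<zero>\<^bsub>gr\<^esub>"
  using leading_eq_zero_iff[OF Fil_zero] Fil_zero by simp

lemma leading_finsum:
  assumes "finite S" "\<And>i. i \<in> S \<Longrightarrow> f i \<in> Fil (P - e)"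
  shows "finsum M f S \<in> Fil (P - e) \<and> leading P e (finsum M f S) = finsum gr (\<lambda>i. leading P e (f i)) S"
  using assms
proof (induct S rule: finite_induct)
  case empty
  interpret W: vectorspace k gr by (rule vectorspace_gr)
  show ?case by (simp add: leading_zero Fil_zero)
next
  case (insert i S)
  interpret W: vectorspace k gr by (rule vectorspace_gr)
  have m: "f i \<in> carrier M" "f \<in> S \<rightarrow> carrier M" using insert(4) Fil_subset by blast+
  have "(\<lambda>i. leading P e (f i)) \<in> S \<rightarrow> carrier gr" "leading P e (f i) \<in> carrier gr"
    using insert(4) leading_closed by auto
  then show ?case using insert m by (simp add: leading_add Fil_add)
qed

lemma twist_smult_Fil:
  assumes a: "a \<in> twist R A e d" and y: "y \<in> Fil (P - d)"
  shows "a \<odot>\<^bsub>M\<^esub> y \<in> Fil (P - e)"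
proof (cases "e \<le> d")
  case True
  then have "a \<odot>\<^bsub>M\<^esub> y \<in> Fil ((P - d) + (d - e))" using a by (intro degree_smult_Fil y) (simp add: twist_def)
  \<comment> \<open>With truncated subtraction \<open>(P - d) + (d - e)\<close> is only at least
    \<open>P - e\<close>, which suffices as the filtration descends.\<close>
  moreover have "Fil ((P - d) + (d - e)) \<subseteq> Fil (P - e)" by (rule Fil_antimono) (use True in arith)
  ultimately show ?thesis by (rule subsetD[rotated])
next
  case False
  then show ?thesis using a Fil_subset[OF y] Fil_zero by (simp add: twist_def)
qed

lemma zero_in_A: "\<zero> \<in> A e"
  using graded_group.G_zero[OF graded_group_R] .

lemma twist_homogeneous:
  assumes "a \<in> twist R A e d"
  shows "a \<in> A (d - e)" "d < e \<Longrightarrow> a = \<zero>"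
  using assms zero_in_A by (auto simp: twist_def split: if_splits)

lemma leading_smult:
  assumes a: "a \<in> twist R A e d" and y: "y \<in> Fil (P - d)"
  shows "a \<odot>\<^bsub>gr\<^esub> leading P d y = leading P e (a \<odot>\<^bsub>M\<^esub> y)"
proof (cases "d \<le> P")
  case False
  interpret W: vectorspace k gr by (rule vectorspace_gr)
  have y': "y \<in> Fil (Suc P - d)" using y False by simp
  have "a \<odot>\<^bsub>gr\<^esub> \<zero>\<^bsub>gr\<^esub> = \<zero>\<^bsub>gr\<^esub>"
    using linear_scalar_gr[OF twist_homogeneous(1)[OF a]]
    by (intro additive_map_zero[OF W.M.abelian_group_axioms W.M.abelian_group_axioms])
      (simp add: linear_scalar_def)
  then show ?thesis
    using leading_eq_zero_iff[OF y] leading_eq_zero_iff[OF twist_smult_Fil[OF a y]] y' twist_smult_Fil[OF a y']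
    by simp
next
  case dP: True
  show ?thesis
  proof
    fix p
    define x where "x p = (if p + d = P then y else \<zero>\<^bsub>M\<^esub>)" for p
    have x: "x p \<in> Fil p" for p using y Fil_zero by (auto simp: x_def)
    have lx: "leading P d y = (\<lambda>p. Fil (Suc p) +>\<^bsub>M\<^esub> x p)"
      using Fil_coset_eq_self_iff[of "\<zero>\<^bsub>M\<^esub>"] Fil_zero by (intro ext) (simp add: leading_def x_def)
    have z: "Fil (Suc p) +>\<^bsub>M\<^esub> \<zero>\<^bsub>M\<^esub> = Fil (Suc p)" using Fil_coset_eq_self_iff[of "\<zero>\<^bsub>M\<^esub>"] Fil_zero by simp
    have aR: "a \<in> carrier R" using twist_R_carrier[OF a] .
    have *: "(a \<odot>\<^bsub>gr\<^esub> leading P d y) p =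
        (if d - e \<le> p then Fil (Suc p) +>\<^bsub>M\<^esub> (a \<odot>\<^bsub>M\<^esub> x (p - (d - e))) else Fil (Suc p))"
      by (rule gr_smult_lift[OF twist_homogeneous(1)[OF a] leading_closed[OF y] x lx])
    show "(a \<odot>\<^bsub>gr\<^esub> leading P d y) p = leading P e (a \<odot>\<^bsub>M\<^esub> y) p"
    proof (cases "e \<le> d")
      case True
      have "d - e \<le> p" if "P = p + e" using dP that by simp
      then show ?thesis using * True aR z by (auto simp: leading_def x_def)
    next
      case False
      then have "a = \<zero>" using twist_homogeneous(2)[OF a] by simp
      then show ?thesis using * z Fil_subset[OF y] Fil_subset[OF x] by (simp add: leading_def)
    qed
  qed
qed

lemma gr_degree_closed: "f \<in> carrier gr \<Longrightarrow> gr_degree P e f \<in> carrier gr"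
proof -
  assume f: "f \<in> carrier gr"
  have "{p. gr_degree P e f p \<noteq> Fil (Suc p)} \<subseteq> {p. f p \<noteq> Fil (Suc p)}" by (auto simp: gr_degree_def)
  then have "finite {p. gr_degree P e f p \<noteq> Fil (Suc p)}"
    by (rule finite_subset) (use f in \<open>simp add: gr_simps\<close>)
  moreover have "gr_degree P e f p \<in> carrier (gr_part M Fil p)" for p
  proof -
    interpret Q: vectorspace k "gr_part M Fil p" by (rule vectorspace_gr_part)
    show ?thesis using f Q.M.zero_closed by (simp add: gr_degree_def gr_simps gr_part_simps(2))
  qed
  ultimately show ?thesis by (simp add: gr_simps)
qed

lemma gr_degree_add:
  "gr_degree P e (f \<oplus>\<^bsub>gr\<^esub> g) = gr_degree P e f \<oplus>\<^bsub>gr\<^esub> gr_degree P e g"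
proof
  fix p
  interpret Q: vectorspace k "gr_part M Fil p" by (rule vectorspace_gr_part)
  have "Fil (Suc p) <+>\<^bsub>M\<^esub> Fil (Suc p) = Fil (Suc p)"
    using Q.M.r_zero[OF Q.M.zero_closed] by (simp add: gr_part_simps(2,3))
  then show "gr_degree P e (f \<oplus>\<^bsub>gr\<^esub> g) p = (gr_degree P e f \<oplus>\<^bsub>gr\<^esub> gr_degree P e g) p"
    by (simp add: gr_degree_def gr_simps(3) gr_part_simps(3))
qed

lemma gr_degree_additive: "additive_map gr gr (gr_degree P e)"
  by (simp add: additive_map_def gr_degree_closed gr_degree_add)

lemma gr_degree_smult:
  assumes a: "a \<in> twist R A e d" and f: "f \<in> carrier gr"
  shows "gr_degree P e (a \<odot>\<^bsub>gr\<^esub> f) = a \<odot>\<^bsub>gr\<^esub> gr_degree P d f"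
proof
  fix p
  obtain x where x: "\<And>p. x p \<in> Fil p" "f = (\<lambda>p. Fil (Suc p) +>\<^bsub>M\<^esub> x p)" using gr_lift[OF f] by metis
  have z: "Fil (Suc q) +>\<^bsub>M\<^esub> \<zero>\<^bsub>M\<^esub> = Fil (Suc q)" for q using Fil_coset_eq_self_iff[of "\<zero>\<^bsub>M\<^esub>"] Fil_zero by simp
  define y where "y p = (if p + d = P then x p else \<zero>\<^bsub>M\<^esub>)" for p
  have y: "y p \<in> Fil p" for p using x Fil_zero by (auto simp: y_def)
  have fy: "gr_degree P d f = (\<lambda>p. Fil (Suc p) +>\<^bsub>M\<^esub> y p)" using z by (intro ext) (simp add: gr_degree_def x(2) y_def)
  have aR: "a \<in> carrier R" using twist_R_carrier[OF a] .
  note 1 = gr_smult_lift[OF twist_homogeneous(1)[OF a] f x, of p]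
  note 2 = gr_smult_lift[OF twist_homogeneous(1)[OF a] gr_degree_closed[OF f] y fy, of p]
  show "gr_degree P e (a \<odot>\<^bsub>gr\<^esub> f) p = (a \<odot>\<^bsub>gr\<^esub> gr_degree P d f) p"
  proof (cases "e \<le> d")
    case True
    then show ?thesis using 1 2 aR z by (auto simp: gr_degree_def y_def)
  next
    case False
    then have "a = \<zero>" using twist_homogeneous(2)[OF a] by simp
    then show ?thesis using 1 2 z Fil_subset[OF x(1)] Fil_subset[OF y] by (simp add: gr_degree_def)
  qed
qed

lemma gr_degree_leading: "gr_degree P e (leading Q e y) = (if P = Q then leading Q e y else \<zero>\<^bsub>gr\<^esub>)"
  by (intro ext) (simp add: gr_degree_def leading_def gr_simps(2))

text \<open>Homogeneity becomes a fixed-point equation of an additive projection. This form is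
  stable under linear combinations and compatible with the differentials.\<close>

lemma twist_gr_iff:
  "f \<in> twist gr (assoc_grading R A M Fil) e P \<longleftrightarrow> f \<in> carrier gr \<and> gr_degree P e f = f"
proof (cases "e \<le> P")
  case True
  have "gr_degree P e f = f \<longleftrightarrow> (\<forall>q. q \<noteq> P - e \<longrightarrow> f q = Fil (Suc q))"
    using True by (auto simp: gr_degree_def fun_eq_iff)
  then show ?thesis using True by (simp add: twist_def assoc_grading_def gr_part_simps(2))
next
  case False
  interpret W: vectorspace k gr by (rule vectorspace_gr)
  have "gr_degree P e f = \<zero>\<^bsub>gr\<^esub>" using False by (auto simp: gr_degree_def gr_simps(2))
  then show ?thesis using False W.M.zero_closed by (auto simp: twist_def)
qed

lemma gr_degree_lift:
  assumes "f \<in> carrier gr"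
  obtains y where "y \<in> Fil (P - e)" "gr_degree P e f = leading P e y"
proof -
  obtain x where x: "\<And>p. x p \<in> Fil p" "f = (\<lambda>p. Fil (Suc p) +>\<^bsub>M\<^esub> x p)" using gr_lift[OF assms] by metis
  have "gr_degree P e f = leading P e (x (P - e))"
    by (intro ext) (auto simp: gr_degree_def leading_def x(2))
  then show ?thesis using that x(1) by blast
qed

section \<open>Filtration and leading classes on powers\<close>

abbreviation "PM n \<equiv> power_module M n"
abbreviation "Pgr n \<equiv> power_module gr n"

lemma vectorspace_PM: "vectorspace k (PM n)"
  by (rule vectorspace_power_module[OF vectorspace_M])

lemma vectorspace_Pgr: "vectorspace k (Pgr n)"
  by (rule vectorspace_power_module[OF vectorspace_gr])

lemma module_PM: "module R (PM n)"
  by (rule module_power_module[OF module_axioms])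

lemma module_gr: "module k gr"
  using vectorspace_gr by (simp add: vectorspace_def)

text \<open>Step \<open>P\<close> of the filtration on the direct sum of the twists M(-d l). The
  shift by \<open>d l\<close> is chosen so that homogeneous matrices preserve the
  filtration.\<close>

definition Fil_power :: "(nat \<Rightarrow> nat) \<Rightarrow> nat \<Rightarrow> nat \<Rightarrow> (nat \<Rightarrow> 'b) set" where
  "Fil_power d n P = (\<Pi>\<^sub>E l\<in>{..<n}. Fil (P - d l))"

definition leading_power :: "(nat \<Rightarrow> nat) \<Rightarrow> nat \<Rightarrow> nat \<Rightarrow> (nat \<Rightarrow> 'b) \<Rightarrow> nat \<Rightarrow> nat \<Rightarrow> 'b set" where
  "leading_power d n P v = (\<lambda>l\<in>{..<n}. leading P (d l) (v l))"

definition gr_degree_power ::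
  "(nat \<Rightarrow> nat) \<Rightarrow> nat \<Rightarrow> nat \<Rightarrow> (nat \<Rightarrow> nat \<Rightarrow> 'b set) \<Rightarrow> nat \<Rightarrow> nat \<Rightarrow> 'b set" where
  "gr_degree_power d n P x = (\<lambda>l\<in>{..<n}. gr_degree P (d l) (x l))"

lemma Fil_power_memD: "v \<in> Fil_power d n P \<Longrightarrow> l < n \<Longrightarrow> v l \<in> Fil (P - d l)"
  by (auto simp: Fil_power_def)

lemma Fil_power_carrier: "v \<in> Fil_power d n P \<Longrightarrow> v \<in> carrier (PM n)"
  using Fil_subset by (fastforce simp: Fil_power_def power_module_simps PiE_iff)

lemma Fil_powerI: "v \<in> carrier (PM n) \<Longrightarrow> (\<And>l. l < n \<Longrightarrow> v l \<in> Fil (P - d l)) \<Longrightarrow> v \<in> Fil_power d n P"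
  by (auto simp: Fil_power_def power_module_simps PiE_iff)

lemma Fil_power_0: "Fil_power d n 0 = carrier (PM n)"
  by (simp add: Fil_power_def power_module_simps Fil_0)

lemma tclosed_Fil_power: "tclosed (PM n) (carrier R) (Fil_power d n P)"
proof -
  interpret P: module R "PM n" by (rule module_PM)
  show ?thesis
  proof (rule tclosedI)
    show "Fil_power d n P \<subseteq> carrier (PM n)" using Fil_power_carrier by blast
    show "\<zero>\<^bsub>PM n\<^esub> \<in> Fil_power d n P" by (rule Fil_powerI) (simp_all add: power_module_simps(2) Fil_zero P.M.zero_closed[unfolded power_module_simps(2)])
    fix x y assume h: "x \<in> Fil_power d n P" "y \<in> Fil_power d n P"
    show "x \<oplus>\<^bsub>PM n\<^esub> y \<in> Fil_power d n P"
      by (rule Fil_powerI)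
        (use h Fil_power_carrier Fil_power_memD in \<open>auto simp: power_module_simps(3) Fil_add intro: P.M.a_closed[unfolded power_module_simps(3)]\<close>)
  next
    fix t x assume h: "t \<in> carrier R" "x \<in> Fil_power d n P"
    show "t \<odot>\<^bsub>PM n\<^esub> x \<in> Fil_power d n P"
      by (rule Fil_powerI)
        (use h Fil_power_carrier Fil_power_memD in \<open>auto simp: power_module_simps(4) Fil_smult intro: P.smult_closed[unfolded power_module_simps(4)]\<close>)
  qed
qed

lemma tclosed_restrict_k: "tclosed V (carrier R) N \<Longrightarrow> tclosed V (carrier k) N"
  using A_0_subset by (auto simp: tclosed_def)

lemma leading_power_closed: "v \<in> Fil_power d n P \<Longrightarrow> leading_power d n P v \<in> carrier (Pgr n)"
  using leading_closed Fil_power_memD by (auto simp: leading_power_def power_module_simps)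

lemma leading_power_add:
  assumes "v \<in> Fil_power d n P" "w \<in> Fil_power d n P"
  shows "leading_power d n P (v \<oplus>\<^bsub>PM n\<^esub> w) = leading_power d n P v \<oplus>\<^bsub>Pgr n\<^esub> leading_power d n P w"
  using leading_add[OF Fil_power_memD[OF assms(1)] Fil_power_memD[OF assms(2)]]
  by (auto simp: leading_power_def power_module_simps intro!: restrict_ext)

lemma leading_power_smult:
  assumes "v \<in> Fil_power d n P" "t \<in> A 0"
  shows "leading_power d n P (t \<odot>\<^bsub>PM n\<^esub> v) = t \<odot>\<^bsub>Pgr n\<^esub> leading_power d n P v"
proof -
  have t: "t \<in> twist R A e e" for e using assms(2) by (simp add: twist_def)
  show ?thesis
    using leading_smult[OF t Fil_power_memD[OF assms(1)]]
    by (auto simp: leading_power_def power_module_simps intro!: restrict_ext)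
qed

text \<open>Together with the lifting of degree parts below, this identifies step \<open>P\<close>
  modulo step \<open>P + 1\<close> with the degree \<open>P\<close> part of the twisted power of the
  associated graded module.\<close>

lemma leading_power_eq_zero_iff:
  assumes "v \<in> Fil_power d n P"
  shows "leading_power d n P v = \<zero>\<^bsub>Pgr n\<^esub> \<longleftrightarrow> v \<in> Fil_power d n (Suc P)"
proof -
  have "leading_power d n P v = \<zero>\<^bsub>Pgr n\<^esub> \<longleftrightarrow> (\<forall>l<n. leading P (d l) (v l) = \<zero>\<^bsub>gr\<^esub>)"
    by (auto simp: leading_power_def power_module_simps(2) fun_eq_iff)
  also have "\<dots> \<longleftrightarrow> (\<forall>l<n. v l \<in> Fil (Suc P - d l))"
    using leading_eq_zero_iff[OF Fil_power_memD[OF assms]] by auto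
  also have "\<dots> \<longleftrightarrow> v \<in> Fil_power d n (Suc P)"
    using Fil_powerI[OF Fil_power_carrier[OF assms]] Fil_power_memD by blast
  finally show ?thesis .
qed

lemma leading_power_minus:
  assumes "v \<in> Fil_power d n P" "w \<in> Fil_power d n P"
  shows "leading_power d n P (v \<ominus>\<^bsub>PM n\<^esub> w) = leading_power d n P v \<ominus>\<^bsub>Pgr n\<^esub> leading_power d n P w"
proof -
  interpret V: vectorspace k "PM n" by (rule vectorspace_PM)
  interpret W: vectorspace k "Pgr n" by (rule vectorspace_Pgr)
  have vw: "v \<ominus>\<^bsub>PM n\<^esub> w \<in> Fil_power d n P"
    by (rule V.tclosed_diff[OF tclosed_restrict_k[OF tclosed_Fil_power] assms])
  note c = Fil_power_carrier[OF assms(1)] Fil_power_carrier[OF assms(2)]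
  have "v = (v \<ominus>\<^bsub>PM n\<^esub> w) \<oplus>\<^bsub>PM n\<^esub> w" using c by (simp add: V.M.minus_eq V.M.a_assoc V.M.l_neg)
  then have "leading_power d n P v = leading_power d n P (v \<ominus>\<^bsub>PM n\<^esub> w) \<oplus>\<^bsub>Pgr n\<^esub> leading_power d n P w"
    using leading_power_add[OF vw assms(2)] by simp
  then show ?thesis
    using leading_power_closed[OF vw] leading_power_closed[OF assms(2)]
    by (simp add: W.M.minus_eq W.M.a_assoc W.M.r_neg)
qed

lemma gr_degree_power_closed: "x \<in> carrier (Pgr n) \<Longrightarrow> gr_degree_power d n P x \<in> carrier (Pgr n)"
  using gr_degree_closed by (auto simp: gr_degree_power_def power_module_simps)

lemma gr_degree_power_add:
  "gr_degree_power d n P (x \<oplus>\<^bsub>Pgr n\<^esub> y) = gr_degree_power d n P x \<oplus>\<^bsub>Pgr n\<^esub> gr_degree_power d n P y"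
  by (auto simp: gr_degree_power_def power_module_simps gr_degree_add intro!: restrict_ext)

lemma gr_degree_power_smult:
  assumes "x \<in> carrier (Pgr n)" "t \<in> A 0"
  shows "gr_degree_power d n P (t \<odot>\<^bsub>Pgr n\<^esub> x) = t \<odot>\<^bsub>Pgr n\<^esub> gr_degree_power d n P x"
proof -
  have t: "t \<in> twist R A e e" for e using assms(2) by (simp add: twist_def)
  show ?thesis
    using gr_degree_smult[OF t power_module_memD[OF assms(1)]]
    by (auto simp: gr_degree_power_def power_module_simps intro!: restrict_ext)
qed

lemma gr_degree_power_zero: "gr_degree_power d n P \<zero>\<^bsub>Pgr n\<^esub> = \<zero>\<^bsub>Pgr n\<^esub>"
  by (auto simp: gr_degree_power_def power_module_simps gr_degree_def gr_simps(2) intro!: restrict_ext)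

lemma gr_degree_power_leading:
  "gr_degree_power d n P (leading_power d n Q v) = (if P = Q then leading_power d n Q v else \<zero>\<^bsub>Pgr n\<^esub>)"
  by (auto simp: gr_degree_power_def leading_power_def power_module_simps gr_degree_leading intro!: restrict_ext)

lemma gr_degree_power_lift:
  assumes "x \<in> carrier (Pgr n)"
  obtains v where "v \<in> Fil_power d n P" "gr_degree_power d n P x = leading_power d n P v"
proof -
  have "\<forall>l. \<exists>y. l < n \<longrightarrow> y \<in> Fil (P - d l) \<and> gr_degree P (d l) (x l) = leading P (d l) y"
    using gr_degree_lift[OF power_module_memD[OF assms]] by metis
  then obtain y where y: "\<forall>l. l < n \<longrightarrow> y l \<in> Fil (P - d l) \<and> gr_degree P (d l) (x l) = leading P (d l) (y l)"
    unfolding choice_iff ..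
  show ?thesis
  proof (rule that)
    show "(\<lambda>l\<in>{..<n}. y l) \<in> Fil_power d n P" using y by (simp add: Fil_power_def)
    show "gr_degree_power d n P x = leading_power d n P (\<lambda>l\<in>{..<n}. y l)"
      using y by (auto simp: gr_degree_power_def leading_power_def intro!: restrict_ext)
  qed
qed

lemma linear_scalar_gr_twist: "a \<in> twist R A e d \<Longrightarrow> linear_scalar k gr a"
  by (rule linear_scalar_gr[OF twist_homogeneous(1)])

lemma linear_scalar_M_twist: "a \<in> twist R A e d \<Longrightarrow> linear_scalar R M a"
  by (rule linear_scalar_carrier[OF twist_R_carrier])

text \<open>The associated graded complex of the filtered one is thus given by the same matrices,
  acting on the associated graded module.\<close>

lemma matrix_map_Fil_power:
  assumes \<phi>: "\<And>r c. r < m \<Longrightarrow> c < n \<Longrightarrow> \<phi> r c \<in> twist R A (e r) (d c)" and v: "v \<in> Fil_power d n P"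
  shows "matrix_map M m n \<phi> v \<in> Fil_power e m P"
    "matrix_map gr m n \<phi> (leading_power d n P v) = leading_power e m P (matrix_map M m n \<phi> v)"
proof -
  have t: "\<phi> r c \<odot>\<^bsub>M\<^esub> v c \<in> Fil (P - e r)" if "r < m" "c < n" for r c
    using twist_smult_Fil[OF \<phi>[OF that] Fil_power_memD[OF v that(2)]] .
  have s: "(\<Oplus>\<^bsub>M\<^esub>c\<in>{..<n}. \<phi> r c \<odot>\<^bsub>M\<^esub> v c) \<in> Fil (P - e r) \<and>
      leading P (e r) (\<Oplus>\<^bsub>M\<^esub>c\<in>{..<n}. \<phi> r c \<odot>\<^bsub>M\<^esub> v c) = (\<Oplus>\<^bsub>gr\<^esub>c\<in>{..<n}. leading P (e r) (\<phi> r c \<odot>\<^bsub>M\<^esub> v c))" if "r < m" for r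
    by (rule leading_finsum) (use t that in auto)
  show "matrix_map M m n \<phi> v \<in> Fil_power e m P" using s by (simp add: Fil_power_def matrix_map_def)
  interpret W: vectorspace k gr by (rule vectorspace_gr)
  have "(\<Oplus>\<^bsub>gr\<^esub>c\<in>{..<n}. \<phi> r c \<odot>\<^bsub>gr\<^esub> leading_power d n P v c) =
      (\<Oplus>\<^bsub>gr\<^esub>c\<in>{..<n}. leading P (e r) (\<phi> r c \<odot>\<^bsub>M\<^esub> v c))" if "r < m" for r
    by (rule W.M.finsum_cong')
      (use leading_smult[OF \<phi>[OF that] Fil_power_memD[OF v]] leading_closed[OF t[OF that]] in \<open>auto simp: leading_power_def\<close>)
  then show "matrix_map gr m n \<phi> (leading_power d n P v) = leading_power e m P (matrix_map M m n \<phi> v)"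
    using s by (auto simp: matrix_map_def leading_power_def[of e m] intro!: restrict_ext)
qed

lemma matrix_map_gr_degree_power:
  assumes \<phi>: "\<And>r c. r < m \<Longrightarrow> c < n \<Longrightarrow> \<phi> r c \<in> twist R A (e r) (d c)" and x: "x \<in> carrier (Pgr n)"
  shows "gr_degree_power e m P (matrix_map gr m n \<phi> x) = matrix_map gr m n \<phi> (gr_degree_power d n P x)"
proof -
  interpret W: vectorspace k gr by (rule vectorspace_gr)
  have t: "\<phi> r c \<odot>\<^bsub>gr\<^esub> x c \<in> carrier gr" if "r < m" "c < n" for r c
    using linear_scalarD(1)[OF linear_scalar_gr_twist[OF \<phi>[OF that]] power_module_memD[OF x that(2)]] .
  have "gr_degree P (e r) (\<Oplus>\<^bsub>gr\<^esub>c\<in>{..<n}. \<phi> r c \<odot>\<^bsub>gr\<^esub> x c) = (\<Oplus>\<^bsub>gr\<^esub>c\<in>{..<n}. \<phi> r c \<odot>\<^bsub>gr\<^esub> gr_degree_power d n P x c)"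
    if r: "r < m" for r
  proof -
    have eq: "gr_degree P (e r) (\<phi> r c \<odot>\<^bsub>gr\<^esub> x c) = \<phi> r c \<odot>\<^bsub>gr\<^esub> gr_degree P (d c) (x c)" if "c < n" for c
      using gr_degree_smult[OF \<phi>[OF r that] power_module_memD[OF x that]] .
    have "gr_degree P (e r) (\<Oplus>\<^bsub>gr\<^esub>c\<in>{..<n}. \<phi> r c \<odot>\<^bsub>gr\<^esub> x c) = (\<Oplus>\<^bsub>gr\<^esub>c\<in>{..<n}. gr_degree P (e r) (\<phi> r c \<odot>\<^bsub>gr\<^esub> x c))"
      by (rule additive_map_finsum[OF W.M.abelian_group_axioms W.M.abelian_group_axioms gr_degree_additive])
        (use t[OF r] in auto)
    also have "\<dots> = (\<Oplus>\<^bsub>gr\<^esub>c\<in>{..<n}. \<phi> r c \<odot>\<^bsub>gr\<^esub> gr_degree_power d n P x c)"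
      by (rule W.M.finsum_cong')
        (use eq gr_degree_closed[OF t[OF r]] in \<open>auto simp: gr_degree_power_def simp flip: eq\<close>)
    finally show ?thesis .
  qed
  then show ?thesis by (auto simp: matrix_map_def gr_degree_power_def[of e m] intro!: restrict_ext)
qed

lemma power_comp_Fil_power:
  assumes "v \<in> Fil_power d n P"
  shows "power_comp d n j v \<in> Fil_power d n P"
  using Fil_graded[OF Fil_power_memD[OF assms]] Fil_zero by (auto simp: Fil_power_def power_comp_def)

lemma tclosed_power_grading: "tclosed (PM n) (carrier k) (power_grading d n j)"
proof -
  interpret g: graded_group "PM n" "power_grading d n" by (rule graded_group_power)
  show ?thesis
  proof (rule tclosedI)
    fix t x assume t: "t \<in> carrier k" and x: "x \<in> power_grading d n j"
    have t: "t \<in> twist R A (d l) (d l)" for l using t by (simp add: twist_def)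
    have "x l \<in> twist M G (d l) j" if "l < n" for l using x that by (auto simp: power_grading_def)
    then show "t \<odot>\<^bsub>PM n\<^esub> x \<in> power_grading d n j"
      using twist_smult[OF t] by (simp add: power_grading_def power_module_simps)
  qed (use g.G_subset g.G_zero g.G_add in auto)
qed

lemma power_comp_power_grading:
  "x \<in> power_grading d n i \<Longrightarrow> power_comp d n j x = (if j = i then x else \<zero>\<^bsub>PM n\<^esub>)"
  using graded_group.comp_hom[OF graded_group_power, of x d n i j]
    power_graded(2)[of x n d j] graded_group.G_subset[OF graded_group_power, of x d n i] by simp

lemma power_comp_in: "x \<in> carrier (PM n) \<Longrightarrow> power_comp d n j x \<in> power_grading d n j"
  using graded_group.comp_in[OF graded_group_power, of x n d j] power_graded(2)[of x n d j] by simp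

lemma power_comp_mem_imp:
  assumes "x \<in> carrier (PM n)" "\<zero>\<^bsub>PM n\<^esub> \<in> N" "\<And>u v. u \<in> N \<Longrightarrow> v \<in> N \<Longrightarrow> u \<oplus>\<^bsub>PM n\<^esub> v \<in> N"
    "\<And>j. power_comp d n j x \<in> N"
  shows "x \<in> N"
  using graded_group.comp_mem_imp[OF graded_group_power assms(1-3), of d] assms(4) power_graded(2)[OF assms(1), of d]
  by simp

lemma power_grading_finite_span:
  assumes fin: "\<And>j. \<exists>Y. finite Y \<and> Y \<subseteq> G j \<and> G j \<subseteq> tspan M (A 0) Y"
  shows "\<exists>Y. finite Y \<and> Y \<subseteq> carrier (PM n) \<and> power_grading d n j \<subseteq> tspan (PM n) (A 0) Y"
proof -
  interpret g: graded_group M G by (rule graded_group_M)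
  obtain Y where Y: "\<And>j. finite (Y j)" "\<And>j. Y j \<subseteq> G j" "\<And>j. G j \<subseteq> tspan M (A 0) (Y j)"
    using fin by metis
  define s where "s m y = (\<lambda>l\<in>{..<n}. if l = m then y else \<zero>\<^bsub>M\<^esub>)" for m and y :: 'b
  \<comment> \<open>Coordinate \<open>m\<close> of a vector of degree \<open>j\<close> has internal
    degree \<open>j - d m\<close>. When \<open>j < d m\<close> that coordinate is zero, and the
    vectors that truncated subtraction contributes only enlarge the span.\<close>
  define X where "X = (\<Union>m\<in>{..<n}. s m ` Y (j - d m))"
  have fX: "finite X" using Y(1) by (simp add: X_def)
  have XP: "X \<subseteq> carrier (PM n)" 
  proof -
    have "s m y \<in> carrier (PM n)" if "y \<in> Y i" for m y i
      using g.G_subset[of y i] Y(2)[of i] that by (auto simp: s_def power_module_simps)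
    then show ?thesis by (auto simp: X_def)
  qed
  have span: "s m y \<in> tspan (PM n) (A 0) X" if m: "m < n" and "y \<in> tspan M (A 0) (Y (j - d m))" for m y
    using that(2)
  proof (induct rule: tspan.induct)
    case tspan_zero
    have "s m \<zero>\<^bsub>M\<^esub> = \<zero>\<^bsub>PM n\<^esub>" by (auto simp: s_def power_module_simps intro!: restrict_ext)
    then show ?case using tspan.tspan_zero by metis
  next
    case (tspan_base y)
    then show ?case using m by (intro tspan.tspan_base) (auto simp: X_def)
  next
    case (tspan_add x y)
    have "s m (x \<oplus>\<^bsub>M\<^esub> y) = s m x \<oplus>\<^bsub>PM n\<^esub> s m y" by (auto simp: s_def power_module_simps intro!: restrict_ext)
    then show ?case using tspan.tspan_add[OF tspan_add(2,4)] by simp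
  next
    case (tspan_smult t x)
    have "s m (t \<odot>\<^bsub>M\<^esub> x) = t \<odot>\<^bsub>PM n\<^esub> s m x"
      using k_carrier[OF tspan_smult(1)] by (auto simp: s_def power_module_simps intro!: restrict_ext)
    then show ?case using tspan.tspan_smult[OF tspan_smult(1,3)] by simp
  qed
  have "power_grading d n j \<subseteq> tspan (PM n) (A 0) X"
  proof
    fix x assume x: "x \<in> power_grading d n j"
    show "x \<in> tspan (PM n) (A 0) X"
    proof (rule power_module_mem_imp[OF module_axioms _ tspan_zero tspan_add])
      show "x \<in> carrier (PM n)" using x graded_group.G_subset[OF graded_group_power] by blast
      fix m assume m: "m < n"
      have "x m \<in> twist M G (d m) j" using x m by (auto simp: power_grading_def)
      then have "x m \<in> tspan M (A 0) (Y (j - d m))" using Y(3) tspan_zero[of M "A 0"] by (auto simp: twist_def split: if_splits)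
      then show "(\<lambda>l\<in>{..<n}. if l = m then x m else \<zero>\<^bsub>M\<^esub>) \<in> tspan (PM n) (A 0) X"
        using span[OF m] by (simp add: s_def)
    qed
  qed
  then show ?thesis using fX XP by blast
qed

lemma twist_gr_power:
  "(\<Pi>\<^sub>E l\<in>{..<n}. twist gr (assoc_grading R A M Fil) (d l) P) = {x \<in> carrier (Pgr n). gr_degree_power d n P x = x}"
proof (intro Set.set_eqI iffI)
  fix x assume "x \<in> (\<Pi>\<^sub>E l\<in>{..<n}. twist gr (assoc_grading R A M Fil) (d l) P)"
  then have x: "x \<in> extensional {..<n}" "\<And>l. l < n \<Longrightarrow> x l \<in> carrier gr \<and> gr_degree P (d l) (x l) = x l"
    by (auto simp: PiE_iff twist_gr_iff)
  then have "x \<in> carrier (Pgr n)" by (simp add: power_module_simps PiE_iff)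
  moreover have "gr_degree_power d n P x = x"
    by (rule power_module_eqI[OF gr_degree_power_closed[OF calculation] calculation]) (use x in \<open>simp add: gr_degree_power_def\<close>)
  ultimately show "x \<in> {x \<in> carrier (Pgr n). gr_degree_power d n P x = x}" by simp
next
  fix x assume "x \<in> {x \<in> carrier (Pgr n). gr_degree_power d n P x = x}"
  then have x: "x \<in> carrier (Pgr n)" "gr_degree_power d n P x = x" by auto
  have "gr_degree P (d l) (x l) = x l" if "l < n" for l
    using fun_cong[OF x(2), of l] that by (simp add: gr_degree_power_def)
  then show "x \<in> (\<Pi>\<^sub>E l\<in>{..<n}. twist gr (assoc_grading R A M Fil) (d l) P)"
    using x(1) by (auto simp: PiE_iff twist_gr_iff power_module_simps)
qed

end

section \<open>Comparing the Tor modules\<close>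

context module
begin

lemma tclosed_tor_cycles:
  assumes "\<And>i r c. r < rk F i \<Longrightarrow> c < rk F (Suc i) \<Longrightarrow> linear_scalar R M (dmat F i r c)"
  shows "tclosed (power_module M (rk F i)) (carrier R) (tor_cycles M F i)"
proof (cases i)
  case 0
  interpret P: module R "power_module M (rk F i)" by (rule module_power_module) (rule module_axioms)
  have "tor_cycles M F i = carrier (power_module M (rk F i))" using 0 by (simp add: tor_cycles_def)
  then show ?thesis by (simp add: tclosed_def)
next
  case (Suc n)
  show ?thesis
    using tclosed_matrix_map_kernel[of "rk F n" "rk F i" "dmat F n"] assms
    by (simp add: Suc tor_cycles_def res_map_def)
qed

lemma tclosed_tor_boundaries:
  assumes "\<And>i r c. r < rk F i \<Longrightarrow> c < rk F (Suc i) \<Longrightarrow> linear_scalar R M (dmat F i r c)"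
  shows "tclosed (power_module M (rk F i)) (carrier R) (tor_boundaries M F i)"
  using tclosed_matrix_map_image[of "rk F i" "rk F (Suc i)" "dmat F i"] assms
  by (simp add: tor_boundaries_def res_map_def)

end

lemma tor_res_degree_eq:
  "tor_res_degree N G F i j =
    subquotient (power_module N (rk F i)) (tor_cycles N F i \<inter> tensor_degree_part N G F i j) (tor_boundaries N F i)"
  by (simp add: tor_res_degree_def tor_res_def subquotient_def)

text \<open>Homogeneity makes the differentials respect degrees and filtration steps; the vanishing
  of the matrix products makes boundaries cycles. Both are fixed over \<open>R\<close>, so that
  \<open>M\<close> and its associated graded module share them.\<close>

locale filtered_complex = stable_graded_filtration R A M G Fil
  for R :: "('a, 'r) ring_scheme" (structure) and A :: "nat \<Rightarrow> 'a set"
    and M :: "('a, 'b, 'm) module_scheme" (structure) and G :: "nat \<Rightarrow> 'b set" and Fil :: "nat \<Rightarrow> 'b set" +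
  fixes F :: "('a, 'c) free_res"
  assumes dmat_homogeneous:
      "r < rk F i \<Longrightarrow> c < rk F (Suc i) \<Longrightarrow> dmat F i r c \<in> twist R A (gen_deg F i r) (gen_deg F (Suc i) c)"
    and dmat_comp: "r < rk F i \<Longrightarrow> s < rk F (Suc (Suc i)) \<Longrightarrow>
      (\<Oplus>c\<in>{..<rk F (Suc i)}. dmat F i r c \<otimes> dmat F (Suc i) c s) = \<zero>"
begin

abbreviation "Z i \<equiv> tor_cycles M F i"
abbreviation "B i \<equiv> tor_boundaries M F i"
abbreviation "Zgr i \<equiv> tor_cycles gr F i"
abbreviation "Bgr i \<equiv> tor_boundaries gr F i"
abbreviation "U i P \<equiv> Fil_power (gen_deg F i) (rk F i) P"
abbreviation "W i j \<equiv> power_grading (gen_deg F i) (rk F i) j"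
abbreviation "lead i P \<equiv> leading_power (gen_deg F i) (rk F i) P"
abbreviation "proj i P \<equiv> gr_degree_power (gen_deg F i) (rk F i) P"
abbreviation "part i j \<equiv> power_comp (gen_deg F i) (rk F i) j"

lemma tensor_degree_part_M: "tensor_degree_part M G F i j = W i j"
  by (simp add: tensor_degree_part_def power_grading_def)

lemma tensor_degree_part_gr:
  "tensor_degree_part gr (assoc_grading R A M Fil) F i P = {x \<in> carrier (Pgr (rk F i)). proj i P x = x}"
  by (simp add: tensor_degree_part_def twist_gr_power)

lemma linear_scalar_M: "r < rk F i \<Longrightarrow> c < rk F (Suc i) \<Longrightarrow> linear_scalar R M (dmat F i r c)"
  by (rule linear_scalar_M_twist[OF dmat_homogeneous])

lemma linear_scalar_gr_k: "r < rk F i \<Longrightarrow> c < rk F (Suc i) \<Longrightarrow> linear_scalar k gr (dmat F i r c)"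
  by (rule linear_scalar_gr_twist[OF dmat_homogeneous])

lemma tclosed_Z_R: "tclosed (PM (rk F i)) (carrier R) (Z i)"
  by (rule tclosed_tor_cycles[OF linear_scalar_M])

lemma tclosed_B_R: "tclosed (PM (rk F i)) (carrier R) (B i)"
  by (rule tclosed_tor_boundaries[OF linear_scalar_M])

lemmas tclosed_Z = tclosed_restrict_k[OF tclosed_Z_R]
lemmas tclosed_B = tclosed_restrict_k[OF tclosed_B_R]

lemma tclosed_Zgr: "tclosed (Pgr (rk F i)) (carrier k) (Zgr i)"
  by (rule module.tclosed_tor_cycles[OF module_gr linear_scalar_gr_k])

lemma tclosed_Bgr: "tclosed (Pgr (rk F i)) (carrier k) (Bgr i)"
  by (rule module.tclosed_tor_boundaries[OF module_gr linear_scalar_gr_k])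

lemma tclosed_degree_gr: "tclosed (Pgr (rk F i)) (carrier k) {x \<in> carrier (Pgr (rk F i)). proj i P x = x}"
proof -
  interpret Wg: vectorspace k "Pgr (rk F i)" by (rule vectorspace_Pgr)
  show ?thesis
    by (rule tclosedI) (auto simp: gr_degree_power_zero gr_degree_power_add gr_degree_power_smult)
qed

lemma tclosed_Int: "tclosed V T X \<Longrightarrow> tclosed V T Y \<Longrightarrow> tclosed V T (X \<inter> Y)"
  by (auto simp: tclosed_def)

lemma tor_degree_M_eq_0_iff:
  "vdim k (tor_res_degree M G F i j) = 0 \<longleftrightarrow> Z i \<inter> W i j \<subseteq> B i"
  unfolding tor_res_degree_eq tensor_degree_part_M
  by (rule vectorspace.vdim_subquotient_eq_0_iff[OF vectorspace_PM tclosed_Int[OF tclosed_Z tclosed_power_grading] tclosed_B])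

lemma tor_degree_gr_eq_0_iff:
  "vdim k (tor_res_degree gr (assoc_grading R A M Fil) F i P) = 0 \<longleftrightarrow>
    Zgr i \<inter> {x \<in> carrier (Pgr (rk F i)). proj i P x = x} \<subseteq> Bgr i"
  unfolding tor_res_degree_eq tensor_degree_part_gr
  by (rule vectorspace.vdim_subquotient_eq_0_iff[OF vectorspace_Pgr tclosed_Int[OF tclosed_Zgr tclosed_degree_gr] tclosed_Bgr])

lemma Z_carrier: "z \<in> Z i \<Longrightarrow> z \<in> carrier (PM (rk F i))"
  by (simp add: tor_cycles_def)

lemma res_map_closed: "x \<in> carrier (PM (rk F (Suc i))) \<Longrightarrow> res_map M F i x \<in> carrier (PM (rk F i))"
  unfolding res_map_def by (rule matrix_map_closed[OF linear_scalar_M])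

lemma res_map_in_B: "x \<in> carrier (PM (rk F (Suc i))) \<Longrightarrow> res_map M F i x \<in> B i"
  by (simp add: tor_boundaries_def)

lemma B_subset_Z: "B i \<subseteq> Z i"
proof
  fix b assume "b \<in> B i"
  then obtain x where x: "x \<in> carrier (PM (rk F (Suc i)))" "b = res_map M F i x"
    by (auto simp: tor_boundaries_def)
  have "res_map M F n b = \<zero>\<^bsub>PM (rk F n)\<^esub>" if i: "i = Suc n" for n
  proof (rule power_module_eqI)
    interpret P: module R "PM (rk F n)" by (rule module_PM)
    show "res_map M F n b \<in> carrier (PM (rk F n))" using res_map_closed x i by simp
    show "\<zero>\<^bsub>PM (rk F n)\<^esub> \<in> carrier (PM (rk F n))" by simp
    fix r assume r: "r < rk F n"
    have d: "dmat F j r c \<in> carrier R" if "r < rk F j" "c < rk F (Suc j)" for j r c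
      by (rule twist_R_carrier[OF dmat_homogeneous[OF that]])
    have "res_map M F n b r =
        (\<Oplus>\<^bsub>M\<^esub>s\<in>{..<rk F (Suc (Suc n))}. (\<Oplus>c\<in>{..<rk F (Suc n)}. dmat F n r c \<otimes> dmat F (Suc n) c s) \<odot>\<^bsub>M\<^esub> x s)"
      unfolding x(2) res_map_def i
      by (rule matrix_map_comp) (use d r x(1) i in auto)
    also have "\<dots> = (\<Oplus>\<^bsub>M\<^esub>s\<in>{..<rk F (Suc (Suc n))}. \<zero>\<^bsub>M\<^esub>)"
      by (rule M.finsum_cong') (use dmat_comp[OF r] power_module_memD[OF x(1)] i in auto)
    also have "\<dots> = \<zero>\<^bsub>M\<^esub>" by (rule M.finsum_zero)
    finally show "res_map M F n b r = \<zero>\<^bsub>PM (rk F n)\<^esub> r" using r by (simp add: power_module_simps)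
  qed
  then show "b \<in> Z i" using x res_map_closed by (simp add: tor_cycles_def)
qed

lemma res_map_U: "u \<in> U (Suc i) P \<Longrightarrow> res_map M F i u \<in> U i P"
  and res_map_lead: "u \<in> U (Suc i) P \<Longrightarrow> res_map gr F i (lead (Suc i) P u) = lead i P (res_map M F i u)"
  unfolding res_map_def
  using matrix_map_Fil_power[of "rk F i" "rk F (Suc i)" "dmat F i" "gen_deg F i" "gen_deg F (Suc i)" u P,
      OF dmat_homogeneous] by simp_all

lemma res_map_part:
  "x \<in> carrier (PM (rk F (Suc i))) \<Longrightarrow> part i j (res_map M F i x) = res_map M F i (part (Suc i) j x)"
  unfolding res_map_def by (rule power_comp_matrix_map[OF dmat_homogeneous])

lemma res_map_proj:
  "x \<in> carrier (Pgr (rk F (Suc i))) \<Longrightarrow> proj i P (res_map gr F i x) = res_map gr F i (proj (Suc i) P x)"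
  unfolding res_map_def by (rule matrix_map_gr_degree_power[OF dmat_homogeneous])

lemma part_additive: "additive_map (PM (rk F i)) (PM (rk F i)) (part i j)"
proof -
  interpret g: graded_group "PM (rk F i)" "power_grading (gen_deg F i) (rk F i)" by (rule graded_group_power)
  show ?thesis
    using g.comp_additive[of j] power_graded(2)[of _ "rk F i" "gen_deg F i" j] g.comp_carrier g.a_closed
    by (simp add: additive_map_def)
qed

lemma part_closed: "x \<in> carrier (PM (rk F i)) \<Longrightarrow> part i j x \<in> carrier (PM (rk F i))"
  using additive_mapD(1)[OF part_additive] .

lemma part_Z:
  assumes z: "z \<in> Z i"
  shows "part i j z \<in> Z i"
proof -
  interpret P: module R "PM (rk F i)" by (rule module_PM)
  have "res_map M F n (part i j z) = \<zero>\<^bsub>PM (rk F n)\<^esub>" if i: "i = Suc n" for n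
  proof -
    interpret Pn: module R "PM (rk F n)" by (rule module_PM)
    have "res_map M F n (part i j z) = part n j (res_map M F n z)"
      using res_map_part[of z n j] Z_carrier[OF z] i by simp
    also have "res_map M F n z = \<zero>\<^bsub>PM (rk F n)\<^esub>" using z i by (simp add: tor_cycles_def)
    also have "part n j \<zero>\<^bsub>PM (rk F n)\<^esub> = \<zero>\<^bsub>PM (rk F n)\<^esub>"
      by (rule additive_map_zero[OF Pn.abelian_group_axioms Pn.abelian_group_axioms part_additive])
    finally show ?thesis .
  qed
  then show ?thesis using part_closed[OF Z_carrier[OF z]] by (simp add: tor_cycles_def)
qed

lemma lead_Z:
  assumes z: "z \<in> Z i" "z \<in> U i P"
  shows "lead i P z \<in> Zgr i"
proof -
  have "res_map gr F n (lead i P z) = \<zero>\<^bsub>Pgr (rk F n)\<^esub>" if i: "i = Suc n" for n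
  proof -
    have "res_map gr F n (lead i P z) = lead n P (res_map M F n z)" using res_map_lead z i by simp
    also have "res_map M F n z = \<zero>\<^bsub>PM (rk F n)\<^esub>" using z i by (simp add: tor_cycles_def)
    also have "lead n P \<zero>\<^bsub>PM (rk F n)\<^esub> = \<zero>\<^bsub>Pgr (rk F n)\<^esub>"
      using leading_power_eq_zero_iff tclosedD(2)[OF tclosed_Fil_power] by blast
    finally show ?thesis .
  qed
  then show ?thesis using leading_power_closed[OF z(2)] by (simp add: tor_cycles_def)
qed

text \<open>A preimage of the leading class is lifted to \<open>u\<close> in step \<open>P\<close>.
  Then \<open>z\<close> and the image of \<open>u\<close> have the same leading class, so their
  difference lies one step deeper.\<close>

lemma lift_boundary:
  assumes z: "z \<in> U i P" "lead i P z \<in> Bgr i"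
  obtains u where "u \<in> U (Suc i) P" "z \<ominus>\<^bsub>PM (rk F i)\<^esub> res_map M F i u \<in> U i (Suc P)"
proof -
  interpret V: vectorspace k "PM (rk F i)" by (rule vectorspace_PM)
  interpret Vg: vectorspace k "Pgr (rk F i)" by (rule vectorspace_Pgr)
  obtain y where y: "y \<in> carrier (Pgr (rk F (Suc i)))" "lead i P z = res_map gr F i y"
    using z(2) by (auto simp: tor_boundaries_def)
  obtain u where u: "u \<in> U (Suc i) P" "proj (Suc i) P y = lead (Suc i) P u"
    using gr_degree_power_lift[OF y(1)] by metis
  \<comment> \<open>Only the degree \<open>P\<close> part of the preimage \<open>y\<close> matters,
    since projection commutes with the differential and fixes the leading class.\<close>
  have "lead i P z = proj i P (lead i P z)" by (simp add: gr_degree_power_leading)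
  also have "\<dots> = res_map gr F i (lead (Suc i) P u)" using res_map_proj[OF y(1)] y(2) u(2) by simp
  also have "\<dots> = lead i P (res_map M F i u)" by (rule res_map_lead[OF u(1)])
  finally have "lead i P (z \<ominus>\<^bsub>PM (rk F i)\<^esub> res_map M F i u) = \<zero>\<^bsub>Pgr (rk F i)\<^esub>"
    using leading_power_minus[OF z(1) res_map_U[OF u(1)]] leading_power_closed[OF res_map_U[OF u(1)]]
    by (simp add: Vg.M.minus_eq Vg.M.r_neg)
  moreover have "z \<ominus>\<^bsub>PM (rk F i)\<^esub> res_map M F i u \<in> U i P"
    by (rule V.tclosed_diff[OF tclosed_restrict_k[OF tclosed_Fil_power] z(1) res_map_U[OF u(1)]])
  ultimately show ?thesis using that[OF u(1)] leading_power_eq_zero_iff by blast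
qed

text \<open>Passing to the degree \<open>j\<close> part of \<open>u\<close> keeps the correction
  homogeneous. It does not destroy the depth gained, because the filtration consists of graded
  submodules.\<close>

lemma lift_boundary_homogeneous:
  assumes z: "z \<in> U i P" "z \<in> W i j" "lead i P z \<in> Bgr i"
  obtains b where "b \<in> B i" "z \<ominus>\<^bsub>PM (rk F i)\<^esub> b \<in> U i (Suc P)" "z \<ominus>\<^bsub>PM (rk F i)\<^esub> b \<in> W i j"
proof -
  interpret P: module R "PM (rk F i)" by (rule module_PM)
  obtain u where u: "u \<in> U (Suc i) P" "z \<ominus>\<^bsub>PM (rk F i)\<^esub> res_map M F i u \<in> U i (Suc P)"
    using lift_boundary[OF z(1,3)] .
  have uc: "u \<in> carrier (PM (rk F (Suc i)))" by (rule Fil_power_carrier[OF u(1)])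
  have zc: "z \<in> carrier (PM (rk F i))" by (rule Fil_power_carrier[OF z(1)])
  let ?b = "res_map M F i (part (Suc i) j u)"
  have "part i j (z \<ominus>\<^bsub>PM (rk F i)\<^esub> res_map M F i u) = part i j z \<ominus>\<^bsub>PM (rk F i)\<^esub> part i j (res_map M F i u)"
    by (rule additive_map_minus[OF P.abelian_group_axioms P.abelian_group_axioms part_additive zc res_map_closed[OF uc]])
  also have "\<dots> = z \<ominus>\<^bsub>PM (rk F i)\<^esub> ?b"
    using res_map_part[OF uc, of j] power_comp_power_grading[OF z(2), of j] by simp
  finally have e: "z \<ominus>\<^bsub>PM (rk F i)\<^esub> ?b = part i j (z \<ominus>\<^bsub>PM (rk F i)\<^esub> res_map M F i u)" by simp
  show ?thesis
  proof (rule that)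
    show "?b \<in> B i" by (rule res_map_in_B[OF part_closed[OF uc]])
    show "z \<ominus>\<^bsub>PM (rk F i)\<^esub> ?b \<in> U i (Suc P)" unfolding e by (rule power_comp_Fil_power[OF u(2)])
    show "z \<ominus>\<^bsub>PM (rk F i)\<^esub> ?b \<in> W i j" unfolding e by (rule power_comp_in[OF Fil_power_carrier[OF u(2)]])
  qed
qed

text \<open>A generator degree shifts internal degree and filtration step alike and cancels from the
  comparison. Hence the constant \<open>c\<close> of \<open>M\<close> works for every coordinate and
  every homological degree.\<close>

lemma homogeneous_Fil_zero:
  assumes c: "\<forall>p j. \<forall>x\<in>Fil p \<inter> G j. j + c < p \<longrightarrow> x = \<zero>\<^bsub>M\<^esub>"
    and z: "z \<in> U i P" "z \<in> W i j" "j + c < P"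
  shows "z = \<zero>\<^bsub>PM (rk F i)\<^esub>"
proof (rule power_module_eqI)
  interpret P: module R "PM (rk F i)" by (rule module_PM)
  show "z \<in> carrier (PM (rk F i))" by (rule Fil_power_carrier[OF z(1)])
  show "\<zero>\<^bsub>PM (rk F i)\<^esub> \<in> carrier (PM (rk F i))" by simp
  fix l assume l: "l < rk F i"
  have zU: "z l \<in> Fil (P - gen_deg F i l)" by (rule Fil_power_memD[OF z(1) l])
  have zW: "z l \<in> twist M G (gen_deg F i l) j" using z(2) l by (auto simp: power_grading_def)
  have "z l = \<zero>\<^bsub>M\<^esub>"
  proof (cases "gen_deg F i l \<le> j")
    case True
    then show ?thesis using c[rule_format, of "z l" "P - gen_deg F i l" "j - gen_deg F i l"] zU zW z(3) by (auto simp: twist_def)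
  next
    case False
    then show ?thesis using zW by (simp add: twist_def)
  qed
  then show "z l = \<zero>\<^bsub>PM (rk F i)\<^esub> l" using l by (simp add: power_module_simps)
qed

section \<open>From the associated graded module to \<open>M\<close>\<close>

lemma high_degree_boundary:
  assumes c: "\<forall>p j. \<forall>x\<in>Fil p \<inter> G j. j + c < p \<longrightarrow> x = \<zero>\<^bsub>M\<^esub>"
    and gr0: "\<forall>P>C. Zgr i \<inter> {x \<in> carrier (Pgr (rk F i)). proj i P x = x} \<subseteq> Bgr i"
    and z: "z \<in> Z i" "z \<in> W i j" "z \<in> U i P" "P > C"
  shows "z \<in> B i"
  using z
\<comment> \<open>The measure counts the steps left until the cycle must vanish. Each correction
  keeps the degree \<open>j\<close> and raises \<open>P\<close> by one, and \<open>P\<close> stays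
  above \<open>C\<close>.\<close>
proof (induct "j + c + 1 - P" arbitrary: z P rule: less_induct)
  case less
  interpret V: vectorspace k "PM (rk F i)" by (rule vectorspace_PM)
  show ?case
  proof (cases "j + c < P")
    case True
    then have "z = \<zero>\<^bsub>PM (rk F i)\<^esub>" using homogeneous_Fil_zero[OF c less(4,3)] by blast
    then show ?thesis using tclosedD(2)[OF tclosed_B] by simp
  next
    case False
    have "lead i P z \<in> Bgr i"
      using gr0[rule_format, OF less(5)] lead_Z[OF less(2,4)] leading_power_closed[OF less(4)] by (auto simp: gr_degree_power_leading)
    then obtain b where b: "b \<in> B i" "z \<ominus>\<^bsub>PM (rk F i)\<^esub> b \<in> U i (Suc P)" "z \<ominus>\<^bsub>PM (rk F i)\<^esub> b \<in> W i j"
      using lift_boundary_homogeneous[OF less(4,3)] by metis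
    have "z \<ominus>\<^bsub>PM (rk F i)\<^esub> b \<in> B i"
    proof (rule less(1)[OF _ _ b(3,2)])
      show "z \<ominus>\<^bsub>PM (rk F i)\<^esub> b \<in> Z i"
        using V.tclosed_diff[OF tclosed_Z less(2)] b(1) B_subset_Z by blast
    qed (use False less(5) in auto)
    then have "(z \<ominus>\<^bsub>PM (rk F i)\<^esub> b) \<oplus>\<^bsub>PM (rk F i)\<^esub> b \<in> B i" by (rule tclosedD(3)[OF tclosed_B _ b(1)])
    moreover have "b \<in> carrier (PM (rk F i))" using b(1) B_subset_Z Z_carrier by blast
    ultimately show ?thesis using Z_carrier[OF less(2)] by (simp add: V.M.minus_eq V.M.a_assoc V.M.l_neg)
  qed
qed

text \<open>A vector of degree \<open>j\<close> lies in step \<open>j - c'\<close>, again because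
  the generator degrees cancel. For \<open>j > C + c'\<close> this step exceeds \<open>C\<close>,
  where all leading cycles are boundaries.\<close>

lemma tor_M_vanishes:
  assumes c: "\<forall>p j. \<forall>x\<in>Fil p \<inter> G j. j + c < p \<longrightarrow> x = \<zero>\<^bsub>M\<^esub>"
    and c': "\<And>j. G j \<subseteq> Fil (j - c')"
    and gr0: "\<forall>P>C. Zgr i \<inter> {x \<in> carrier (Pgr (rk F i)). proj i P x = x} \<subseteq> Bgr i"
    and j: "j > C + c'"
  shows "Z i \<inter> W i j \<subseteq> B i"
proof
  fix z assume z: "z \<in> Z i \<inter> W i j"
  have "z \<in> U i (j - c')"
  proof (rule Fil_powerI)
    show "z \<in> carrier (PM (rk F i))" using z Z_carrier by blast
    fix l assume l: "l < rk F i"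
    have zW: "z l \<in> twist M G (gen_deg F i l) j" using z l by (auto simp: power_grading_def)
    show "z l \<in> Fil (j - c' - gen_deg F i l)"
    proof (cases "gen_deg F i l \<le> j")
      case True
      then have "z l \<in> Fil (j - gen_deg F i l - c')" using zW c'[of "j - gen_deg F i l"] by (auto simp: twist_def)
      then show ?thesis by (simp add: add.commute)
    next
      case False
      then show ?thesis using zW Fil_zero by (simp add: twist_def)
    qed
  qed
  then show "z \<in> B i" using high_degree_boundary[OF c gr0, of z j "j - c'"] z j by auto
qed

section \<open>From \<open>M\<close> to the associated graded module\<close>

lemma proj_Bgr:
  assumes "b \<in> Bgr i"
  shows "proj i P b \<in> Bgr i"
proof -
  obtain y where "y \<in> carrier (Pgr (rk F (Suc i)))" "b = res_map gr F i y"
    using assms by (auto simp: tor_boundaries_def)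
  then show ?thesis using res_map_proj gr_degree_power_closed by (auto simp: tor_boundaries_def)
qed

lemma lead_zero: "lead i P \<zero>\<^bsub>PM (rk F i)\<^esub> = \<zero>\<^bsub>Pgr (rk F i)\<^esub>"
  using leading_power_eq_zero_iff tclosedD(2)[OF tclosed_Fil_power] by blast

text \<open>A pair \<open>(p, x)\<close> records a lift together with the step in which its leading
  class is taken, since \<open>x\<close> alone does not determine that step.\<close>

definition leads :: "nat \<Rightarrow> (nat \<times> (nat \<Rightarrow> 'b)) list \<Rightarrow> (nat \<Rightarrow> nat \<Rightarrow> 'b set) list" where
  "leads i zs = map (\<lambda>(p, x). lead i p x) zs"

text \<open>Projection to degree \<open>P\<close> annihilates the leading classes of all other
  steps. What remains, modulo boundaries, is the leading class of a combination of the lifts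
  recorded for step \<open>P\<close>; without such lifts only a boundary remains.\<close>

lemma span_leads_proj:
  assumes zs: "\<And>p x. (p, x) \<in> set zs \<Longrightarrow> x \<in> Z i \<inter> U i p"
    and v: "v \<in> tspan (Pgr (rk F i)) (carrier k) (set (leads i zs) \<union> Bgr i)"
  shows "\<exists>w\<in>tspan (PM (rk F i)) (carrier k) {x. (P, x) \<in> set zs}. \<exists>b\<in>Bgr i.
    proj i P v = lead i P w \<oplus>\<^bsub>Pgr (rk F i)\<^esub> b"
proof -
  interpret Vg: vectorspace k "Pgr (rk F i)" by (rule vectorspace_Pgr)
  let ?T = "tspan (PM (rk F i)) (carrier k) {x. (P, x) \<in> set zs}"
  have TU: "?T \<subseteq> U i P"
    by (rule tspan_subset[OF tclosed_restrict_k[OF tclosed_Fil_power]]) (use zs in auto)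
  note Bc = tclosedD[OF tclosed_Bgr]
  have BP: "b \<in> Bgr i \<Longrightarrow> b \<in> carrier (Pgr (rk F i))" for b using Bc(1) by auto
  have TP: "w \<in> ?T \<Longrightarrow> lead i P w \<in> carrier (Pgr (rk F i))" for w
    using leading_power_closed subsetD[OF TU] by simp
  have SP: "set (leads i zs) \<union> Bgr i \<subseteq> carrier (Pgr (rk F i))"
    using zs leading_power_closed BP by (auto simp: leads_def)
  note vP = subsetD[OF tclosedD(1)[OF Vg.tclosed_tspan[OF order_refl SP]]]
  show ?thesis
    using v
  proof (induct rule: tspan.induct)
    case tspan_zero
    have "proj i P \<zero>\<^bsub>Pgr (rk F i)\<^esub> = lead i P \<zero>\<^bsub>PM (rk F i)\<^esub> \<oplus>\<^bsub>Pgr (rk F i)\<^esub> \<zero>\<^bsub>Pgr (rk F i)\<^esub>"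
      by (simp add: gr_degree_power_zero lead_zero)
    then show ?case using tspan.tspan_zero[of "PM (rk F i)"] Bc(2) by blast
  next
    case (tspan_base v)
    show ?case
    proof (cases "v \<in> Bgr i")
      case True
      have "proj i P v = lead i P \<zero>\<^bsub>PM (rk F i)\<^esub> \<oplus>\<^bsub>Pgr (rk F i)\<^esub> proj i P v"
        using BP[OF proj_Bgr[OF True]] by (simp add: lead_zero)
      then show ?thesis using tspan.tspan_zero[of "PM (rk F i)"] proj_Bgr[OF True] by blast
    next
      case False
      then obtain p x where px: "(p, x) \<in> set zs" "v = lead i p x" using tspan_base by (auto simp: leads_def)
      show ?thesis
      proof (cases "P = p")
        case True
        have x: "x \<in> ?T" using px True by (intro tspan.tspan_base) simp
        have "proj i P v = lead i P x \<oplus>\<^bsub>Pgr (rk F i)\<^esub> \<zero>\<^bsub>Pgr (rk F i)\<^esub>"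
          using px True TP[OF x] by (simp add: gr_degree_power_leading)
        then show ?thesis using x Bc(2) by blast
      next
        case False
        have "proj i P v = lead i P \<zero>\<^bsub>PM (rk F i)\<^esub> \<oplus>\<^bsub>Pgr (rk F i)\<^esub> \<zero>\<^bsub>Pgr (rk F i)\<^esub>"
          using px False by (simp add: gr_degree_power_leading lead_zero)
        then show ?thesis using tspan.tspan_zero[of "PM (rk F i)"] Bc(2) by blast
      qed
    qed
  next
    case (tspan_add u v)
    then obtain w b w' b' where h: "w \<in> ?T" "b \<in> Bgr i" "proj i P u = lead i P w \<oplus>\<^bsub>Pgr (rk F i)\<^esub> b"
      "w' \<in> ?T" "b' \<in> Bgr i" "proj i P v = lead i P w' \<oplus>\<^bsub>Pgr (rk F i)\<^esub> b'" by auto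
    have "proj i P (u \<oplus>\<^bsub>Pgr (rk F i)\<^esub> v) =
        lead i P (w \<oplus>\<^bsub>PM (rk F i)\<^esub> w') \<oplus>\<^bsub>Pgr (rk F i)\<^esub> (b \<oplus>\<^bsub>Pgr (rk F i)\<^esub> b')"
      using h TP BP Vg.add_interchange[of "lead i P w" b "lead i P w'" b']
        leading_power_add[OF subsetD[OF TU h(1)] subsetD[OF TU h(4)]]
      by (simp add: gr_degree_power_add)
    then show ?case using tspan.tspan_add[OF h(1,4)] Bc(3)[OF h(2,5)] by blast
  next
    case (tspan_smult t u)
    then obtain w b where h: "w \<in> ?T" "b \<in> Bgr i" "proj i P u = lead i P w \<oplus>\<^bsub>Pgr (rk F i)\<^esub> b" by auto
    have t: "t \<in> A 0" using tspan_smult(1) by simp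
    have "proj i P (t \<odot>\<^bsub>Pgr (rk F i)\<^esub> u) =
        lead i P (t \<odot>\<^bsub>PM (rk F i)\<^esub> w) \<oplus>\<^bsub>Pgr (rk F i)\<^esub> (t \<odot>\<^bsub>Pgr (rk F i)\<^esub> b)"
      using h TP BP t Vg.smult_r_distr[of t "lead i P w" b]
        leading_power_smult[OF subsetD[OF TU h(1)] t] gr_degree_power_smult[OF vP[OF tspan_smult(2)] t]
      by simp
    then show ?case using tspan.tspan_smult[OF tspan_smult(1) h(1)] Bc(4)[OF tspan_smult(1) h(2)] by blast
  qed
qed

text \<open>Modulo boundaries only cycles of degree at most \<open>C\<close> matter, and these lie
  in a finite-dimensional space.\<close>

lemma tor_M_finite:
  assumes fin: "\<And>j. \<exists>Y. finite Y \<and> Y \<subseteq> G j \<and> G j \<subseteq> tspan M (A 0) Y"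
    and van: "\<And>j. j > C \<Longrightarrow> Z i \<inter> W i j \<subseteq> B i"
  obtains Y where "finite Y" "Y \<subseteq> Z i" "Z i \<subseteq> tspan (PM (rk F i)) (carrier k) (Y \<union> B i)"
proof -
  let ?P = "PM (rk F i)"
  interpret V: vectorspace k ?P by (rule vectorspace_PM)
  interpret g: graded_group ?P "power_grading (gen_deg F i) (rk F i)" by (rule graded_group_power)
  have "\<forall>j. \<exists>Y. finite Y \<and> Y \<subseteq> carrier ?P \<and> W i j \<subseteq> tspan ?P (A 0) Y"
    using power_grading_finite_span[OF fin] by blast
  then obtain E where E: "\<forall>j. finite (E j) \<and> E j \<subseteq> carrier ?P \<and> W i j \<subseteq> tspan ?P (A 0) (E j)"
    unfolding choice_iff ..
  define E' where "E' = (\<Union>j\<in>{..C}. E j)"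
  have E': "finite E'" "E' \<subseteq> carrier ?P" using E by (auto simp: E'_def)
  have WE: "W i j \<subseteq> tspan ?P (carrier k) E'" if "j \<le> C" for j
  proof -
    have "W i j \<subseteq> tspan ?P (A 0) (E j)" using E by blast
    also have "\<dots> \<subseteq> tspan ?P (carrier k) E'" by (rule tspan_mono) (use that in \<open>auto simp: E'_def\<close>)
    finally show ?thesis .
  qed
  \<comment> \<open>Finite generation of a subspace is invoked so that the spanning set consists of
    cycles.\<close>
  define X where "X = Z i \<inter> tspan ?P (carrier k) E'"
  have X: "tclosed ?P (carrier k) X"
    unfolding X_def by (rule tclosed_Int[OF tclosed_Z V.tclosed_tspan[OF order_refl E'(2)]])
  have "subfield (carrier k) k" by (rule V.carrier_is_subfield)
  from tnoetherianD[OF V.tnoetherian_finite_span[OF this E'] X]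
  obtain Y where Y: "finite Y" "Y \<subseteq> X" "X \<subseteq> tspan ?P (carrier k) Y" by (auto simp: X_def)
  have sub: "tspan ?P (carrier k) Y \<subseteq> tspan ?P (carrier k) (Y \<union> B i)" by (rule tspan_mono) auto
  have "Z i \<subseteq> tspan ?P (carrier k) (Y \<union> B i)"
  proof
    fix z assume z: "z \<in> Z i"
    show "z \<in> tspan ?P (carrier k) (Y \<union> B i)"
    proof (rule power_comp_mem_imp[OF Z_carrier[OF z] tspan_zero tspan_add])
      fix j
      have zj: "part i j z \<in> Z i \<inter> W i j" using part_Z[OF z] power_comp_in[OF Z_carrier[OF z]] by simp
      show "part i j z \<in> tspan ?P (carrier k) (Y \<union> B i)"
      proof (cases "j \<le> C")
        case True
        then have "part i j z \<in> X" using zj WE[OF True] by (auto simp: X_def)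
        then show ?thesis using Y(3) sub by blast
      next
        case False
        then have "part i j z \<in> B i" using van[of j] zj by auto
        then show ?thesis by (intro tspan_base) simp
      qed
    qed
  qed
  then show ?thesis using that[of Y] Y by (auto simp: X_def)
qed

text \<open>The element is split by internal degree: above \<open>C\<close> the components are
  boundaries by assumption, and those of degree at most \<open>C\<close> vanish because
  \<open>P\<close> exceeds \<open>C + c\<close>.\<close>

lemma high_filtration_boundary:
  assumes c: "\<forall>p j. \<forall>x\<in>Fil p \<inter> G j. j + c < p \<longrightarrow> x = \<zero>\<^bsub>M\<^esub>"
    and van: "\<And>j. j > C \<Longrightarrow> Z i \<inter> W i j \<subseteq> B i"
    and z: "z \<in> Z i" "z \<in> U i P" "P > C + c"
  shows "z \<in> B i"
proof (rule power_comp_mem_imp[OF Z_carrier[OF z(1)] tclosedD(2,3)[OF tclosed_B]])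
  fix j
  have zj: "part i j z \<in> Z i" "part i j z \<in> W i j" "part i j z \<in> U i P"
    using part_Z[OF z(1)] power_comp_in[OF Z_carrier[OF z(1)]] power_comp_Fil_power[OF z(2)] by auto
  show "part i j z \<in> B i"
  proof (cases "j > C")
    case True
    then show ?thesis using van zj by blast
  next
    case False
    then have "part i j z = \<zero>\<^bsub>PM (rk F i)\<^esub>" using homogeneous_Fil_zero[OF c zj(3,2)] z(3) by simp
    then show ?thesis using tclosedD(2)[OF tclosed_B] by simp
  qed
qed auto

text \<open>If \<open>gr\<close> has a homology class in high filtration degree, then the classes of \<open>gr\<close> that lift
  to \<open>M\<close> span a space of dimension smaller than \<open>dim Tor(gr)\<close>; but their lifts span \<open>Tor(M)\<close>.\<close>

lemma tor_gr_vanishes: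
  assumes c: "\<forall>p j. \<forall>x\<in>Fil p \<inter> G j. j + c < p \<longrightarrow> x = \<zero>\<^bsub>M\<^esub>"
    and fin: "\<And>j. \<exists>Y. finite Y \<and> Y \<subseteq> G j \<and> G j \<subseteq> tspan M (A 0) Y"
    and van: "\<And>j. j > C \<Longrightarrow> Z i \<inter> W i j \<subseteq> B i"
    and eq: "vdim k (tor_res M F i) = vdim k (tor_res gr F i)"
    and P: "P > C + c"
  shows "Zgr i \<inter> {x \<in> carrier (Pgr (rk F i)). proj i P x = x} \<subseteq> Bgr i"
proof (rule ccontr)
  let ?P = "PM (rk F i)" and ?Pg = "Pgr (rk F i)"
  interpret V: vectorspace k ?P by (rule vectorspace_PM)
  interpret Vg: vectorspace k ?Pg by (rule vectorspace_Pgr)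
  assume "\<not> ?thesis"
  then obtain z0 where z0: "z0 \<in> Zgr i" "proj i P z0 = z0" "z0 \<notin> Bgr i" by blast
  have sfk: "subfield (carrier k) k" by (rule V.carrier_is_subfield)
  obtain Y where Y: "finite Y" "Y \<subseteq> Z i" "Z i \<subseteq> tspan ?P (carrier k) (Y \<union> B i)"
    by (rule tor_M_finite[OF fin van])
  have "vdim k (tor_res M F i) \<le> enat (card Y)"
    unfolding tor_res_def by (rule V.subquotient_generated[OF tclosed_Z tclosed_B Y])
  \<comment> \<open>The strict comparison at the end requires a finite dimension; equality of
    infinite ones would give no bound on the lists.\<close>
  then obtain n where n: "vdim k (tor_res M F i) = enat n" by (cases "vdim k (tor_res M F i)") auto
  have gn: "vdim k (subquotient ?Pg (Zgr i) (Bgr i)) \<le> enat n" using n eq by (simp add: tor_res_def)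
  obtain Y' where Y': "finite Y'" "Y' \<subseteq> Zgr i" "card Y' \<le> n" "Zgr i \<subseteq> tspan ?Pg (carrier k) (Y' \<union> Bgr i)"
    by (rule Vg.subquotient_generatedE[OF tclosed_Zgr tclosed_Bgr gn])
  have ZgP: "Zgr i \<subseteq> carrier ?Pg" and BgP: "Bgr i \<subseteq> carrier ?Pg"
    using tclosedD(1)[OF tclosed_Zgr] tclosedD(1)[OF tclosed_Bgr] by auto
  have len: "length xs \<le> n" if "indep_mod ?Pg (carrier k) (Bgr i) xs" "set xs \<subseteq> Zgr i" for xs
  proof -
    have "length xs \<le> card Y'"
      by (rule Vg.steinitz[OF sfk Y'(1) _ BgP that(1)]) (use Y' ZgP that(2) in auto)
    then show ?thesis using Y'(3) by simp
  qed
  \<comment> \<open>Lifts are taken in steps below \<open>P\<close> only, which keeps the presumed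
    class \<open>z0\<close> of degree \<open>P\<close> independent of their leading classes.\<close>
  define good where "good zs \<longleftrightarrow> (\<forall>(p, x)\<in>set zs. p < P \<and> x \<in> Z i \<inter> U i p) \<and>
    indep_mod ?Pg (carrier k) (Bgr i) (leads i zs)" for zs
  have goodD: "x \<in> Z i \<inter> U i p" "p < P" if "good zs" "(p, x) \<in> set zs" for zs p x
    using that by (auto simp: good_def)
  have leads_Z: "set (leads i zs) \<subseteq> Zgr i" if "good zs" for zs
    using goodD[OF that] lead_Z by (auto simp: leads_def)
  have "good []" by (simp add: good_def leads_def)
  moreover have "length zs \<le> n" if "good zs" for zs
    using len[of "leads i zs"] leads_Z[OF that] that by (simp add: good_def leads_def)
  \<comment> \<open>Lengths are bounded by \<open>n\<close>, so a longest list exists; its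
    maximality will force the lifts to span.\<close>
  ultimately have "\<exists>zs. good zs \<and> (\<forall>ys. good ys \<longrightarrow> length ys \<le> length zs)"
    by (intro ex_has_greatest_nat[of good "[]" length "Suc n"]) (simp_all add: less_Suc_eq_le)
  then obtain zs where zs: "good zs" "\<And>ys. good ys \<Longrightarrow> length ys \<le> length zs" by auto
  \<comment> \<open>No entry has step \<open>P\<close>, so a dependence would make
    \<open>z0\<close>, its own degree \<open>P\<close> part, a boundary. Thus \<open>z0\<close>
    lengthens the independent list by one.\<close>
  have short: "Suc (length zs) \<le> n"
  proof -
    have "z0 \<notin> tspan ?Pg (carrier k) (set (leads i zs) \<union> Bgr i)"
    proof
      assume "z0 \<in> tspan ?Pg (carrier k) (set (leads i zs) \<union> Bgr i)"
      from span_leads_proj[OF goodD(1)[OF zs(1)] this, of P]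
      obtain w b where w: "w \<in> tspan ?P (carrier k) {x. (P, x) \<in> set zs}" and b: "b \<in> Bgr i"
        "proj i P z0 = lead i P w \<oplus>\<^bsub>?Pg\<^esub> b" by blast
      have "{x. (P, x) \<in> set zs} \<subseteq> {\<zero>\<^bsub>?P\<^esub>}" using goodD(2)[OF zs(1)] by blast
      moreover have "tclosed ?P (carrier k) {\<zero>\<^bsub>?P\<^esub>}" by (simp add: tclosed_def)
      ultimately have "w = \<zero>\<^bsub>?P\<^esub>" using w tspan_subset by blast
      then have "z0 = b" using b z0(2) BgP by (auto simp: lead_zero)
      then show False using z0(3) b(1) by simp
    qed
    then have "indep_mod ?Pg (carrier k) (Bgr i) (z0 # leads i zs)" using zs(1) by (simp add: good_def)
    from len[OF this] show ?thesis using z0(1) leads_Z[OF zs(1)] by (simp add: leads_def)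
  qed
  define X where "X = snd ` set zs"
  have XZ: "X \<subseteq> Z i" using goodD(1)[OF zs(1)] by (auto simp: X_def)
  let ?T = "tspan ?P (carrier k) (X \<union> B i)"
  have XB: "X \<union> B i \<subseteq> carrier ?P" using XZ B_subset_Z Z_carrier by blast
  note Tc = tclosedD[OF V.tclosed_tspan[OF order_refl XB]]
  \<comment> \<open>Descending induction on depth: from step \<open>P\<close> on, cycles are
    boundaries, and below it a cycle is corrected by lifts and boundaries into the next
    step.\<close>
  have span: "z \<in> ?T" if "z \<in> Z i" "z \<in> U i p" for z p
    using that
  proof (induct "P - p" arbitrary: z p rule: less_induct)
    case less
    show ?case
    proof (cases "p < P")
      case False
      then have "z \<in> B i" using high_filtration_boundary[OF c van less(2,3)] P by simp
      then show ?thesis by (intro tspan_base) simp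
    next
      case True
      \<comment> \<open>Otherwise \<open>(p, z)\<close> could be prepended, contradicting
        maximality.\<close>
      have "lead i p z \<in> tspan ?Pg (carrier k) (set (leads i zs) \<union> Bgr i)"
      proof (rule ccontr)
        assume "lead i p z \<notin> tspan ?Pg (carrier k) (set (leads i zs) \<union> Bgr i)"
        then have "good ((p, z) # zs)" using zs(1) less True by (simp add: good_def leads_def)
        from zs(2)[OF this] show False by simp
      qed
      from span_leads_proj[OF goodD(1)[OF zs(1)] this, of p]
      obtain w b where w: "w \<in> tspan ?P (carrier k) {x. (p, x) \<in> set zs}" and b: "b \<in> Bgr i"
        "lead i p z = lead i p w \<oplus>\<^bsub>?Pg\<^esub> b" by (auto simp: gr_degree_power_leading)
      have "{x. (p, x) \<in> set zs} \<subseteq> Z i \<inter> U i p" using goodD(1)[OF zs(1)] by auto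
      from tspan_subset[OF tclosed_Int[OF tclosed_Z tclosed_restrict_k[OF tclosed_Fil_power]] this] w
      have wZ: "w \<in> Z i" and wU: "w \<in> U i p" by auto
      have "{x. (p, x) \<in> set zs} \<subseteq> X \<union> B i" by (force simp: X_def)
      from tspan_mono[OF this order_refl] w have wT: "w \<in> ?T" by blast
      \<comment> \<open>After subtracting \<open>w\<close> the leading class is the boundary
        \<open>b\<close>. Lifting it removes the class altogether, and the remainder lies in step
        \<open>Suc p\<close>.\<close>
      let ?y = "z \<ominus>\<^bsub>?P\<^esub> w"
      have yZ: "?y \<in> Z i" by (rule V.tclosed_diff[OF tclosed_Z less(2) wZ])
      have yU: "?y \<in> U i p" by (rule V.tclosed_diff[OF tclosed_restrict_k[OF tclosed_Fil_power] less(3) wU])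
      have "lead i p ?y = b"
        using leading_power_minus[OF less(3) wU] b leading_power_closed[OF wU] BgP
          Vg.add_minus_cancel_left[of "lead i p w" b "\<zero>\<^bsub>?Pg\<^esub>"]
          Vg.M.minus_equality[of "\<zero>\<^bsub>?Pg\<^esub>" "\<zero>\<^bsub>?Pg\<^esub>"]
        by (auto simp: Vg.M.minus_eq)
      then obtain u where u: "u \<in> U (Suc i) p" "?y \<ominus>\<^bsub>?P\<^esub> res_map M F i u \<in> U i (Suc p)"
        using lift_boundary[OF yU] b(1) by metis
      let ?d = "res_map M F i u"
      have dB: "?d \<in> B i" by (rule res_map_in_B[OF Fil_power_carrier[OF u(1)]])
      have "?y \<ominus>\<^bsub>?P\<^esub> ?d \<in> ?T"
      proof (rule less(1)[OF _ _ u(2)])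
        show "?y \<ominus>\<^bsub>?P\<^esub> ?d \<in> Z i" using V.tclosed_diff[OF tclosed_Z yZ] dB B_subset_Z by blast
      qed (use True in simp)
      moreover have "?d \<in> ?T" using dB by (intro tspan_base) simp
      ultimately have "(?y \<ominus>\<^bsub>?P\<^esub> ?d) \<oplus>\<^bsub>?P\<^esub> ?d \<oplus>\<^bsub>?P\<^esub> w \<in> ?T" using wT Tc(3) by simp
      moreover have "?d \<in> carrier ?P" "w \<in> carrier ?P" "z \<in> carrier ?P"
        using dB B_subset_Z Z_carrier wZ less(2) by blast+
      ultimately show ?thesis by (simp add: V.M.minus_eq V.M.a_assoc V.M.l_neg)
    qed
  qed
  have "Z i \<subseteq> ?T"
    using span[of _ 0] Z_carrier by (auto simp: Fil_power_0)
  then have "vdim k (tor_res M F i) \<le> enat (card X)"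
    unfolding tor_res_def by (intro V.subquotient_generated[OF tclosed_Z tclosed_B _ XZ]) (simp add: X_def)
  moreover have "card X \<le> length zs" unfolding X_def by (metis card_image_le card_length finite_set le_trans)
  \<comment> \<open>The dimension \<open>n\<close> of Tor of \<open>M\<close> is at most
    \<open>length zs\<close>, which is below \<open>n\<close>.\<close>
  ultimately show False using short n by simp
qed

end

section \<open>Regularity and the final comparison\<close>

text \<open>A natural bound \<open>C\<close> uniform in \<open>i\<close> replaces the supremum. If
  all graded Betti numbers vanish, the supremum is minus infinity, which counts as finite
  here.\<close>

lemma regularity_finite_iff:
  "regularity R A N H < \<infinity> \<longleftrightarrow> (\<exists>C. \<forall>i j. j > i + C \<longrightarrow> graded_betti R A N H i j = 0)"
proof
  assume "regularity R A N H < \<infinity>"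
  then obtain C :: nat where C: "regularity R A N H < ereal (real C)" using less_PInf_Ex_of_nat by auto
  have "graded_betti R A N H i j = 0" if "j > i + C" for i j
  proof (rule ccontr)
    assume "graded_betti R A N H i j \<noteq> 0"
    then have "ereal (real j - real i) \<le> regularity R A N H"
      unfolding regularity_def by (intro Sup_upper) blast
    then have "ereal (real j - real i) < ereal (real C)" using C by (rule le_less_trans)
    then show False using that by simp
  qed
  then show "\<exists>C. \<forall>i j. j > i + C \<longrightarrow> graded_betti R A N H i j = 0" by blast
next
  assume "\<exists>C. \<forall>i j. j > i + C \<longrightarrow> graded_betti R A N H i j = 0"
  then obtain C where C: "\<And>i j. j > i + C \<Longrightarrow> graded_betti R A N H i j = 0" by blast
  have "regularity R A N H \<le> ereal (real C)"
    unfolding regularity_def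
  proof (rule Sup_least)
    fix x assume "x \<in> {ereal (real j - real i) | i j. graded_betti R A N H i j \<noteq> 0}"
    then obtain i j where x: "x = ereal (real j - real i)" "graded_betti R A N H i j \<noteq> 0" by blast
    then have "j \<le> i + C" using C[of i j] by fastforce
    then show "x \<le> ereal (real C)" using x(1) by simp
  qed
  then show "regularity R A N H < \<infinity>" by (rule le_less_trans) simp
qed

context standard_graded_algebra
begin

text \<open>Exactness at \<open>F i + 1\<close> is evaluated on unit vectors: the image of a unit
  vector is a column of the next matrix, and the preceding differential kills it.\<close>

lemma graded_free_resolution_complex:
  assumes F: "graded_free_resolution R A B H F"
  shows "r < rk F i \<Longrightarrow> c < rk F (Suc i) \<Longrightarrow> dmat F i r c \<in> twist R A (gen_deg F i r) (gen_deg F (Suc i) c)"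
    and "r < rk F i \<Longrightarrow> s < rk F (Suc (Suc i)) \<Longrightarrow>
      (\<Oplus>c\<in>{..<rk F (Suc i)}. dmat F i r c \<otimes> dmat F (Suc i) c s) = \<zero>"
proof -
  let ?S = "self_module R"
  interpret S: graded_module R A ?S A by (rule graded_module_self)
  from F have hom: "\<forall>i. \<forall>r<rk F i. \<forall>c<rk F (Suc i). dmat F i r c \<in> twist R A (gen_deg F i r) (gen_deg F (Suc i) c)"
    unfolding graded_free_resolution_def Let_def by (elim conjE) assumption
  from F have exact: "\<forall>i. res_map ?S F (Suc i) ` carrier (power_module ?S (rk F (Suc (Suc i)))) =
      {x \<in> carrier (power_module ?S (rk F (Suc i))). res_map ?S F i x = \<zero>\<^bsub>power_module ?S (rk F i)\<^esub>}"
    unfolding graded_free_resolution_def Let_def by (elim conjE) assumption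
  show h: "dmat F i r c \<in> twist R A (gen_deg F i r) (gen_deg F (Suc i) c)"
    if "r < rk F i" "c < rk F (Suc i)" for i r c using hom that by simp
  have hR: "dmat F i r c \<in> carrier R" if "r < rk F i" "c < rk F (Suc i)" for i r c
    using S.twist_R_carrier[OF h[OF that]] .
  assume r: "r < rk F i" and s: "s < rk F (Suc (Suc i))"
  have "res_map ?S F (Suc i) (unit_vector (rk F (Suc (Suc i))) s) \<in>
      res_map ?S F (Suc i) ` carrier (power_module ?S (rk F (Suc (Suc i))))"
    using unit_vector_carrier by (rule imageI)
  also have "\<dots> = {x \<in> carrier (power_module ?S (rk F (Suc i))). res_map ?S F i x = \<zero>\<^bsub>power_module ?S (rk F i)\<^esub>}"
    using exact by (rule spec)
  finally have "res_map ?S F i (res_map ?S F (Suc i) (unit_vector (rk F (Suc (Suc i))) s)) r =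
      \<zero>\<^bsub>power_module ?S (rk F i)\<^esub> r" by simp
  moreover have "res_map ?S F (Suc i) (unit_vector (rk F (Suc (Suc i))) s) =
      (\<lambda>c\<in>{..<rk F (Suc i)}. dmat F (Suc i) c s)"
    unfolding res_map_def by (rule matrix_map_unit_vector[OF hR s])
  ultimately have "(\<Oplus>c\<in>{..<rk F (Suc i)}. dmat F i r c \<otimes> (\<lambda>c\<in>{..<rk F (Suc i)}. dmat F (Suc i) c s) c) = \<zero>"
    using r by (simp add: res_map_def matrix_map_apply power_module_simps self_module_simps finsum_self_module)
  moreover have "(\<Oplus>c\<in>{..<rk F (Suc i)}. dmat F i r c \<otimes> (\<lambda>c\<in>{..<rk F (Suc i)}. dmat F (Suc i) c s) c)
      = (\<Oplus>c\<in>{..<rk F (Suc i)}. dmat F i r c \<otimes> dmat F (Suc i) c s)"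
    by (rule finsum_cong') (use hR r s in auto)
  ultimately show "(\<Oplus>c\<in>{..<rk F (Suc i)}. dmat F i r c \<otimes> dmat F (Suc i) c s) = \<zero>" by simp
qed

end

lemma (in stable_graded_filtration) filtered_complex_chosen_resolution:
  "filtered_complex R A M G Fil (chosen_resolution R A (residue_module R A) (residue_grading R A))"
  by (intro filtered_complex.intro filtered_complex_axioms.intro stable_graded_filtration_axioms
      graded_free_resolution_complex[OF chosen_resolution])

theorem corollary2p6:
  fixes R :: "('a, 'r) ring_scheme"
    and A :: "nat \<Rightarrow> 'a set"
    and M :: "('a, 'b, 'm) module_scheme"
    and G :: "nat \<Rightarrow> 'b set"
    and Fil :: "nat \<Rightarrow> 'b set"
  assumes "standard_graded_algebra R A"
    and "graded_module R A M G"
    and "finitely_generated_module R M"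
    and "carrier M \<noteq> {\<zero>\<^bsub>M\<^esub>}"
    and "stable_graded_filtration R A M G Fil"
  shows "(regularity R A (assoc_graded R A M Fil) (assoc_grading R A M Fil) < \<infinity> \<longrightarrow>
            regularity R A M G < \<infinity>) \<and>
         (homogeneous_type R A M Fil \<longrightarrow> regularity R A M G < \<infinity> \<longrightarrow>
            regularity R A (assoc_graded R A M Fil) (assoc_grading R A M Fil) < \<infinity>)"
proof -
  define F where "F = chosen_resolution R A (residue_module R A) (residue_grading R A)"
  interpret stable_graded_filtration R A M G Fil by fact
  interpret filtered_complex R A M G Fil F unfolding F_def by (rule filtered_complex_chosen_resolution)
  obtain c where c: "\<forall>p j. \<forall>x\<in>Fil p \<inter> G j. j + c < p \<longrightarrow> x = \<zero>\<^bsub>M\<^esub>"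
    using Fil_degree_bound ..
  obtain c' where c': "\<forall>j. G j \<subseteq> Fil (j - c')"
    using finitely_generated_degrees(1)[OF assms(3)] ..
  have bM: "graded_betti R A M G i j = 0 \<longleftrightarrow> Z i \<inter> W i j \<subseteq> B i" for i j
    using tor_degree_M_eq_0_iff by (simp add: graded_betti_def Tor_degree_def ground_field_of_def F_def)
  have bgr: "graded_betti R A (assoc_graded R A M Fil) (assoc_grading R A M Fil) i P = 0 \<longleftrightarrow>
      Zgr i \<inter> {x \<in> carrier (Pgr (rk F i)). proj i P x = x} \<subseteq> Bgr i" for i P
    using tor_degree_gr_eq_0_iff by (simp add: graded_betti_def Tor_degree_def ground_field_of_def F_def)
  show ?thesis
  proof (intro conjI impI)
    assume "regularity R A (assoc_graded R A M Fil) (assoc_grading R A M Fil) < \<infinity>"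
    then obtain C where C: "\<And>i P. P > i + C \<Longrightarrow> Zgr i \<inter> {x \<in> carrier (Pgr (rk F i)). proj i P x = x} \<subseteq> Bgr i"
      unfolding regularity_finite_iff bgr by blast
    \<comment> \<open>For fixed \<open>i\<close> the vanishing bound is \<open>i + C\<close>; the
      shift \<open>c'\<close> is the same for all \<open>i\<close>, so the new bound again has the
      form \<open>i\<close> plus a constant.\<close>
    have "Z i \<inter> W i j \<subseteq> B i" if "j > i + (C + c')" for i j
      by (rule tor_M_vanishes[OF c c'[rule_format], of "i + C"]) (use C that in auto)
    then show "regularity R A M G < \<infinity>" unfolding regularity_finite_iff bM by blast
  next
    assume ht: "homogeneous_type R A M Fil" and "regularity R A M G < \<infinity>"
    then obtain C where C: "\<And>i j. j > i + C \<Longrightarrow> Z i \<inter> W i j \<subseteq> B i"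
      unfolding regularity_finite_iff bM by blast
    have eq: "vdim k (tor_res M F i) = vdim k (tor_res gr F i)" for i
      using ht by (simp add: homogeneous_type_def betti_def Tor_def ground_field_of_def F_def)
    \<comment> \<open>Here the shift is \<open>c\<close>, the constant that bounds the filtration
      depth by the degree; it is likewise independent of \<open>i\<close>.\<close>
    have "Zgr i \<inter> {x \<in> carrier (Pgr (rk F i)). proj i P x = x} \<subseteq> Bgr i" if "P > i + (C + c)" for i P
      by (rule tor_gr_vanishes[OF c finitely_generated_degrees(2)[OF assms(3)] C eq]) (use that in auto)
    then show "regularity R A (assoc_graded R A M Fil) (assoc_grading R A M Fil) < \<infinity>"
      unfolding regularity_finite_iff bgr by blast
  qed
qed

end
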